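(* Let $R$ be a standard graded $k$-algebra over a field $k$ with homogeneous maximal ideal $\mathfrak{m}$, and let $I$ be a homogeneous ideal of $R$. Set $d=\dim(R/I)$. Assume there is a constant $c'$ such that $$\operatorname{beg}\bigl(\operatorname{Ext}^i_R(k, H^j_{\mathfrak{m}}(R/I^t))\bigr)\geq -c't$$ for all $j<d$, all $i<d+2$ and all $t\geq 1$. Then there exists a constant $c$ such that $$\operatorname{beg}\bigl(\operatorname{Soc}(H^d_{\mathfrak{m}}(R/I^t))\bigr)\geq -ct$$ for all $t\geq 1$.
   Context: A standard graded $k$-algebra is $R=k[x_1,\dots,x_n]/\mathfrak{a}$, where $k[x_1,\dots,x_n]$ has the standard grading ($\deg x_i=1$) and $\mathfrak{a}$ is a homogeneous ideal; $\mathfrak{m}=(x_1,\dots,x_n)$ denotes the homogeneous maximal ideal of $R$, and $k=R/\mathfrak{m}$ is viewed as a graded $R$-module. For a graded $R$-module $M$, $\operatorname{beg}(M):=\inf\{i\mid M_i\neq 0\}$ (so $\operatorname{beg}(0)=+\infty$), and $\operatorname{Soc}(M):=\{z\in M\mid \mathfrak{m}z=0\}=\operatorname{Hom}_R(R/\mathfrak{m},M)$. The local cohomology modules $H^j_{\mathfrak{m}}(-)$ and the $\operatorname{Ext}$ modules carry their natural gradings. *)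

theory Defs
  imports
    "HOL-Algebra.Ideal_Product"
    "HOL-Algebra.QuotRing"
    "HOL-Algebra.Module"
    "HOL-Library.Poly_Mapping"
    "HOL-Library.Extended_Nat"
    "HOL-Library.Extended_Real"
begin

section \<open>Graded rings and graded modules\<close>

text \<open>
  All gradings are by the integers and internal: \<open>part R i\<close> and \<open>component M i\<close> are the sets
  of homogeneous elements of degree \<open>i\<close>, zero included.  The fields \<open>mult\<close> and \<open>one\<close> that the
  library's module record inherits from the ring record play no role in a module.
\<close>

record 'a graded_ring = "'a ring" +
  part :: "int \<Rightarrow> 'a set"

record ('a, 'b) graded_module = "('a, 'b) module" +
  component :: "int \<Rightarrow> 'b set"

definition homogeneous_ideal :: "'a graded_ring \<Rightarrow> 'a set \<Rightarrow> bool" where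
  "homogeneous_ideal R J \<longleftrightarrow>
     ideal J R \<and> (\<exists>S \<subseteq> (\<Union>i. part R i). J = Idl\<^bsub>R\<^esub> S)"

definition quotient_ring :: "'a graded_ring \<Rightarrow> 'a set \<Rightarrow> 'a set graded_ring" where
  "quotient_ring R J =
     \<lparr>carrier = carrier (R Quot J), mult = mult (R Quot J), one = one (R Quot J),
      zero = zero (R Quot J), add = add (R Quot J),
      part = (\<lambda>i. (\<lambda>r. J +>\<^bsub>R\<^esub> r) ` part R i)\<rparr>"

primrec ideal_power :: "'a graded_ring \<Rightarrow> 'a set \<Rightarrow> nat \<Rightarrow> 'a set" where
  "ideal_power R J 0 = carrier R"
| "ideal_power R J (Suc t) = ideal_prod R (ideal_power R J t) J"

text \<open>The supremum of the lengths of chains of prime ideals; it is 0 for the zero ring.\<close>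

definition krull_dim :: "('a, 'm) ring_scheme \<Rightarrow> enat" where
  "krull_dim S =
     Sup {enat l | l. \<exists>P. (\<forall>i\<le>l. primeideal (P i) S) \<and> (\<forall>i<l. P i \<subset> P (Suc i))}"

text \<open>In particular \<open>beg M = \<infinity>\<close> if all components of \<open>M\<close> vanish, and \<open>beg M = -\<infinity>\<close> if
  nonzero components occur in arbitrarily negative degrees.\<close>

definition beg :: "('a, 'b) graded_module \<Rightarrow> ereal" where
  "beg M = Inf {ereal (real_of_int i) | i. component M i \<noteq> {\<zero>\<^bsub>M\<^esub>}}"

definition Soc :: "'a set \<Rightarrow> ('a, 'b) graded_module \<Rightarrow> ('a, 'b) graded_module" where
  "Soc J M =
     (let Z = {z \<in> carrier M. \<forall>r\<in>J. r \<odot>\<^bsub>M\<^esub> z = \<zero>\<^bsub>M\<^esub>}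
      in M\<lparr>carrier := Z, component := (\<lambda>i. Z \<inter> component M i)\<rparr>)"

definition regular_module :: "'a graded_ring \<Rightarrow> ('a, 'a) graded_module" where
  "regular_module R =
     \<lparr>carrier = carrier R, mult = mult R, one = one R, zero = zero R, add = add R,
      smult = mult R, component = part R\<rparr>"

text \<open>The subquotient \<open>Z/B\<close> of \<open>M\<close>, for graded submodules \<open>B \<subseteq> Z\<close> of \<open>M\<close>.  In the scalar
  multiplication the sets in the union all coincide.\<close>

definition subquotient ::
  "('a, 'b) graded_module \<Rightarrow> 'b set \<Rightarrow> 'b set \<Rightarrow> ('a, 'b set) graded_module" where
  "subquotient M Z B =
     \<lparr>carrier = (\<lambda>z. B +>\<^bsub>M\<^esub> z) ` Z,
      mult = undefined, one = undefined,
      zero = B,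
      add = set_add M,
      smult = (\<lambda>r X. \<Union>z\<in>X. B +>\<^bsub>M\<^esub> (r \<odot>\<^bsub>M\<^esub> z)),
      component = (\<lambda>i. (\<lambda>z. B +>\<^bsub>M\<^esub> z) ` (Z \<inter> component M i))\<rparr>"

abbreviation quotient_module ::
  "'a graded_ring \<Rightarrow> 'a set \<Rightarrow> ('a, 'a set) graded_module" where
  "quotient_module R J \<equiv> subquotient (regular_module R) (carrier R) J"

text \<open>Cohomology in degree \<open>j\<close> of a complex \<open>C 0 \<rightarrow> C 1 \<rightarrow> C 2 \<rightarrow> \<dots>\<close> whose differentials
  \<open>D j\<close> from \<open>C j\<close> to \<open>C (Suc j)\<close> preserve degrees.\<close>

definition cohomology ::
  "(nat \<Rightarrow> ('a, 'b) graded_module) \<Rightarrow> (nat \<Rightarrow> 'b \<Rightarrow> 'b) \<Rightarrow> nat \<Rightarrow> ('a, 'b set) graded_module" where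
  "cohomology C D j =
     subquotient (C j)
       {z \<in> carrier (C j). D j z = \<zero>\<^bsub>C (Suc j)\<^esub>}
       (case j of 0 \<Rightarrow> {\<zero>\<^bsub>C 0\<^esub>} | Suc l \<Rightarrow> D l ` carrier (C l))"


section \<open>Ext modules\<close>

text \<open>The module of all linear maps from \<open>M\<close> to \<open>N\<close>, made unique as functions by taking them
  extensional.  The component of degree \<open>a\<close> consists of the maps that raise degrees by \<open>a\<close>;
  if \<open>M\<close> is finitely generated, these components span the whole module.\<close>

definition hom_module ::
  "'a graded_ring \<Rightarrow> ('a, 'b) graded_module \<Rightarrow> ('a, 'c) graded_module
     \<Rightarrow> ('a, 'b \<Rightarrow> 'c) graded_module" where
  "hom_module R M N =
     (let H = {\<phi> \<in> carrier M \<rightarrow>\<^sub>E carrier N.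
            (\<forall>v\<in>carrier M. \<forall>w\<in>carrier M. \<phi> (v \<oplus>\<^bsub>M\<^esub> w) = \<phi> v \<oplus>\<^bsub>N\<^esub> \<phi> w) \<and>
            (\<forall>r\<in>carrier R. \<forall>v\<in>carrier M. \<phi> (r \<odot>\<^bsub>M\<^esub> v) = r \<odot>\<^bsub>N\<^esub> \<phi> v)}
      in \<lparr>carrier = H,
          mult = undefined, one = undefined,
          zero = (\<lambda>v\<in>carrier M. \<zero>\<^bsub>N\<^esub>),
          add = (\<lambda>\<phi> \<psi>. \<lambda>v\<in>carrier M. \<phi> v \<oplus>\<^bsub>N\<^esub> \<psi> v),
          smult = (\<lambda>r \<phi>. \<lambda>v\<in>carrier M. r \<odot>\<^bsub>N\<^esub> \<phi> v),
          component = (\<lambda>a. {\<phi> \<in> H. \<forall>e. \<phi> ` component M e \<subseteq> component N (e + a)})\<rparr>)"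

text \<open>The graded free module \<open>R(-s 0) \<oplus> \<dots> \<oplus> R(-s (b - 1))\<close>: the \<open>l\<close>-th basis vector has
  degree \<open>s l\<close>.\<close>

definition free_module ::
  "'a graded_ring \<Rightarrow> nat \<Rightarrow> (nat \<Rightarrow> int) \<Rightarrow> ('a, nat \<Rightarrow> 'a) graded_module" where
  "free_module R b s =
     \<lparr>carrier = {..<b} \<rightarrow>\<^sub>E carrier R,
      mult = undefined, one = undefined,
      zero = (\<lambda>l\<in>{..<b}. \<zero>\<^bsub>R\<^esub>),
      add = (\<lambda>v w. \<lambda>l\<in>{..<b}. v l \<oplus>\<^bsub>R\<^esub> w l),
      smult = (\<lambda>r v. \<lambda>l\<in>{..<b}. r \<otimes>\<^bsub>R\<^esub> v l),
      component = (\<lambda>i. \<Pi>\<^sub>E l\<in>{..<b}. part R (i - s l))\<rparr>"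

text \<open>Data for a complex \<open>\<dots> \<rightarrow> F 2 \<rightarrow> F 1 \<rightarrow> F 0 \<rightarrow> M\<close> of graded free modules of finite rank:
  \<open>fdiff X i\<close> goes from \<open>F (Suc i)\<close> to \<open>F i\<close>, and \<open>faug X\<close> from \<open>F 0\<close> to \<open>M\<close>.\<close>

record ('a, 'b) free_data =
  frank :: "nat \<Rightarrow> nat"
  fshift :: "nat \<Rightarrow> nat \<Rightarrow> int"
  fdiff :: "nat \<Rightarrow> (nat \<Rightarrow> 'a) \<Rightarrow> (nat \<Rightarrow> 'a)"
  faug :: "(nat \<Rightarrow> 'a) \<Rightarrow> 'b"

definition fmod ::
  "'a graded_ring \<Rightarrow> ('a, 'b) free_data \<Rightarrow> nat \<Rightarrow> ('a, nat \<Rightarrow> 'a) graded_module" where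
  "fmod R X i = free_module R (frank X i) (fshift X i)"

definition graded_free_resolution ::
  "'a graded_ring \<Rightarrow> ('a, 'b) graded_module \<Rightarrow> ('a, 'b) free_data \<Rightarrow> bool" where
  "graded_free_resolution R M X \<longleftrightarrow>
     faug X \<in> component (hom_module R (fmod R X 0) M) 0 \<and>
     (\<forall>i. fdiff X i \<in> component (hom_module R (fmod R X (Suc i)) (fmod R X i)) 0) \<and>
     faug X ` carrier (fmod R X 0) = carrier M \<and>
     {v \<in> carrier (fmod R X 0). faug X v = \<zero>\<^bsub>M\<^esub>} = fdiff X 0 ` carrier (fmod R X 1) \<and>
     (\<forall>i. {v \<in> carrier (fmod R X (Suc i)). fdiff X i v = \<zero>\<^bsub>fmod R X i\<^esub>}
            = fdiff X (Suc i) ` carrier (fmod R X (Suc (Suc i))))"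

text \<open>\<open>Ext\<^sup>i(M, N)\<close> with its natural grading, for a finitely generated graded module \<open>M\<close> over a
  Noetherian graded ring \<open>R\<close>: the cohomology of \<open>Hom(F, N)\<close> for a graded free resolution \<open>F\<close>
  of \<open>M\<close> by modules of finite rank.  Such a resolution exists under these hypotheses, and
  another choice gives an isomorphic graded module.\<close>

definition Ext ::
  "'a graded_ring \<Rightarrow> nat \<Rightarrow> ('a, 'b) graded_module \<Rightarrow> ('a, 'c) graded_module
     \<Rightarrow> ('a, ((nat \<Rightarrow> 'a) \<Rightarrow> 'c) set) graded_module" where
  "Ext R i M N =
     (let X = (SOME X. graded_free_resolution R M X)
      in cohomology
           (\<lambda>p. hom_module R (fmod R X p) N)
           (\<lambda>p \<phi>. \<lambda>v\<in>carrier (fmod R X (Suc p)). \<phi> (fdiff X p v))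
           i)"


section \<open>Local cohomology\<close>

text \<open>The localization \<open>M\<^sub>f\<close>, for \<open>f\<close> homogeneous of degree \<open>e\<close>.  The fraction \<open>m/f\<^sup>s\<close> is the
  set of all pairs \<open>(m', s')\<close> with \<open>f\<^sup>u(f\<^sup>s\<^sup>' m - f\<^sup>s m') = 0\<close> for some \<open>u\<close>, and its degree is
  \<open>deg m - s e\<close>.  In the operations the sets in the unions all coincide.\<close>

definition fraction ::
  "'a graded_ring \<Rightarrow> ('a, 'b) graded_module \<Rightarrow> 'a \<Rightarrow> 'b \<Rightarrow> nat \<Rightarrow> ('b \<times> nat) set" where
  "fraction R M f m s =
     {(m', s'). m' \<in> carrier M \<and>
        (\<exists>u::nat. (f [^]\<^bsub>R\<^esub> (u + s')) \<odot>\<^bsub>M\<^esub> m = (f [^]\<^bsub>R\<^esub> (u + s)) \<odot>\<^bsub>M\<^esub> m')}"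

definition localization ::
  "'a graded_ring \<Rightarrow> ('a, 'b) graded_module \<Rightarrow> 'a \<Rightarrow> int
     \<Rightarrow> ('a, ('b \<times> nat) set) graded_module" where
  "localization R M f e =
     \<lparr>carrier = {fraction R M f m s | m s. m \<in> carrier M},
      mult = undefined, one = undefined,
      zero = fraction R M f \<zero>\<^bsub>M\<^esub> 0,
      add = (\<lambda>X Y. \<Union>(m, s)\<in>X. \<Union>(m', s')\<in>Y.
               fraction R M f
                 ((f [^]\<^bsub>R\<^esub> s') \<odot>\<^bsub>M\<^esub> m \<oplus>\<^bsub>M\<^esub> (f [^]\<^bsub>R\<^esub> s) \<odot>\<^bsub>M\<^esub> m') (s + s')),
      smult = (\<lambda>r X. \<Union>(m, s)\<in>X. fraction R M f (r \<odot>\<^bsub>M\<^esub> m) s),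
      component = (\<lambda>i. {fraction R M f m s | m s. m \<in> component M (i + int s * e)})\<rparr>"

text \<open>The Cech complex of \<open>M\<close> on elements \<open>x 0, \<dots>, x (n - 1)\<close> of degree 1.  Its term in degree
  \<open>j\<close> is the direct sum of the localizations of \<open>M\<close> at the products \<open>x\<^sub>S\<close> of the \<open>x i\<close> with
  \<open>i \<in> S\<close>, over the \<open>j\<close>-element sets \<open>S\<close> of indices.\<close>

definition cech_local ::
  "'a graded_ring \<Rightarrow> (nat \<Rightarrow> 'a) \<Rightarrow> ('a, 'b) graded_module \<Rightarrow> nat set
     \<Rightarrow> ('a, ('b \<times> nat) set) graded_module" where
  "cech_local R x M S = localization R M (\<Otimes>\<^bsub>R\<^esub>i\<in>S. x i) (int (card S))"

definition cech_index :: "nat \<Rightarrow> nat \<Rightarrow> nat set set" where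
  "cech_index n j = {S. S \<subseteq> {..<n} \<and> card S = j}"

definition cech_module ::
  "'a graded_ring \<Rightarrow> nat \<Rightarrow> (nat \<Rightarrow> 'a) \<Rightarrow> ('a, 'b) graded_module \<Rightarrow> nat
     \<Rightarrow> ('a, nat set \<Rightarrow> ('b \<times> nat) set) graded_module" where
  "cech_module R n x M j =
     \<lparr>carrier = (\<Pi>\<^sub>E S\<in>cech_index n j. carrier (cech_local R x M S)),
      mult = undefined, one = undefined,
      zero = (\<lambda>S\<in>cech_index n j. \<zero>\<^bsub>cech_local R x M S\<^esub>),
      add = (\<lambda>c c'. \<lambda>S\<in>cech_index n j. c S \<oplus>\<^bsub>cech_local R x M S\<^esub> c' S),
      smult = (\<lambda>r c. \<lambda>S\<in>cech_index n j. r \<odot>\<^bsub>cech_local R x M S\<^esub> c S),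
      component = (\<lambda>i. \<Pi>\<^sub>E S\<in>cech_index n j. component (cech_local R x M S) i)\<rparr>"

text \<open>For \<open>i \<in> T\<close>, the canonical map from the localization at \<open>x\<^sub>S\<close>, \<open>S = T - {i}\<close>, to the one
  at \<open>x\<^sub>T\<close>, which sends \<open>m/x\<^sub>S\<^sup>s\<close> to \<open>x\<^sub>i\<^sup>s m/x\<^sub>T\<^sup>s\<close>.\<close>

definition cech_restrict ::
  "'a graded_ring \<Rightarrow> (nat \<Rightarrow> 'a) \<Rightarrow> ('a, 'b) graded_module \<Rightarrow> nat set \<Rightarrow> nat
     \<Rightarrow> ('b \<times> nat) set \<Rightarrow> ('b \<times> nat) set" where
  "cech_restrict R x M T i Y =
     (\<Union>(m, s)\<in>Y. fraction R M (\<Otimes>\<^bsub>R\<^esub>l\<in>T. x l) ((x i [^]\<^bsub>R\<^esub> s) \<odot>\<^bsub>M\<^esub> m) s)"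

definition cech_diff ::
  "'a graded_ring \<Rightarrow> nat \<Rightarrow> (nat \<Rightarrow> 'a) \<Rightarrow> ('a, 'b) graded_module \<Rightarrow> nat
     \<Rightarrow> (nat set \<Rightarrow> ('b \<times> nat) set) \<Rightarrow> (nat set \<Rightarrow> ('b \<times> nat) set)" where
  "cech_diff R n x M j c =
     (\<lambda>T\<in>cech_index n (Suc j).
        \<Oplus>\<^bsub>cech_local R x M T\<^esub>i\<in>T.
          (let y = cech_restrict R x M T i (c (T - {i}))
           in if even (card {l \<in> T. l < i}) then y else \<ominus>\<^bsub>cech_local R x M T\<^esub> y))"

text \<open>The local cohomology modules of \<open>M\<close> with support in the ideal generated by
  \<open>x 0, \<dots>, x (n - 1)\<close> (elements of degree 1 of a Noetherian graded ring), with their natural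
  grading.\<close>

definition local_cohomology ::
  "'a graded_ring \<Rightarrow> nat \<Rightarrow> (nat \<Rightarrow> 'a) \<Rightarrow> nat \<Rightarrow> ('a, 'b) graded_module
     \<Rightarrow> ('a, (nat set \<Rightarrow> ('b \<times> nat) set) set) graded_module" where
  "local_cohomology R n x j M = cohomology (cech_module R n x M) (cech_diff R n x M) j"


section \<open>Standard graded algebras\<close>

text \<open>The polynomial ring over \<open>'k\<close> in the variables with indices \<open>0, \<dots>, n - 1\<close>, with its
  standard grading.\<close>

definition std_poly_ring :: "nat \<Rightarrow> ((nat \<Rightarrow>\<^sub>0 nat) \<Rightarrow>\<^sub>0 'k::field) graded_ring" where
  "std_poly_ring n =
     (let A = {p. \<forall>\<mu> \<in> Poly_Mapping.keys p. Poly_Mapping.keys \<mu> \<subseteq> {..<n}}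
      in \<lparr>carrier = A, mult = (*), one = 1, zero = 0, add = (+),
          part = (\<lambda>i. {p \<in> A. \<forall>\<mu> \<in> Poly_Mapping.keys p.
                    int (\<Sum>l\<in>Poly_Mapping.keys \<mu>. Poly_Mapping.lookup \<mu> l) = i})\<rparr>)"

definition poly_var :: "nat \<Rightarrow> (nat \<Rightarrow>\<^sub>0 nat) \<Rightarrow>\<^sub>0 'k::field" where
  "poly_var i = Poly_Mapping.single (Poly_Mapping.single i 1) 1"

definition std_graded_algebra ::
  "nat \<Rightarrow> ((nat \<Rightarrow>\<^sub>0 nat) \<Rightarrow>\<^sub>0 'k::field) set
     \<Rightarrow> ((nat \<Rightarrow>\<^sub>0 nat) \<Rightarrow>\<^sub>0 'k) set graded_ring" where
  "std_graded_algebra n \<aa> = quotient_ring (std_poly_ring n) \<aa>"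

definition alg_gen ::
  "nat \<Rightarrow> ((nat \<Rightarrow>\<^sub>0 nat) \<Rightarrow>\<^sub>0 'k::field) set \<Rightarrow> nat \<Rightarrow> ((nat \<Rightarrow>\<^sub>0 nat) \<Rightarrow>\<^sub>0 'k) set" where
  "alg_gen n \<aa> i = \<aa> +>\<^bsub>std_poly_ring n\<^esub> poly_var i"

definition max_ideal ::
  "nat \<Rightarrow> ((nat \<Rightarrow>\<^sub>0 nat) \<Rightarrow>\<^sub>0 'k::field) set \<Rightarrow> ((nat \<Rightarrow>\<^sub>0 nat) \<Rightarrow>\<^sub>0 'k) set set" where
  "max_ideal n \<aa> = Idl\<^bsub>std_graded_algebra n \<aa>\<^esub> (alg_gen n \<aa> ` {..<n})"

end

theory Submission
  imports Defs "HOL-Library.Product_Lexorder"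
begin

text \<open>The spectral sequence \<open>Ext\<^sup>i(k, H\<^sup>j(M)) \<Longrightarrow> Ext\<^sup>i\<^sup>+\<^sup>j(k, M)\<close> for \<open>M = R/I\<^sup>t\<close> is replaced by a chase in the
  double complex \<open>Hom(F, C)\<close>, where \<open>F\<close> is a graded free resolution of \<open>k\<close> and \<open>C\<close> is the Cech
  complex of \<open>M\<close>.  A socle element of \<open>H\<^sup>d(M)\<close> of degree \<open>a\<close> gives an element of \<open>Hom(F\<^sub>0, C\<^sup>d)\<close>, which
  is continued to a zigzag with members in \<open>Hom(F\<^sub>r, C\<^sup>d\<^sup>-\<^sup>r)\<close>; the obstruction against the next step
  lies in \<open>Ext\<^sup>r\<^sup>+\<^sup>1(k, H\<^sup>d\<^sup>-\<^sup>r(M))\<close> and vanishes for \<open>a < - c't\<close>.  The last member lies in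
  \<open>Hom(F\<^sub>d, C\<^sup>0)\<close>.  As \<open>M\<close> lives in nonnegative degrees, it is zero as soon as \<open>- a\<close> exceeds the
  degrees of the generators of \<open>F\<^sub>d\<close>, a bound that does not depend on \<open>t\<close>.  Now \<open>Hom(F, C\<^sup>q)\<close> is exact
  for \<open>q > 0\<close>, because on every localization occurring in \<open>C\<^sup>q\<close> some variable is invertible, while it
  annihilates \<open>k\<close>.  So the zigzag can be traced back, and the given element is zero.

  As \<open>Ext\<close> is computed from a resolution chosen by \<open>SOME\<close>, a resolution by modules of finite rank has to
  be constructed; the finite generation of its syzygies comes from homogeneous Groebner bases.\<close>

section \<open>Modules and linear maps\<close>

text \<open>The vanishing of \<open>Ext\<close> is available in one degree \<open>a\<close> at a
  time, so the descending half of the chase has to stay homogeneous of degree \<open>a\<close>.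
  Preimages and lifts are first chosen without regard to degree and then projected; this does no
  harm, because the projections commute with the Cech differentials and preserve cocycles and
  coboundaries. This is why gradings are handled through families of projections. The way back needs
  only exactness of \<open>Hom(F, C\<^sup>q)\<close>, which says nothing about degrees, so the maps
  found there may be inhomogeneous. No total complex is formed: one induction along an antidiagonal
  descends and returns in the same step. The constant is \<open>max c' \<sigma>\<close>, where
  \<open>\<sigma>\<close> bounds the generator degrees of \<open>F\<^sub>d\<close>: the first entry
  makes the \<open>Ext\<close> modules vanish in degree \<open>a\<close>, the second makes the last
  member of the zigzag vanish.\<close>

text \<open>Maps are total functions without the extensionality that \<open>hom_module\<close>
  demands, so composites, differences and sums of linear maps are plain lambda terms.
  \<open>restrict\<close> is inserted only where an element of \<open>hom_module\<close> is
  needed.\<close>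

definition lin_map ::
  "'a graded_ring \<Rightarrow> ('a, 'b) graded_module \<Rightarrow> ('a, 'c) graded_module \<Rightarrow> ('b \<Rightarrow> 'c) \<Rightarrow> bool" where
  "lin_map R M N f \<longleftrightarrow> f \<in> carrier M \<rightarrow> carrier N \<and>
     (\<forall>v\<in>carrier M. \<forall>w\<in>carrier M. f (v \<oplus>\<^bsub>M\<^esub> w) = f v \<oplus>\<^bsub>N\<^esub> f w) \<and>
     (\<forall>r\<in>carrier R. \<forall>v\<in>carrier M. f (r \<odot>\<^bsub>M\<^esub> v) = r \<odot>\<^bsub>N\<^esub> f v)"

lemma lin_mapI:
  assumes "\<And>v. v \<in> carrier M \<Longrightarrow> f v \<in> carrier N"
    and "\<And>v w. v \<in> carrier M \<Longrightarrow> w \<in> carrier M \<Longrightarrow> f (v \<oplus>\<^bsub>M\<^esub> w) = f v \<oplus>\<^bsub>N\<^esub> f w"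
    and "\<And>r v. r \<in> carrier R \<Longrightarrow> v \<in> carrier M \<Longrightarrow> f (r \<odot>\<^bsub>M\<^esub> v) = r \<odot>\<^bsub>N\<^esub> f v"
  shows "lin_map R M N f"
  using assms unfolding lin_map_def by blast

lemma lin_map_closed: "lin_map R M N f \<Longrightarrow> v \<in> carrier M \<Longrightarrow> f v \<in> carrier N"
  and lin_map_add: "lin_map R M N f \<Longrightarrow> v \<in> carrier M \<Longrightarrow> w \<in> carrier M
     \<Longrightarrow> f (v \<oplus>\<^bsub>M\<^esub> w) = f v \<oplus>\<^bsub>N\<^esub> f w"
  and lin_map_smult: "lin_map R M N f \<Longrightarrow> r \<in> carrier R \<Longrightarrow> v \<in> carrier M
     \<Longrightarrow> f (r \<odot>\<^bsub>M\<^esub> v) = r \<odot>\<^bsub>N\<^esub> f v"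
  unfolding lin_map_def by blast+

lemma lin_map_zero:
  assumes "Module.module R M" "Module.module R N" "lin_map R M N f"
  shows "f \<zero>\<^bsub>M\<^esub> = \<zero>\<^bsub>N\<^esub>"
proof -
  interpret M: Module.module R M by fact
  interpret N: Module.module R N by fact
  have "f (\<zero>\<^bsub>R\<^esub> \<odot>\<^bsub>M\<^esub> \<zero>\<^bsub>M\<^esub>) = \<zero>\<^bsub>R\<^esub> \<odot>\<^bsub>N\<^esub> f \<zero>\<^bsub>M\<^esub>"
    by (intro lin_map_smult[OF assms(3)]) auto
  then show ?thesis
    using lin_map_closed[OF assms(3), of "\<zero>\<^bsub>M\<^esub>"] by simp
qed

lemma lin_map_a_inv:
  assumes "Module.module R M" "Module.module R N" "lin_map R M N f" "v \<in> carrier M"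
  shows "f (\<ominus>\<^bsub>M\<^esub> v) = \<ominus>\<^bsub>N\<^esub> f v"
proof -
  interpret M: Module.module R M by fact
  interpret N: Module.module R N by fact
  have "\<ominus>\<^bsub>M\<^esub> v = (\<ominus>\<^bsub>R\<^esub> \<one>\<^bsub>R\<^esub>) \<odot>\<^bsub>M\<^esub> v" "\<ominus>\<^bsub>N\<^esub> f v = (\<ominus>\<^bsub>R\<^esub> \<one>\<^bsub>R\<^esub>) \<odot>\<^bsub>N\<^esub> f v"
    using assms(4) lin_map_closed[OF assms(3)] by (simp_all add: M.smult_l_minus N.smult_l_minus)
  then show ?thesis using lin_map_smult[OF assms(3), of "\<ominus>\<^bsub>R\<^esub> \<one>\<^bsub>R\<^esub>" v] assms(4) by simp
qed

lemma lin_map_minus: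
  assumes "Module.module R M" "Module.module R N" "lin_map R M N f" "v \<in> carrier M" "w \<in> carrier M"
  shows "f (v \<ominus>\<^bsub>M\<^esub> w) = f v \<ominus>\<^bsub>N\<^esub> f w"
proof -
  interpret M: Module.module R M by fact
  show ?thesis using assms lin_map_add[OF assms(3)] lin_map_a_inv[OF assms(1-3)]
    by (simp add: a_minus_def)
qed

lemma lin_map_finsum:
  assumes "Module.module R M" "Module.module R N" "lin_map R M N f" "finite A" "g \<in> A \<rightarrow> carrier M"
  shows "f (\<Oplus>\<^bsub>M\<^esub>i\<in>A. g i) = (\<Oplus>\<^bsub>N\<^esub>i\<in>A. f (g i))"
proof -
  interpret M: Module.module R M by fact
  interpret N: Module.module R N by fact
  show ?thesis using assms(4,5)
  proof (induction A)
    case empty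
    then show ?case using lin_map_zero[OF assms(1-3)] by simp
  next
    case (insert x F)
    then show ?case using lin_map_add[OF assms(3)] lin_map_closed[OF assms(3)]
      by (simp add: Pi_iff)
  qed
qed

lemma lin_map_compose:
  "lin_map R M N f \<Longrightarrow> lin_map R N P g \<Longrightarrow> lin_map R M P (\<lambda>v. g (f v))"
  unfolding lin_map_def by (simp add: Pi_iff)

lemma lin_map_diff:
  assumes "Module.module R N" "lin_map R M N f" "lin_map R M N g"
  shows "lin_map R M N (\<lambda>v. f v \<ominus>\<^bsub>N\<^esub> g v)"
proof -
  interpret N: Module.module R N by fact
  note cl = lin_map_closed[OF assms(2)] lin_map_closed[OF assms(3)]
  show ?thesis
  proof (rule lin_mapI)
    fix v w assume vw: "v \<in> carrier M" "w \<in> carrier M"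
    show "f (v \<oplus>\<^bsub>M\<^esub> w) \<ominus>\<^bsub>N\<^esub> g (v \<oplus>\<^bsub>M\<^esub> w) = (f v \<ominus>\<^bsub>N\<^esub> g v) \<oplus>\<^bsub>N\<^esub> (f w \<ominus>\<^bsub>N\<^esub> g w)"
      using vw cl by (simp add: lin_map_add[OF assms(2)] lin_map_add[OF assms(3)]
        a_minus_def N.minus_add N.a_ac)
  next
    fix r v assume "r \<in> carrier R" "v \<in> carrier M"
    then show "f (r \<odot>\<^bsub>M\<^esub> v) \<ominus>\<^bsub>N\<^esub> g (r \<odot>\<^bsub>M\<^esub> v) = r \<odot>\<^bsub>N\<^esub> (f v \<ominus>\<^bsub>N\<^esub> g v)"
      using cl by (simp add: lin_map_smult[OF assms(2)] lin_map_smult[OF assms(3)]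
        a_minus_def N.smult_r_distr N.smult_r_minus)
  qed (use cl in auto)
qed

lemma lin_map_smult_map:
  assumes "Module.module R M" "r \<in> carrier R"
  shows "lin_map R M M (\<lambda>v. r \<odot>\<^bsub>M\<^esub> v)"
proof -
  interpret M: Module.module R M by fact
  show ?thesis
    using assms(2)
    by (auto intro!: lin_mapI simp: M.smult_r_distr M.smult_assoc1[symmetric] M.R.m_comm)
qed

lemma lin_map_zero_map:
  assumes "Module.module R N"
  shows "lin_map R M N (\<lambda>v. \<zero>\<^bsub>N\<^esub>)"
proof -
  interpret N: Module.module R N by fact
  show ?thesis by (rule lin_mapI) auto
qed

section \<open>Submodules, images and kernels\<close>

lemma submodule_zero: "Module.module R M \<Longrightarrow> submodule B R M \<Longrightarrow> \<zero>\<^bsub>M\<^esub> \<in> B"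
  using subgroup.one_closed[OF submodule.axioms(1)] by fastforce

lemma submodule_finsum:
  assumes "Module.module R M" "submodule B R M" "finite A" "g \<in> A \<rightarrow> B"
  shows "(\<Oplus>\<^bsub>M\<^esub>i\<in>A. g i) \<in> B"
proof -
  interpret M: Module.module R M by fact
  note B = M.submoduleE[OF assms(2)]
  show ?thesis using assms(3,4)
  proof (induction A)
    case empty
    then show ?case using submodule_zero[OF assms(1,2)] by simp
  next
    case (insert x F)
    then have "g \<in> F \<rightarrow> carrier M" "g x \<in> carrier M" using B(1) by auto
    then show ?case using insert B by simp
  qed
qed

lemma submodule_zero_set: "Module.module R M \<Longrightarrow> submodule {\<zero>\<^bsub>M\<^esub>} R M"
proof -
  assume "Module.module R M"
  then interpret M: Module.module R M .
  show ?thesis by (rule M.submoduleI) auto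
qed

lemma submodule_image:
  assumes "Module.module R M" "Module.module R N" "lin_map R M N f" "submodule Z R M"
  shows "submodule (f ` Z) R N"
proof -
  interpret M: Module.module R M by fact
  interpret N: Module.module R N by fact
  note Z = M.submoduleE[OF assms(4)]
  show ?thesis
  proof (rule N.submoduleI)
    show "f ` Z \<subseteq> carrier N" using Z(1) lin_map_closed[OF assms(3)] by auto
    show "\<zero>\<^bsub>N\<^esub> \<in> f ` Z"
      using submodule_zero[OF assms(1,4)] lin_map_zero[OF assms(1-3)] by (metis imageI)
    have Zc: "z \<in> carrier M" if "z \<in> Z" for z using that Z(1) by blast
    show "\<ominus>\<^bsub>N\<^esub> a \<in> f ` Z" if a: "a \<in> f ` Z" for a
    proof -
      obtain z where "z \<in> Z" "a = f z" using a by blast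
      then show ?thesis
        by (intro image_eqI[of _ _ "\<ominus>\<^bsub>M\<^esub> z"] Z(3)) (simp_all add: lin_map_a_inv[OF assms(1-3)] Zc)
    qed
    show "a \<oplus>\<^bsub>N\<^esub> b \<in> f ` Z" if ab: "a \<in> f ` Z" "b \<in> f ` Z" for a b
    proof -
      obtain z w where "z \<in> Z" "a = f z" "w \<in> Z" "b = f w" using ab by blast
      then show ?thesis
        by (intro image_eqI[of _ _ "z \<oplus>\<^bsub>M\<^esub> w"] Z(5)) (simp_all add: lin_map_add[OF assms(3)] Zc)
    qed
    show "r \<odot>\<^bsub>N\<^esub> b \<in> f ` Z" if ab: "r \<in> carrier R" "b \<in> f ` Z" for r b
    proof -
      obtain w where "w \<in> Z" "b = f w" using ab by blast
      then show ?thesis using ab(1)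
        by (intro image_eqI[of _ _ "r \<odot>\<^bsub>M\<^esub> w"] Z(4)) (simp_all add: lin_map_smult[OF assms(3)] Zc)
    qed
  qed
qed

lemma submodule_kernel:
  assumes "Module.module R M" "Module.module R N" "lin_map R M N f"
  shows "submodule {v \<in> carrier M. f v = \<zero>\<^bsub>N\<^esub>} R M"
proof -
  interpret M: Module.module R M by fact
  interpret N: Module.module R N by fact
  show ?thesis
    by (rule M.submoduleI) (auto simp: lin_map_zero[OF assms] lin_map_a_inv[OF assms]
       lin_map_add[OF assms(3)] lin_map_smult[OF assms(3)])
qed

text \<open>The axioms for \<open>N\<close> are pulled through a surjection that respects the
  operations, so that none of them has to be verified on cosets.\<close>

lemma module_surjective_image:
  fixes M :: "('a, 'b) graded_module" and N :: "('a, 'c) graded_module"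
  assumes "Module.module R M" and img: "g ` carrier M = carrier N"
    and add: "\<And>x y. x \<in> carrier M \<Longrightarrow> y \<in> carrier M \<Longrightarrow> g x \<oplus>\<^bsub>N\<^esub> g y = g (x \<oplus>\<^bsub>M\<^esub> y)"
    and zero: "g \<zero>\<^bsub>M\<^esub> = \<zero>\<^bsub>N\<^esub>"
    and smult: "\<And>r x. r \<in> carrier R \<Longrightarrow> x \<in> carrier M \<Longrightarrow> r \<odot>\<^bsub>N\<^esub> g x = g (r \<odot>\<^bsub>M\<^esub> x)"
  shows "Module.module R N" and "lin_map R M N g"
proof -
  interpret M: Module.module R M by fact
  have ex: "\<exists>x\<in>carrier M. y = g x" if "y \<in> carrier N" for y
    using that img by blast
  have cl: "g x \<in> carrier N" if "x \<in> carrier M" for x using that img by blast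
  have "abelian_group N"
  proof (rule abelian_groupI)
    show "\<zero>\<^bsub>N\<^esub> \<in> carrier N" using cl[OF M.zero_closed] zero by simp
    fix x assume "x \<in> carrier N"
    then obtain x' where x: "x' \<in> carrier M" "x = g x'" using ex by blast
    show "\<zero>\<^bsub>N\<^esub> \<oplus>\<^bsub>N\<^esub> x = x" using x add[OF M.zero_closed x(1)] zero by simp
    have "g (\<ominus>\<^bsub>M\<^esub> x') \<oplus>\<^bsub>N\<^esub> x = \<zero>\<^bsub>N\<^esub>" using x add[of "\<ominus>\<^bsub>M\<^esub> x'" x'] zero
      by (simp add: M.l_neg)
    then show "\<exists>y\<in>carrier N. y \<oplus>\<^bsub>N\<^esub> x = \<zero>\<^bsub>N\<^esub>" using x cl by blast
    fix y assume "y \<in> carrier N"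
    then obtain y' where y: "y' \<in> carrier M" "y = g y'" using ex by blast
    show "x \<oplus>\<^bsub>N\<^esub> y \<in> carrier N" using x y add cl by simp
    show "x \<oplus>\<^bsub>N\<^esub> y = y \<oplus>\<^bsub>N\<^esub> x" using x y add M.a_comm by simp
    fix z assume "z \<in> carrier N"
    then obtain z' where z: "z' \<in> carrier M" "z = g z'" using ex by blast
    show "x \<oplus>\<^bsub>N\<^esub> y \<oplus>\<^bsub>N\<^esub> z = x \<oplus>\<^bsub>N\<^esub> (y \<oplus>\<^bsub>N\<^esub> z)"
      using x y z add M.a_assoc by simp
  qed
  then show "Module.module R N"
  proof (rule moduleI[OF M.is_cring])
    fix a b x y assume ab: "a \<in> carrier R" "b \<in> carrier R" "x \<in> carrier N" "y \<in> carrier N"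
    then obtain x' y' where x: "x' \<in> carrier M" "x = g x'" "y' \<in> carrier M" "y = g y'"
      using ex by metis
    show "(a \<oplus>\<^bsub>R\<^esub> b) \<odot>\<^bsub>N\<^esub> x = a \<odot>\<^bsub>N\<^esub> x \<oplus>\<^bsub>N\<^esub> b \<odot>\<^bsub>N\<^esub> x"
      "a \<odot>\<^bsub>N\<^esub> (x \<oplus>\<^bsub>N\<^esub> y) = a \<odot>\<^bsub>N\<^esub> x \<oplus>\<^bsub>N\<^esub> a \<odot>\<^bsub>N\<^esub> y"
      "a \<otimes>\<^bsub>R\<^esub> b \<odot>\<^bsub>N\<^esub> x = a \<odot>\<^bsub>N\<^esub> (b \<odot>\<^bsub>N\<^esub> x)"
      using ab(1,2) x by (simp_all add: add smult M.smult_l_distr M.smult_r_distr M.smult_assoc1)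
  next
    fix a x assume ab: "a \<in> carrier R" "x \<in> carrier N"
    then obtain x' where x: "x' \<in> carrier M" "x = g x'" using ex by metis
    show "a \<odot>\<^bsub>N\<^esub> x \<in> carrier N" using ab x cl by (simp add: smult)
  next
    fix x assume "x \<in> carrier N"
    then obtain x' where x: "x' \<in> carrier M" "x = g x'" using ex by metis
    then show "\<one>\<^bsub>R\<^esub> \<odot>\<^bsub>N\<^esub> x = x" by (simp add: smult)
  qed
  show "lin_map R M N g" using cl add smult by (auto intro!: lin_mapI)
qed

text \<open>Covers both products that occur: free modules, whose factors are copies of the ring, and
  the terms of the Cech complex.\<close>

lemma module_pointwise:
  fixes P :: "('a, 'i \<Rightarrow> 'b) graded_module" and N :: "'i \<Rightarrow> ('a, 'b) graded_module"
  assumes "cring R" and mod: "\<And>i. i \<in> J \<Longrightarrow> Module.module R (N i)"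
    and car: "carrier P = (\<Pi>\<^sub>E i\<in>J. carrier (N i))"
    and zero: "\<zero>\<^bsub>P\<^esub> = (\<lambda>i\<in>J. \<zero>\<^bsub>N i\<^esub>)"
    and add: "\<And>v w. v \<oplus>\<^bsub>P\<^esub> w = (\<lambda>i\<in>J. v i \<oplus>\<^bsub>N i\<^esub> w i)"
    and smult: "\<And>r v. r \<odot>\<^bsub>P\<^esub> v = (\<lambda>i\<in>J. r \<odot>\<^bsub>N i\<^esub> v i)"
  shows "Module.module R P"
proof -
  have ag: "abelian_group (N i)" if "i \<in> J" for i
    using mod[OF that] by (simp add: Module.module.axioms)
  note E = abelian_groupE[OF ag]
  have "abelian_group P"
  proof (rule abelian_groupI)
    fix x assume x: "x \<in> carrier P"
    then have xi: "\<And>i. i \<in> J \<Longrightarrow> x i \<in> carrier (N i)" by (auto simp: car)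
    show "\<zero>\<^bsub>P\<^esub> \<oplus>\<^bsub>P\<^esub> x = x"
      unfolding add zero
      by (rule extensionalityI[of _ J]) (use x xi E in \<open>auto simp: car PiE_iff\<close>)
    have "(\<lambda>i\<in>J. \<ominus>\<^bsub>N i\<^esub> x i) \<oplus>\<^bsub>P\<^esub> x = \<zero>\<^bsub>P\<^esub>"
      unfolding add zero using xi
      by (intro restrict_ext) (simp add: abelian_group.l_neg[OF ag])
    moreover have "(\<lambda>i\<in>J. \<ominus>\<^bsub>N i\<^esub> x i) \<in> carrier P"
      using xi by (simp add: car abelian_group.a_inv_closed[OF ag])
    ultimately show "\<exists>y\<in>carrier P. y \<oplus>\<^bsub>P\<^esub> x = \<zero>\<^bsub>P\<^esub>" by blast
    fix y assume y: "y \<in> carrier P"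
    then have yi: "\<And>i. i \<in> J \<Longrightarrow> y i \<in> carrier (N i)" by (auto simp: car)
    show "x \<oplus>\<^bsub>P\<^esub> y \<in> carrier P" "x \<oplus>\<^bsub>P\<^esub> y = y \<oplus>\<^bsub>P\<^esub> x"
      unfolding add car using xi yi E by (auto intro!: restrict_ext)
    fix z assume z: "z \<in> carrier P"
    then have zi: "\<And>i. i \<in> J \<Longrightarrow> z i \<in> carrier (N i)" by (auto simp: car)
    show "x \<oplus>\<^bsub>P\<^esub> y \<oplus>\<^bsub>P\<^esub> z = x \<oplus>\<^bsub>P\<^esub> (y \<oplus>\<^bsub>P\<^esub> z)"
      unfolding add using xi yi zi E by (intro restrict_ext) auto
  qed (use E in \<open>auto simp: zero car\<close>)
  then show ?thesis
  proof (rule moduleI[OF assms(1)])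
    fix a b x y assume ab: "a \<in> carrier R" "b \<in> carrier R" "x \<in> carrier P" "y \<in> carrier P"
    then have xi: "x i \<in> carrier (N i)" "y i \<in> carrier (N i)" if "i \<in> J" for i
      using that by (auto simp: car)
    show "(a \<oplus>\<^bsub>R\<^esub> b) \<odot>\<^bsub>P\<^esub> x = a \<odot>\<^bsub>P\<^esub> x \<oplus>\<^bsub>P\<^esub> b \<odot>\<^bsub>P\<^esub> x"
      "a \<odot>\<^bsub>P\<^esub> (x \<oplus>\<^bsub>P\<^esub> y) = a \<odot>\<^bsub>P\<^esub> x \<oplus>\<^bsub>P\<^esub> a \<odot>\<^bsub>P\<^esub> y"
      "a \<otimes>\<^bsub>R\<^esub> b \<odot>\<^bsub>P\<^esub> x = a \<odot>\<^bsub>P\<^esub> (b \<odot>\<^bsub>P\<^esub> x)"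
      unfolding add smult
      by (rule restrict_ext, simp add: ab xi Module.module.smult_l_distr[OF mod]
        Module.module.smult_r_distr[OF mod] Module.module.smult_assoc1[OF mod])+
  next
    fix a x assume ab: "a \<in> carrier R" "x \<in> carrier P"
    then show "a \<odot>\<^bsub>P\<^esub> x \<in> carrier P"
      by (auto simp: smult car intro!: Module.module.smult_closed[OF mod])
  next
    fix x assume x: "x \<in> carrier P"
    show "\<one>\<^bsub>R\<^esub> \<odot>\<^bsub>P\<^esub> x = x"
      unfolding smult
      by (rule extensionalityI[of _ J]) (use x in \<open>auto simp: car PiE_iff Module.module.smult_one[OF mod]\<close>)
  qed
qed

section \<open>Cosets and subquotients\<close>

lemma coset_eq_iff:
  assumes "Module.module R M" "submodule B R M" "x \<in> carrier M" "y \<in> carrier M"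
  shows "B +>\<^bsub>M\<^esub> x = B +>\<^bsub>M\<^esub> y \<longleftrightarrow> x \<ominus>\<^bsub>M\<^esub> y \<in> B"
proof -
  interpret M: Module.module R M by fact
  have sg: "subgroup B (add_monoid M)" using assms(2) by (rule submodule.axioms)
  have sub: "B \<subseteq> carrier M" by (rule M.submoduleE(1)[OF assms(2)])
  show ?thesis
  proof
    assume "B +>\<^bsub>M\<^esub> x = B +>\<^bsub>M\<^esub> y"
    then have "B +>\<^bsub>M\<^esub> (x \<ominus>\<^bsub>M\<^esub> y) = B"
      using M.a_coset_add_inv2 assms sub by (simp add: a_minus_def)
    then show "x \<ominus>\<^bsub>M\<^esub> y \<in> B" using M.a_coset_join1[OF _ _ sg] assms by simp
  next
    assume "x \<ominus>\<^bsub>M\<^esub> y \<in> B"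
    then have "B +>\<^bsub>M\<^esub> (x \<ominus>\<^bsub>M\<^esub> y) = B"
      using M.a_coset_join2[OF _ sg] assms by simp
    then show "B +>\<^bsub>M\<^esub> x = B +>\<^bsub>M\<^esub> y"
      using M.a_coset_add_inv1 assms sub by (simp add: a_minus_def)
  qed
qed

lemma coset_eq_self_iff:
  assumes "Module.module R M" "submodule B R M" "x \<in> carrier M"
  shows "B +>\<^bsub>M\<^esub> x = B \<longleftrightarrow> x \<in> B"
proof -
  interpret M: Module.module R M by fact
  have sg: "subgroup B (add_monoid M)" using assms(2) by (rule submodule.axioms)
  show ?thesis using M.a_coset_join1[OF _ assms(3) sg] M.a_coset_join2[OF assms(3) sg] by iprover
qed

lemma coset_add:
  assumes "Module.module R M" "submodule B R M" "x \<in> carrier M" "y \<in> carrier M"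
  shows "(B +>\<^bsub>M\<^esub> x) <+>\<^bsub>M\<^esub> (B +>\<^bsub>M\<^esub> y) = B +>\<^bsub>M\<^esub> (x \<oplus>\<^bsub>M\<^esub> y)"
proof -
  interpret M: Module.module R M by fact
  interpret B: abelian_subgroup B M
    by (intro abelian_subgroupI3 additive_subgroupI submodule.axioms(1)[OF assms(2)] M.abelian_group_axioms)
  show ?thesis using B.a_rcos_sum assms by simp
qed

text \<open>Representatives of one coset differ by some \<open>b\<close> in \<open>B\<close>, and
  the multiple of \<open>b\<close> by \<open>r\<close> stays in \<open>B\<close>; so all sets of the
  union agree.\<close>

lemma coset_smult:
  assumes "Module.module R M" "submodule B R M" "x \<in> carrier M" "r \<in> carrier R"
  shows "(\<Union>z\<in>B +>\<^bsub>M\<^esub> x. B +>\<^bsub>M\<^esub> (r \<odot>\<^bsub>M\<^esub> z)) = B +>\<^bsub>M\<^esub> (r \<odot>\<^bsub>M\<^esub> x)"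
proof -
  interpret M: Module.module R M by fact
  note B = M.submoduleE[OF assms(2)]
  have eq: "B +>\<^bsub>M\<^esub> (r \<odot>\<^bsub>M\<^esub> z) = B +>\<^bsub>M\<^esub> (r \<odot>\<^bsub>M\<^esub> x)" if "z \<in> B +>\<^bsub>M\<^esub> x" for z
  proof -
    obtain b where b: "b \<in> B" "z = b \<oplus>\<^bsub>M\<^esub> x" using \<open>z \<in> B +>\<^bsub>M\<^esub> x\<close> unfolding a_r_coset_def' by (elim UN_E singletonE)
    have bc: "b \<in> carrier M" using b B by auto
    have "r \<odot>\<^bsub>M\<^esub> z \<ominus>\<^bsub>M\<^esub> r \<odot>\<^bsub>M\<^esub> x = r \<odot>\<^bsub>M\<^esub> b"
      using b(2) bc assms(3,4) by (simp add: M.smult_r_distr a_minus_def M.a_assoc M.r_neg)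
    moreover have "r \<odot>\<^bsub>M\<^esub> b \<in> B" by (rule B(4)[OF assms(4) b(1)])
    ultimately show ?thesis using b(2) bc assms(3,4) by (subst coset_eq_iff[OF assms(1,2)]) simp_all
  qed
  have "x \<in> B +>\<^bsub>M\<^esub> x"
    by (intro abelian_subgroup.a_rcos_self abelian_subgroupI3 additive_subgroupI
        submodule.axioms(1)[OF assms(2)] M.abelian_group_axioms assms(3))
  then have ne: "B +>\<^bsub>M\<^esub> x \<noteq> {}" by blast
  have "(\<Union>z\<in>B +>\<^bsub>M\<^esub> x. B +>\<^bsub>M\<^esub> (r \<odot>\<^bsub>M\<^esub> z)) = (\<Union>z\<in>B +>\<^bsub>M\<^esub> x. B +>\<^bsub>M\<^esub> (r \<odot>\<^bsub>M\<^esub> x))"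
    by (rule SUP_cong[OF refl eq])
  also have "\<dots> = B +>\<^bsub>M\<^esub> (r \<odot>\<^bsub>M\<^esub> x)" using ne by simp
  finally show ?thesis .
qed

lemma subquotient_module:
  assumes "Module.module R M" "submodule Z R M" "submodule B R M"
  shows "Module.module R (subquotient M Z B)"
    and "lin_map R (M\<lparr>carrier := Z\<rparr>) (subquotient M Z B) (\<lambda>z. B +>\<^bsub>M\<^esub> z)"
proof -
  interpret M: Module.module R M by fact
  have mZ: "Module.module R (M\<lparr>carrier := Z\<rparr>)"
    by (rule submodule.submodule_is_module[OF assms(2,1)])
  have Z: "\<And>z. z \<in> Z \<Longrightarrow> z \<in> carrier M" using M.submoduleE(1)[OF assms(2)] by auto
  have sub: "B \<subseteq> carrier M" by (rule M.submoduleE(1)[OF assms(3)])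
  have im: "(\<lambda>z. B +>\<^bsub>M\<^esub> z) ` carrier (M\<lparr>carrier := Z\<rparr>) = carrier (subquotient M Z B)"
    by (simp add: subquotient_def)
  have add: "(B +>\<^bsub>M\<^esub> x) \<oplus>\<^bsub>subquotient M Z B\<^esub> (B +>\<^bsub>M\<^esub> y) = B +>\<^bsub>M\<^esub> (x \<oplus>\<^bsub>M\<lparr>carrier := Z\<rparr>\<^esub> y)"
    if "x \<in> carrier (M\<lparr>carrier := Z\<rparr>)" "y \<in> carrier (M\<lparr>carrier := Z\<rparr>)" for x y
    using coset_add[OF assms(1,3) Z Z] that by (simp add: subquotient_def)
  have smult: "r \<odot>\<^bsub>subquotient M Z B\<^esub> (B +>\<^bsub>M\<^esub> x) = B +>\<^bsub>M\<^esub> (r \<odot>\<^bsub>M\<lparr>carrier := Z\<rparr>\<^esub> x)"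
    if "r \<in> carrier R" "x \<in> carrier (M\<lparr>carrier := Z\<rparr>)" for r x
    using coset_smult[OF assms(1,3) Z] that by (simp add: subquotient_def)
  have zero: "B +>\<^bsub>M\<^esub> \<zero>\<^bsub>M\<lparr>carrier := Z\<rparr>\<^esub> = \<zero>\<^bsub>subquotient M Z B\<^esub>"
    using sub by (simp add: subquotient_def)
  show "Module.module R (subquotient M Z B)"
    by (rule module_surjective_image(1)[OF mZ im add zero smult])
  show "lin_map R (M\<lparr>carrier := Z\<rparr>) (subquotient M Z B) (\<lambda>z. B +>\<^bsub>M\<^esub> z)"
    by (rule module_surjective_image(2)[OF mZ im add zero smult])
qed

section \<open>Graded modules and free modules\<close>

text \<open>The record only lists the homogeneous elements; the projections onto the components are
  added as a parameter. \<open>decomp\<close> is what allows the components of a product of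
  inhomogeneous elements to be computed.\<close>

locale gring = R?: cring R for R :: "'a graded_ring" (structure) +
  fixes \<pi> :: "int \<Rightarrow> 'a \<Rightarrow> 'a"
  assumes part_sub: "part R i \<subseteq> carrier R"
    and one_part: "\<one> \<in> part R 0"
    and proj_in: "x \<in> carrier R \<Longrightarrow> \<pi> i x \<in> part R i"
    and proj_id: "x \<in> part R i \<Longrightarrow> \<pi> i x = x"
    and proj_other: "x \<in> part R j \<Longrightarrow> i \<noteq> j \<Longrightarrow> \<pi> i x = \<zero>"
    and proj_add: "x \<in> carrier R \<Longrightarrow> y \<in> carrier R \<Longrightarrow> \<pi> i (x \<oplus> y) = \<pi> i x \<oplus> \<pi> i y"
    and proj_mult: "r \<in> part R e \<Longrightarrow> x \<in> carrier R \<Longrightarrow> \<pi> (i + e) (r \<otimes> x) = r \<otimes> \<pi> i x"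
    and decomp: "x \<in> carrier R \<Longrightarrow> \<exists>E. finite E \<and> x = (\<Oplus>e\<in>E. \<pi> e x)"

text \<open>Only the behaviour of the projections on homogeneous elements is recorded; that a module is
  the direct sum of its components is never needed.\<close>

locale gmod = Module.module R M
  for R :: "'a graded_ring" (structure) and M :: "('a, 'b) graded_module" (structure) +
  fixes \<rho> :: "int \<Rightarrow> 'b \<Rightarrow> 'b"
  assumes part_carrier: "part R i \<subseteq> carrier R"
    and comp_sub: "component M i \<subseteq> carrier M"
    and gproj_in: "v \<in> carrier M \<Longrightarrow> \<rho> i v \<in> component M i"
    and gproj_id: "v \<in> component M i \<Longrightarrow> \<rho> i v = v"
    and gproj_add: "v \<in> carrier M \<Longrightarrow> w \<in> carrier M \<Longrightarrow> \<rho> i (v \<oplus>\<^bsub>M\<^esub> w) = \<rho> i v \<oplus>\<^bsub>M\<^esub> \<rho> i w"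
    and gproj_smult: "r \<in> part R e \<Longrightarrow> v \<in> carrier M \<Longrightarrow> \<rho> (i + e) (r \<odot>\<^bsub>M\<^esub> v) = r \<odot>\<^bsub>M\<^esub> \<rho> i v"
begin

lemma module_M: "Module.module R M" ..

lemma gproj_closed [simp]: "v \<in> carrier M \<Longrightarrow> \<rho> i v \<in> carrier M"
  using gproj_in comp_sub by blast

lemma gproj_zero: "\<rho> i \<zero>\<^bsub>M\<^esub> = \<zero>\<^bsub>M\<^esub>"
  using gproj_add[of "\<zero>\<^bsub>M\<^esub>" "\<zero>\<^bsub>M\<^esub>" i] gproj_closed[of "\<zero>\<^bsub>M\<^esub>" i]
  by (simp add: M.add.r_cancel_one')

lemma gproj_a_inv: "v \<in> carrier M \<Longrightarrow> \<rho> i (\<ominus>\<^bsub>M\<^esub> v) = \<ominus>\<^bsub>M\<^esub> \<rho> i v"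
  using gproj_add[of "\<ominus>\<^bsub>M\<^esub> v" v i] gproj_zero
  by (simp add: M.l_neg M.minus_equality)

text \<open>Closure of the components under the operations is derived: a component consists of the
  elements fixed by its projection, and the projections respect the operations.\<close>

lemma comp_zero: "\<zero>\<^bsub>M\<^esub> \<in> component M i"
  using gproj_in[of "\<zero>\<^bsub>M\<^esub>"] gproj_zero by simp

lemma comp_add: "v \<in> component M i \<Longrightarrow> w \<in> component M i \<Longrightarrow> v \<oplus>\<^bsub>M\<^esub> w \<in> component M i"
  using gproj_in[of "v \<oplus>\<^bsub>M\<^esub> w" i] gproj_add[of v w i] comp_sub[of i] gproj_id
  by (simp add: subset_iff)

lemma comp_a_inv: "v \<in> component M i \<Longrightarrow> \<ominus>\<^bsub>M\<^esub> v \<in> component M i"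
  using gproj_in[of "\<ominus>\<^bsub>M\<^esub> v" i] gproj_a_inv[of v i] comp_sub[of i] gproj_id
  by (simp add: subset_iff)

lemma comp_minus: "v \<in> component M i \<Longrightarrow> w \<in> component M i \<Longrightarrow> v \<ominus>\<^bsub>M\<^esub> w \<in> component M i"
  by (simp add: a_minus_def comp_add comp_a_inv)

lemma comp_smult: "r \<in> part R e \<Longrightarrow> v \<in> component M i \<Longrightarrow> r \<odot>\<^bsub>M\<^esub> v \<in> component M (i + e)"
  using gproj_in[of "r \<odot>\<^bsub>M\<^esub> v" "i + e"] gproj_smult[of r e v i] comp_sub[of i] gproj_id
    part_carrier[of e] by (simp add: subset_iff)

lemma comp_finsum:
  "finite A \<Longrightarrow> g \<in> A \<rightarrow> component M i \<Longrightarrow> (\<Oplus>\<^bsub>M\<^esub>l\<in>A. g l) \<in> component M i"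
proof (induction A rule: finite_induct)
  case empty
  then show ?case using comp_zero by simp
next
  case (insert x F)
  then show ?case using comp_add comp_sub[of i] by (auto simp: Pi_iff subset_iff)
qed

end

lemma (in gring) module_regular: "Module.module R (regular_module R)"
proof (rule moduleI[OF is_cring])
  show "abelian_group (regular_module R)"
    by (rule abelian_groupI) (auto simp: regular_module_def a_ac intro: bexI[of _ "\<ominus> _"] l_neg)
qed (auto simp: regular_module_def l_distr r_distr m_assoc)

lemma regular_module_simps [simp]:
  "carrier (regular_module R) = carrier R" "zero (regular_module R) = zero R"
  "add (regular_module R) = add R" "smult (regular_module R) = mult R"
  "component (regular_module R) = part R"
  by (auto simp: regular_module_def)

lemma (in gring) gmod_regular: "gmod R (regular_module R) \<pi>"
  by (intro gmod.intro module_regular gmod_axioms.intro)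
    (auto simp: part_sub proj_in proj_id proj_add proj_mult)

lemma (in gring) part_carr: "x \<in> part R i \<Longrightarrow> x \<in> carrier R"
  using part_sub by blast

lemmas (in gring) part_zero = gmod.comp_zero[OF gmod_regular, simplified]
lemmas (in gring) part_mult = gmod.comp_smult[OF gmod_regular, simplified]
lemmas (in gring) proj_zero = gmod.gproj_zero[OF gmod_regular, simplified]

lemma (in gring) proj_closed [simp]: "x \<in> carrier R \<Longrightarrow> \<pi> i x \<in> carrier R"
  using proj_in part_sub by blast

section \<open>Graded free modules and maps out of them\<close>

lemma free_module_simps [simp]:
  "carrier (free_module R b s) = {..<b} \<rightarrow>\<^sub>E carrier R"
  "zero (free_module R b s) = (\<lambda>l\<in>{..<b}. \<zero>\<^bsub>R\<^esub>)"
  "add (free_module R b s) v w = (\<lambda>l\<in>{..<b}. v l \<oplus>\<^bsub>R\<^esub> w l)"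
  "smult (free_module R b s) r v = (\<lambda>l\<in>{..<b}. r \<otimes>\<^bsub>R\<^esub> v l)"
  "component (free_module R b s) i = (\<Pi>\<^sub>E l\<in>{..<b}. part R (i - s l))"
  by (auto simp: free_module_def)

lemma (in gring) module_free: "Module.module R (free_module R b s)"
  by (rule module_pointwise[where J = "{..<b}" and N = "\<lambda>_. regular_module R"])
    (auto simp: module_regular is_cring)

definition free_proj :: "(int \<Rightarrow> 'a \<Rightarrow> 'a) \<Rightarrow> nat \<Rightarrow> (nat \<Rightarrow> int) \<Rightarrow> int \<Rightarrow> (nat \<Rightarrow> 'a) \<Rightarrow> (nat \<Rightarrow> 'a)" where
  "free_proj \<pi> b s i v = (\<lambda>l\<in>{..<b}. \<pi> (i - s l) (v l))"

lemma (in gring) gmod_free: "gmod R (free_module R b s) (free_proj \<pi> b s)"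
proof (intro gmod.intro module_free gmod_axioms.intro)
  fix i v assume "v \<in> component (free_module R b s) i"
  then show "free_proj \<pi> b s i v = v"
    unfolding free_proj_def by (intro extensionalityI[of _ "{..<b}"]) (auto simp: proj_id PiE_iff)
next
  fix i e v r assume r: "r \<in> part R e" and v: "v \<in> carrier (free_module R b s)"
  have "\<pi> (i + e - s l) (r \<otimes> v l) = r \<otimes> \<pi> (i - s l) (v l)" if "l < b" for l
    using proj_mult[OF r, of "v l" "i - s l"] v that by (auto simp: algebra_simps)
  then show "free_proj \<pi> b s (i + e) (r \<odot>\<^bsub>free_module R b s\<^esub> v)
        = r \<odot>\<^bsub>free_module R b s\<^esub> free_proj \<pi> b s i v"
    unfolding free_proj_def by (simp cong: restrict_cong)
qed (use part_sub in \<open>auto simp: free_proj_def proj_in proj_add subset_iff PiE_iff cong: restrict_cong\<close>)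

definition unit_vec :: "'a graded_ring \<Rightarrow> nat \<Rightarrow> nat \<Rightarrow> (nat \<Rightarrow> 'a)" where
  "unit_vec R b l = (\<lambda>m\<in>{..<b}. if m = l then \<one>\<^bsub>R\<^esub> else \<zero>\<^bsub>R\<^esub>)"

text \<open>As a function of the coordinate vector \<open>v\<close>, this is the linear map out of a
  free module that takes the \<open>l\<close>-th basis vector to \<open>y l\<close>.\<close>

definition lin_comb :: "('a, 'b) graded_module \<Rightarrow> nat \<Rightarrow> (nat \<Rightarrow> 'b) \<Rightarrow> (nat \<Rightarrow> 'a) \<Rightarrow> 'b" where
  "lin_comb N b y v = (\<Oplus>\<^bsub>N\<^esub>l\<in>{..<b}. v l \<odot>\<^bsub>N\<^esub> y l)"

context gring
begin

lemma unit_vec_carrier: "unit_vec R b l \<in> carrier (free_module R b s)"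
  by (auto simp: unit_vec_def)

lemma unit_vec_component: "unit_vec R b l \<in> component (free_module R b s) (s l)"
  by (auto simp: unit_vec_def one_part part_zero)

lemma lin_comb_lin_map:
  assumes "Module.module R N" and y: "\<And>l. l < b \<Longrightarrow> y l \<in> carrier N"
  shows "lin_map R (free_module R b s) N (lin_comb N b y)"
proof -
  interpret N: Module.module R N by fact
  show ?thesis
  proof (rule lin_mapI)
    fix v w assume vw: "v \<in> carrier (free_module R b s)" "w \<in> carrier (free_module R b s)"
    show "lin_comb N b y v \<in> carrier N"
      unfolding lin_comb_def by (rule N.finsum_closed) (use vw y in auto)
    have "lin_comb N b y (v \<oplus>\<^bsub>free_module R b s\<^esub> w)
      = (\<Oplus>\<^bsub>N\<^esub>l\<in>{..<b}. v l \<odot>\<^bsub>N\<^esub> y l \<oplus>\<^bsub>N\<^esub> w l \<odot>\<^bsub>N\<^esub> y l)"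
      unfolding lin_comb_def by (rule N.finsum_cong') (use vw y in \<open>auto simp: N.smult_l_distr PiE_iff\<close>)
    then show "lin_comb N b y (v \<oplus>\<^bsub>free_module R b s\<^esub> w) = lin_comb N b y v \<oplus>\<^bsub>N\<^esub> lin_comb N b y w"
      unfolding lin_comb_def using vw y by (simp add: N.finsum_addf Pi_iff PiE_iff)
  next
    fix r v assume vw: "r \<in> carrier R" "v \<in> carrier (free_module R b s)"
    have "lin_comb N b y (r \<odot>\<^bsub>free_module R b s\<^esub> v) = (\<Oplus>\<^bsub>N\<^esub>l\<in>{..<b}. r \<odot>\<^bsub>N\<^esub> (v l \<odot>\<^bsub>N\<^esub> y l))"
      unfolding lin_comb_def by (rule N.finsum_cong') (use vw y in \<open>auto simp: N.smult_assoc1 PiE_iff\<close>)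
    also have "\<dots> = r \<odot>\<^bsub>N\<^esub> lin_comb N b y v"
      unfolding lin_comb_def by (subst N.finsum_smult_ldistr) (use vw y in auto)
    finally show "lin_comb N b y (r \<odot>\<^bsub>free_module R b s\<^esub> v) = r \<odot>\<^bsub>N\<^esub> lin_comb N b y v" .
  qed
qed

lemma lin_comb_unit_vec:
  assumes "Module.module R N" and y: "\<And>l. l < b \<Longrightarrow> y l \<in> carrier N" and l: "l < b"
  shows "lin_comb N b y (unit_vec R b l) = y l"
proof -
  interpret N: Module.module R N by fact
  have "lin_comb N b y (unit_vec R b l) = (\<Oplus>\<^bsub>N\<^esub>m\<in>{..<b}. if l = m then y m else \<zero>\<^bsub>N\<^esub>)"
    unfolding lin_comb_def by (rule N.finsum_cong') (use y in \<open>auto simp: unit_vec_def\<close>)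
  also have "\<dots> = y l" using l y by (intro N.finsum_singleton) auto
  finally show ?thesis .
qed

text \<open>Evaluation at a coordinate is linear, so it can be moved into the sum, where a single
  term survives.\<close>

lemma free_expand:
  assumes v: "v \<in> carrier (free_module R b s)"
  shows "v = lin_comb (free_module R b s) b (unit_vec R b) v"
proof -
  let ?F = "free_module R b s"
  interpret F: Module.module R ?F by (rule module_free)
  have ev: "lin_map R ?F (regular_module R) (\<lambda>v. v m)" if "m < b" for m
    using that by (auto intro!: lin_mapI)
  have cl: "(\<lambda>l. v l \<odot>\<^bsub>?F\<^esub> unit_vec R b l) \<in> {..<b} \<rightarrow> carrier ?F"
    by (intro Pi_I F.smult_closed unit_vec_carrier) (use v in auto)
  have "lin_comb ?F b (unit_vec R b) v m = v m" if m: "m < b" for m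
  proof -
    have "lin_comb ?F b (unit_vec R b) v m = (\<Oplus>\<^bsub>regular_module R\<^esub>l\<in>{..<b}. (v l \<odot>\<^bsub>?F\<^esub> unit_vec R b l) m)"
      unfolding lin_comb_def by (rule lin_map_finsum[OF module_free module_regular ev[OF m] _ cl]) auto
    also have "\<dots> = (\<Oplus>\<^bsub>regular_module R\<^esub>l\<in>{..<b}. if m = l then v l else \<zero>)"
      by (rule abelian_monoid.finsum_cong')
        (use v m module_regular in \<open>auto simp: unit_vec_def PiE_iff Module.module_def abelian_group_def\<close>)
    also have "\<dots> = v m"
      using v m abelian_monoid.finsum_singleton[of "regular_module R" m "{..<b}" v] module_regular
      unfolding regular_module_simps by (auto simp: Module.module_def abelian_group_def PiE_iff)
    finally show ?thesis .
  qed
  moreover have "lin_comb ?F b (unit_vec R b) v \<in> carrier ?F"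
    unfolding lin_comb_def by (rule F.finsum_closed[OF cl])
  ultimately show ?thesis using v by (intro extensionalityI[of _ "{..<b}"]) (auto simp: PiE_iff)
qed

lemma lin_map_free_expand:
  assumes "Module.module R N" and f: "lin_map R (free_module R b s) N f"
    and v: "v \<in> carrier (free_module R b s)"
  shows "f v = lin_comb N b (\<lambda>l. f (unit_vec R b l)) v"
proof -
  let ?F = "free_module R b s"
  interpret F: Module.module R ?F by (rule module_free)
  interpret N: Module.module R N by fact
  have vl: "v l \<in> carrier R" if "l < b" for l using v that by auto
  note uc = unit_vec_carrier[of b _ s]
  have "f v = f (lin_comb ?F b (unit_vec R b) v)" using free_expand[OF v] by simp
  also have "\<dots> = (\<Oplus>\<^bsub>N\<^esub>l\<in>{..<b}. f (v l \<odot>\<^bsub>?F\<^esub> unit_vec R b l))"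
    unfolding lin_comb_def
    by (rule lin_map_finsum[OF module_free assms(1) f]) (use vl uc F.smult_closed in blast)+
  also have "\<dots> = lin_comb N b (\<lambda>l. f (unit_vec R b l)) v"
    unfolding lin_comb_def
    by (rule N.finsum_cong')
      (use vl uc lin_map_smult[OF f] lin_map_closed[OF f] N.smult_closed in \<open>auto simp del: free_module_simps\<close>)
  finally show ?thesis .
qed

lemma lin_map_free_eqI:
  assumes "Module.module R N" "lin_map R (free_module R b s) N f" "lin_map R (free_module R b s) N g"
    and "\<And>l. l < b \<Longrightarrow> f (unit_vec R b l) = g (unit_vec R b l)" and v: "v \<in> carrier (free_module R b s)"
  shows "f v = g v"
proof -
  interpret N: Module.module R N by fact
  have "lin_comb N b (\<lambda>l. f (unit_vec R b l)) v = lin_comb N b (\<lambda>l. g (unit_vec R b l)) v"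
    unfolding lin_comb_def
    by (rule N.finsum_cong')
      (use v assms(4) lin_map_closed[OF assms(3) unit_vec_carrier] in auto)
  then show ?thesis using lin_map_free_expand[OF assms(1,2) v] lin_map_free_expand[OF assms(1,3) v] by simp
qed

text \<open>Projectivity of free modules: a lift is determined by preimages of the images of the
  basis vectors. The sets \<open>A l\<close> allow further properties of these preimages to be
  prescribed, in practice their degrees.\<close>

lemma free_lift:
  assumes "Module.module R N" "Module.module R P" "lin_map R N P g"
    and f: "lin_map R (free_module R b s) P f"
    and ex: "\<And>l. l < b \<Longrightarrow> \<exists>y\<in>A l. y \<in> carrier N \<and> g y = f (unit_vec R b l)"
  obtains h where "lin_map R (free_module R b s) N h"
    "\<And>v. v \<in> carrier (free_module R b s) \<Longrightarrow> g (h v) = f v" "\<And>l. l < b \<Longrightarrow> h (unit_vec R b l) \<in> A l"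
proof -
  obtain y where y: "\<And>l. l < b \<Longrightarrow> y l \<in> A l \<and> y l \<in> carrier N \<and> g (y l) = f (unit_vec R b l)"
    using ex by metis
  have h: "lin_map R (free_module R b s) N (lin_comb N b y)"
    by (rule lin_comb_lin_map[OF assms(1)]) (simp add: y)
  have u: "lin_comb N b y (unit_vec R b l) = y l" if "l < b" for l
    by (rule lin_comb_unit_vec[OF assms(1)]) (simp_all add: y that)
  show ?thesis
  proof
    fix v assume "v \<in> carrier (free_module R b s)"
    then show "g (lin_comb N b y v) = f v"
      by (rule lin_map_free_eqI[OF assms(2) lin_map_compose[OF h assms(3)] f, rotated]) (simp add: u y)
  qed (simp_all add: h u y)
qed

lemma lin_map_degree:
  assumes "gmod R N \<rho>" and f: "lin_map R (free_module R b s) N f"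
    and fu: "\<And>l. l < b \<Longrightarrow> f (unit_vec R b l) \<in> component N (s l + a)"
    and v: "v \<in> component (free_module R b s) e"
  shows "f v \<in> component N (e + a)"
proof -
  interpret N: gmod R N \<rho> by fact
  have vc: "v \<in> carrier (free_module R b s)" using v gmod.comp_sub[OF gmod_free] by blast
  have "v l \<odot>\<^bsub>N\<^esub> f (unit_vec R b l) \<in> component N (e + a)" if "l < b" for l
    using N.comp_smult[of "v l" "e - s l", OF _ fu[OF that]] v that by (simp add: PiE_iff add.commute)
  then show ?thesis
    unfolding lin_map_free_expand[OF N.module_M f vc] lin_comb_def
    by (intro N.comp_finsum) auto
qed

text \<open>The degree \<open>a\<close> part of a linear map, prescribed on the basis vectors. For a
  homogeneous vector of degree \<open>e\<close> the \<open>l\<close>-th coefficient has degree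
  \<open>e - s l\<close>, so projecting the whole value to degree \<open>e + a\<close> amounts to
  projecting the image of the \<open>l\<close>-th basis vector to degree
  \<open>s l + a\<close>.\<close>

lemma free_homogenize:
  assumes "gmod R N \<rho>" and f: "lin_map R (free_module R b s) N f"
  obtains h where "lin_map R (free_module R b s) N h"
    "\<And>l. l < b \<Longrightarrow> h (unit_vec R b l) = \<rho> (s l + a) (f (unit_vec R b l))"
    "\<And>e v. v \<in> component (free_module R b s) e \<Longrightarrow> h v = \<rho> (e + a) (f v)"
proof -
  interpret N: gmod R N \<rho> by fact
  let ?h = "lin_comb N b (\<lambda>l. \<rho> (s l + a) (f (unit_vec R b l)))"
  note uc = lin_map_closed[OF f unit_vec_carrier]
  have h: "lin_map R (free_module R b s) N ?h"
    by (rule lin_comb_lin_map[OF N.module_M]) (use uc in auto)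
  have "?h v = \<rho> (e + a) (f v)" if v: "v \<in> component (free_module R b s) e" for e v
  proof -
    have vc: "v \<in> carrier (free_module R b s)" using v gmod.comp_sub[OF gmod_free] by blast
    have vl: "v l \<in> carrier R" if "l < b" for l using vc that by auto
    have "\<rho> (e + a) (\<Oplus>\<^bsub>N\<^esub>l\<in>A. v l \<odot>\<^bsub>N\<^esub> f (unit_vec R b l))
        = (\<Oplus>\<^bsub>N\<^esub>l\<in>A. v l \<odot>\<^bsub>N\<^esub> \<rho> (s l + a) (f (unit_vec R b l)))" if "A \<subseteq> {..<b}" for A
      using finite_subset[OF that finite_lessThan] that
    proof (induction A rule: finite_induct)
      case (insert x F)
      have x: "\<rho> (e + a) (v x \<odot>\<^bsub>N\<^esub> f (unit_vec R b x)) = v x \<odot>\<^bsub>N\<^esub> \<rho> (s x + a) (f (unit_vec R b x))"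
        using N.gproj_smult[of "v x" "e - s x" "f (unit_vec R b x)" "s x + a"] v insert(4) uc
        by (auto simp: algebra_simps PiE_iff)
      have 1: "(\<lambda>l. v l \<odot>\<^bsub>N\<^esub> f (unit_vec R b l)) \<in> F \<rightarrow> carrier N"
        "(\<lambda>l. v l \<odot>\<^bsub>N\<^esub> \<rho> (s l + a) (f (unit_vec R b l))) \<in> F \<rightarrow> carrier N"
        using insert(4) vl uc by auto
      have 2: "v x \<odot>\<^bsub>N\<^esub> f (unit_vec R b x) \<in> carrier N"
        "v x \<odot>\<^bsub>N\<^esub> \<rho> (s x + a) (f (unit_vec R b x)) \<in> carrier N"
        using insert(4) vl uc by auto
      show ?case using insert(1,2,4) 1 2 x insert(3) by (simp add: N.gproj_add)
    qed (simp add: N.gproj_zero)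
    from this[of "{..<b}"] show ?thesis
      unfolding lin_map_free_expand[OF N.module_M f vc] by (simp add: lin_comb_def)
  qed
  moreover have "?h (unit_vec R b l) = \<rho> (s l + a) (f (unit_vec R b l))" if "l < b" for l
    by (rule lin_comb_unit_vec[OF N.module_M]) (use that uc in auto)
  ultimately show ?thesis using that h by blast
qed

end

section \<open>Graded free resolutions\<close>

lemma module_minus_eq_zero:
  assumes "Module.module R M" "v \<in> carrier M" "w \<in> carrier M"
  shows "v \<ominus>\<^bsub>M\<^esub> w = \<zero>\<^bsub>M\<^esub> \<longleftrightarrow> v = w"
proof -
  interpret M: Module.module R M by fact
  have "v = (v \<ominus>\<^bsub>M\<^esub> w) \<oplus>\<^bsub>M\<^esub> w" using assms(2,3) by (simp add: a_minus_def M.a_assoc M.l_neg)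
  then show ?thesis using assms(2,3) by (auto simp: a_minus_def M.r_neg)
qed

lemma hom_module_carrier:
  "\<phi> \<in> carrier (hom_module R M N) \<longleftrightarrow> \<phi> \<in> extensional (carrier M) \<and> lin_map R M N \<phi>"
  unfolding hom_module_def lin_map_def Let_def PiE_iff Pi_iff by auto

lemma hom_module_component:
  "\<phi> \<in> component (hom_module R M N) a \<longleftrightarrow>
     \<phi> \<in> carrier (hom_module R M N) \<and> (\<forall>e. \<phi> ` component M e \<subseteq> component N (e + a))"
  unfolding hom_module_def Let_def by auto

lemma lin_map_restrict:
  assumes "Module.module R M"
  shows "lin_map R M N (restrict \<phi> (carrier M)) \<longleftrightarrow> lin_map R M N \<phi>"
proof -
  interpret M: Module.module R M by fact
  show ?thesis by (simp add: lin_map_def Pi_iff)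
qed

lemma lin_map_inverse:
  assumes "Module.module R M" "lin_map R M N f" "bij_betw f (carrier M) (carrier N)"
  shows "lin_map R N M (inv_into (carrier M) f)"
proof -
  interpret M: Module.module R M by fact
  let ?g = "inv_into (carrier M) f"
  have fg: "f (?g w) = w" "?g w \<in> carrier M" if "w \<in> carrier N" for w
    using that assms(3) by (auto simp: bij_betw_def f_inv_into_f inv_into_into)
  have gf: "?g (f v) = v" if "v \<in> carrier M" for v
    using that assms(3) by (simp add: bij_betw_def)
  show ?thesis
  proof (rule lin_mapI)
    fix v w assume "v \<in> carrier N" "w \<in> carrier N"
    then show "?g (v \<oplus>\<^bsub>N\<^esub> w) = ?g v \<oplus>\<^bsub>M\<^esub> ?g w"
      using gf[of "?g v \<oplus>\<^bsub>M\<^esub> ?g w"] lin_map_add[OF assms(2), of "?g v" "?g w"] by (simp add: fg)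
  next
    fix r v assume "r \<in> carrier R" "v \<in> carrier N"
    then show "?g (r \<odot>\<^bsub>N\<^esub> v) = r \<odot>\<^bsub>M\<^esub> ?g v"
      using gf[of "r \<odot>\<^bsub>M\<^esub> ?g v"] lin_map_smult[OF assms(2), of r "?g v"] by (simp add: fg)
  qed (rule fg)
qed

lemma (in gring) lin_map_free_submodule:
  assumes "Module.module R N" "submodule Z R N" "lin_map R (free_module R b s) N f"
    and "\<And>l. l < b \<Longrightarrow> f (unit_vec R b l) \<in> Z" and v: "v \<in> carrier (free_module R b s)"
  shows "f v \<in> Z"
proof -
  interpret N: Module.module R N by fact
  show ?thesis
    unfolding lin_map_free_expand[OF assms(1,3) v] lin_comb_def
    by (rule submodule_finsum[OF assms(1,2)])
      (use v assms(4) N.submoduleE(4)[OF assms(2)] in auto)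
qed

locale gres = gring R \<pi> for R :: "'a graded_ring" (structure) and \<pi> +
  fixes K :: "('a, 'b) graded_module" and X :: "('a, 'b) free_data"
  assumes module_K: "Module.module R K"
    and res: "graded_free_resolution R K X"
begin

abbreviation F where "F p \<equiv> fmod R X p"
abbreviation e where "e p \<equiv> unit_vec R (frank X p)"

lemma module_F: "Module.module R (F p)"
  unfolding fmod_def by (rule module_free)

lemma e_carrier: "e p l \<in> carrier (F p)"
  unfolding fmod_def by (rule unit_vec_carrier)

lemma e_component: "e p l \<in> component (F p) (fshift X p l)"
  unfolding fmod_def by (rule unit_vec_component)

lemma aug_lin: "lin_map R (F 0) K (faug X)"
  and aug_deg: "v \<in> component (F 0) c \<Longrightarrow> faug X v \<in> component K c"
  and diff_lin: "lin_map R (F (Suc p)) (F p) (fdiff X p)"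
  and diff_deg: "v \<in> component (F (Suc p)) c \<Longrightarrow> fdiff X p v \<in> component (F p) c"
  using res unfolding graded_free_resolution_def hom_module_component hom_module_carrier by fastforce+

lemma aug_surj: "faug X ` carrier (F 0) = carrier K"
  and exact0: "{v \<in> carrier (F 0). faug X v = \<zero>\<^bsub>K\<^esub>} = fdiff X 0 ` carrier (F 1)"
  and exactS: "{v \<in> carrier (F (Suc p)). fdiff X p v = \<zero>\<^bsub>F p\<^esub>} = fdiff X (Suc p) ` carrier (F (Suc (Suc p)))"
  using res unfolding graded_free_resolution_def by blast+

lemma diff_closed: "v \<in> carrier (F (Suc p)) \<Longrightarrow> fdiff X p v \<in> carrier (F p)"
  by (rule lin_map_closed[OF diff_lin])

lemma aug_diff: "v \<in> carrier (F (Suc 0)) \<Longrightarrow> faug X (fdiff X 0 v) = \<zero>\<^bsub>K\<^esub>"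
  using exact0 by auto

lemma diff_diff: "v \<in> carrier (F (Suc (Suc p))) \<Longrightarrow> fdiff X p (fdiff X (Suc p) v) = \<zero>\<^bsub>F p\<^esub>"
  using exactS[of p] by blast

lemmas F_lift = free_lift[where b = "frank X p" and s = "fshift X p", folded fmod_def] for p
lemmas F_degree = lin_map_degree[where b = "frank X p" and s = "fshift X p", folded fmod_def] for p
lemmas F_submodule = lin_map_free_submodule[where b = "frank X p" and s = "fshift X p", folded fmod_def] for p
lemmas F_homogenize = free_homogenize[where b = "frank X p" and s = "fshift X p", folded fmod_def] for p

section \<open>Null-homotopic multiplications and acyclic coefficients\<close>

text \<open>Multiplication by \<open>x\<close> and the zero map both cover the zero map on
  \<open>K\<close>, so by the comparison theorem they are homotopic. The homotopy \<open>h\<close>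
  is built one degree after the other.\<close>

lemma smult_null_homotopic:
  assumes x: "x \<in> carrier R" and ann: "\<And>k. k \<in> carrier K \<Longrightarrow> x \<odot>\<^bsub>K\<^esub> k = \<zero>\<^bsub>K\<^esub>"
  obtains h where "\<And>p. lin_map R (F p) (F (Suc p)) (h p)"
    "\<And>v. v \<in> carrier (F 0) \<Longrightarrow> fdiff X 0 (h 0 v) = x \<odot>\<^bsub>F 0\<^esub> v"
    "\<And>p v. v \<in> carrier (F (Suc p)) \<Longrightarrow>
       fdiff X (Suc p) (h (Suc p) v) = x \<odot>\<^bsub>F (Suc p)\<^esub> v \<ominus>\<^bsub>F (Suc p)\<^esub> h p (fdiff X p v)"
proof -
  \<comment> \<open>The last conjunct of \<open>P\<close> says that \<open>x v - h (d v)\<close> is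
    a cycle for every \<open>v\<close> in \<open>F (p + 1)\<close>, which by exactness makes the
    next lift possible. \<open>Q\<close> is the homotopy equation between consecutive maps.\<close>
  define P where "P p h \<longleftrightarrow> lin_map R (F p) (F (Suc p)) h \<and>
     (p = 0 \<longrightarrow> (\<forall>v\<in>carrier (F 0). fdiff X 0 (h v) = x \<odot>\<^bsub>F 0\<^esub> v)) \<and>
     (\<forall>v\<in>carrier (F (Suc p)). fdiff X p (h (fdiff X p v)) = x \<odot>\<^bsub>F p\<^esub> fdiff X p v)" for p h
  define Q where "Q p h h' \<longleftrightarrow> (\<forall>v\<in>carrier (F (Suc p)).
     fdiff X (Suc p) (h' v) = x \<odot>\<^bsub>F (Suc p)\<^esub> v \<ominus>\<^bsub>F (Suc p)\<^esub> h (fdiff X p v))" for p h h'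
  have "\<exists>h. \<forall>p. P p (h p) \<and> Q p (h p) (h (Suc p))"
  proof (rule dependent_nat_choice)
    interpret F0: Module.module R "F 0" by (rule module_F)
    have "\<exists>y\<in>UNIV. y \<in> carrier (F (Suc 0)) \<and> fdiff X 0 y = x \<odot>\<^bsub>F 0\<^esub> e 0 l" for l
    proof -
      have "x \<odot>\<^bsub>F 0\<^esub> e 0 l \<in> {v \<in> carrier (F 0). faug X v = \<zero>\<^bsub>K\<^esub>}"
        using x ann[OF lin_map_closed[OF aug_lin e_carrier]]
        by (simp add: lin_map_smult[OF aug_lin x e_carrier] F0.smult_closed e_carrier)
      then show ?thesis unfolding exact0 by auto
    qed
    then obtain h where h: "lin_map R (F 0) (F (Suc 0)) h"
      "\<And>v. v \<in> carrier (F 0) \<Longrightarrow> fdiff X 0 (h v) = x \<odot>\<^bsub>F 0\<^esub> v"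
      by (rule F_lift[OF module_F module_F diff_lin lin_map_smult_map[OF module_F x]]) blast
    then have "P 0 h" unfolding P_def using diff_closed by simp
    then show "\<exists>h. P 0 h" by blast
  next
    fix h p assume "P p h"
    then have h: "lin_map R (F p) (F (Suc p)) h"
      and hd: "\<And>v. v \<in> carrier (F (Suc p)) \<Longrightarrow> fdiff X p (h (fdiff X p v)) = x \<odot>\<^bsub>F p\<^esub> fdiff X p v"
      by (auto simp: P_def)
    interpret Fp: Module.module R "F p" by (rule module_F)
    interpret Fs: Module.module R "F (Suc p)" by (rule module_F)
    let ?f = "\<lambda>v. x \<odot>\<^bsub>F (Suc p)\<^esub> v \<ominus>\<^bsub>F (Suc p)\<^esub> h (fdiff X p v)"
    have f: "lin_map R (F (Suc p)) (F (Suc p)) ?f"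
      by (rule lin_map_diff[OF module_F lin_map_smult_map[OF module_F x] lin_map_compose[OF diff_lin h]])
    have "\<exists>y\<in>UNIV. y \<in> carrier (F (Suc (Suc p))) \<and> fdiff X (Suc p) y = ?f (e (Suc p) l)" for l
    proof -
      let ?u = "e (Suc p) l"
      have hc: "h (fdiff X p ?u) \<in> carrier (F (Suc p))"
        by (intro lin_map_closed[OF h] diff_closed e_carrier)
      have "fdiff X p (?f ?u) = x \<odot>\<^bsub>F p\<^esub> fdiff X p ?u \<ominus>\<^bsub>F p\<^esub> fdiff X p (h (fdiff X p ?u))"
        using hc e_carrier x by (subst lin_map_minus[OF module_F module_F diff_lin])
          (auto simp: lin_map_smult[OF diff_lin])
      also have "\<dots> = \<zero>\<^bsub>F p\<^esub>"
        using hd[OF e_carrier] x diff_closed[OF e_carrier] by (simp add: Fp.r_neg a_minus_def)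
      finally have "?f ?u \<in> {v \<in> carrier (F (Suc p)). fdiff X p v = \<zero>\<^bsub>F p\<^esub>}"
        using lin_map_closed[OF f e_carrier] by simp
      then show ?thesis unfolding exactS by auto
    qed
    then obtain h' where h': "lin_map R (F (Suc p)) (F (Suc (Suc p))) h'"
      "\<And>v. v \<in> carrier (F (Suc p)) \<Longrightarrow> fdiff X (Suc p) (h' v) = ?f v"
      by (rule F_lift[OF module_F module_F diff_lin f]) blast
    have "fdiff X (Suc p) (h' (fdiff X (Suc p) v)) = x \<odot>\<^bsub>F (Suc p)\<^esub> fdiff X (Suc p) v"
      if v: "v \<in> carrier (F (Suc (Suc p)))" for v
      using h'(2)[OF diff_closed[OF v]] diff_diff[OF v] x diff_closed[OF v]
        lin_map_zero[OF module_F module_F h] by (simp add: a_minus_def)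
    then have "P (Suc p) h'" "Q p h h'" using h' by (auto simp: P_def Q_def)
    then show "\<exists>h'. P (Suc p) h' \<and> Q p h h'" by blast
  qed
  then obtain h where "\<And>p. P p (h p)" "\<And>p. Q p (h p) (h (Suc p))" by blast
  then show ?thesis using that[of h] unfolding P_def Q_def by blast
qed

text \<open>\<open>Ext\<^sup>i(K, N) = 0\<close> for all \<open>i\<close>; the degree \<open>i = 0\<close> has to be treated separately.\<close>

definition hom_acyclic :: "('a, 'c) graded_module \<Rightarrow> bool" where
  "hom_acyclic N \<longleftrightarrow>
     (\<forall>\<phi>. lin_map R (F 0) N \<phi> \<longrightarrow> (\<forall>v\<in>carrier (F (Suc 0)). \<phi> (fdiff X 0 v) = \<zero>\<^bsub>N\<^esub>) \<longrightarrow>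
        (\<forall>v\<in>carrier (F 0). \<phi> v = \<zero>\<^bsub>N\<^esub>)) \<and>
     (\<forall>p \<phi>. lin_map R (F (Suc p)) N \<phi> \<longrightarrow>
        (\<forall>v\<in>carrier (F (Suc (Suc p))). \<phi> (fdiff X (Suc p) v) = \<zero>\<^bsub>N\<^esub>) \<longrightarrow>
        (\<exists>\<psi>. lin_map R (F p) N \<psi> \<and> (\<forall>v\<in>carrier (F (Suc p)). \<phi> v = \<psi> (fdiff X p v))))"

text \<open>On the maps from \<open>F\<close> to \<open>N\<close>, multiplication by
  \<open>x\<close> is null-homotopic because it kills \<open>K\<close>, and bijective because it is
  so on \<open>N\<close>. Hence a cocycle \<open>\<phi>\<close> satisfies
  \<open>x \<phi> = \<phi> h d\<close>, or \<open>x \<phi> = 0\<close> in degree 0, and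
  \<open>x\<close> is divided out by the inverse map \<open>?g\<close>.\<close>

lemma hom_acyclicI:
  assumes x: "x \<in> carrier R" and ann: "\<And>k. k \<in> carrier K \<Longrightarrow> x \<odot>\<^bsub>K\<^esub> k = \<zero>\<^bsub>K\<^esub>"
    and N: "Module.module R N" and bij: "bij_betw (\<lambda>v. x \<odot>\<^bsub>N\<^esub> v) (carrier N) (carrier N)"
  shows "hom_acyclic N"
proof -
  interpret N: Module.module R N by fact
  obtain h where h: "\<And>p. lin_map R (F p) (F (Suc p)) (h p)"
    and h0: "\<And>v. v \<in> carrier (F 0) \<Longrightarrow> fdiff X 0 (h 0 v) = x \<odot>\<^bsub>F 0\<^esub> v"
    and hS: "\<And>p v. v \<in> carrier (F (Suc p)) \<Longrightarrow>
       fdiff X (Suc p) (h (Suc p) v) = x \<odot>\<^bsub>F (Suc p)\<^esub> v \<ominus>\<^bsub>F (Suc p)\<^esub> h p (fdiff X p v)"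
    using smult_null_homotopic[OF x ann] by blast
  let ?g = "inv_into (carrier N) (\<lambda>v. x \<odot>\<^bsub>N\<^esub> v)"
  have g: "lin_map R N N ?g" by (rule lin_map_inverse[OF N lin_map_smult_map[OF N x] bij])
  have gx: "?g (x \<odot>\<^bsub>N\<^esub> v) = v" if "v \<in> carrier N" for v
    using that bij by (simp add: bij_betw_def)
  show ?thesis unfolding hom_acyclic_def
  proof (intro conjI allI impI ballI)
    fix \<phi> v assume \<phi>: "lin_map R (F 0) N \<phi>" "\<forall>v\<in>carrier (F (Suc 0)). \<phi> (fdiff X 0 v) = \<zero>\<^bsub>N\<^esub>"
      and v: "v \<in> carrier (F 0)"
    have "x \<odot>\<^bsub>N\<^esub> \<phi> v = \<phi> (fdiff X 0 (h 0 v))"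
      using lin_map_smult[OF \<phi>(1) x v] h0[OF v] by simp
    also have "\<dots> = \<zero>\<^bsub>N\<^esub>" using \<phi>(2) lin_map_closed[OF h v] by blast
    finally show "\<phi> v = \<zero>\<^bsub>N\<^esub>"
      using gx[OF lin_map_closed[OF \<phi>(1) v]] lin_map_zero[OF N N g] by simp
  next
    fix p \<phi> assume \<phi>: "lin_map R (F (Suc p)) N \<phi>"
      "\<forall>v\<in>carrier (F (Suc (Suc p))). \<phi> (fdiff X (Suc p) v) = \<zero>\<^bsub>N\<^esub>"
    have \<psi>: "lin_map R (F p) N (\<lambda>v. ?g (\<phi> (h p v)))"
      by (rule lin_map_compose[OF lin_map_compose[OF h \<phi>(1)] g])
    have "\<phi> v = ?g (\<phi> (h p (fdiff X p v)))" if v: "v \<in> carrier (F (Suc p))" for v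
    proof -
      interpret Fs: Module.module R "F (Suc p)" by (rule module_F)
      have c: "h p (fdiff X p v) \<in> carrier (F (Suc p))"
        by (rule lin_map_closed[OF h diff_closed[OF v]])
      have "\<phi> (x \<odot>\<^bsub>F (Suc p)\<^esub> v \<ominus>\<^bsub>F (Suc p)\<^esub> h p (fdiff X p v)) = \<zero>\<^bsub>N\<^esub>"
        unfolding hS[OF v, symmetric] using \<phi>(2) lin_map_closed[OF h v] by blast
      then have "x \<odot>\<^bsub>N\<^esub> \<phi> v \<ominus>\<^bsub>N\<^esub> \<phi> (h p (fdiff X p v)) = \<zero>\<^bsub>N\<^esub>"
        using lin_map_minus[OF module_F N \<phi>(1) _ c] lin_map_smult[OF \<phi>(1) x v] x v by simp
      then have "x \<odot>\<^bsub>N\<^esub> \<phi> v = \<phi> (h p (fdiff X p v))"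
        using x lin_map_closed[OF \<phi>(1)] v c by (simp add: module_minus_eq_zero[OF N])
      then show ?thesis using gx[OF lin_map_closed[OF \<phi>(1) v]] by simp
    qed
    then show "\<exists>\<psi>. lin_map R (F p) N \<psi> \<and> (\<forall>v\<in>carrier (F (Suc p)). \<phi> v = \<psi> (fdiff X p v))"
      using \<psi> by blast
  qed
qed

text \<open>A map into a product is a family of maps into the factors, and the maps
  \<open>\<psi>\<close> can be chosen factor by factor.\<close>

lemma hom_acyclic_pointwise:
  fixes P :: "('a, 'i \<Rightarrow> 'c) graded_module" and N :: "'i \<Rightarrow> ('a, 'c) graded_module"
  assumes acyc: "\<And>i. i \<in> J \<Longrightarrow> hom_acyclic (N i)"
    and car: "carrier P = (\<Pi>\<^sub>E i\<in>J. carrier (N i))"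
    and zero: "\<zero>\<^bsub>P\<^esub> = (\<lambda>i\<in>J. \<zero>\<^bsub>N i\<^esub>)"
    and add: "\<And>v w. v \<oplus>\<^bsub>P\<^esub> w = (\<lambda>i\<in>J. v i \<oplus>\<^bsub>N i\<^esub> w i)"
    and smult: "\<And>r v. r \<odot>\<^bsub>P\<^esub> v = (\<lambda>i\<in>J. r \<odot>\<^bsub>N i\<^esub> v i)"
  shows "hom_acyclic P"
proof -
  have comp: "lin_map R M (N i) (\<lambda>v. \<phi> v i)" if \<phi>: "lin_map R M P \<phi>" and i: "i \<in> J"
    for M :: "('a, nat \<Rightarrow> 'a) graded_module" and i \<phi>
  proof (rule lin_mapI)
    show "\<phi> v i \<in> carrier (N i)" if "v \<in> carrier M" for v
      using lin_map_closed[OF \<phi> that] i by (auto simp: car)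
  qed (use lin_map_add[OF \<phi>] lin_map_smult[OF \<phi>] i add smult in auto)
  show ?thesis unfolding hom_acyclic_def
  proof (intro conjI allI impI ballI)
    fix \<phi> v assume \<phi>: "lin_map R (F 0) P \<phi>" "\<forall>v\<in>carrier (F (Suc 0)). \<phi> (fdiff X 0 v) = \<zero>\<^bsub>P\<^esub>"
      and v: "v \<in> carrier (F 0)"
    have "\<phi> v i = \<zero>\<^bsub>N i\<^esub>" if i: "i \<in> J" for i
    proof -
      have "\<forall>v\<in>carrier (F (Suc 0)). \<phi> (fdiff X 0 v) i = \<zero>\<^bsub>N i\<^esub>" using \<phi>(2) i zero by simp
      then show ?thesis
        using acyc[OF i] comp[OF \<phi>(1) i] v unfolding hom_acyclic_def by blast
    qed
    then show "\<phi> v = \<zero>\<^bsub>P\<^esub>"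
      unfolding zero using lin_map_closed[OF \<phi>(1) v]
      by (intro extensionalityI[of _ J]) (auto simp: car PiE_iff)
  next
    fix p \<phi> assume \<phi>: "lin_map R (F (Suc p)) P \<phi>"
      "\<forall>v\<in>carrier (F (Suc (Suc p))). \<phi> (fdiff X (Suc p) v) = \<zero>\<^bsub>P\<^esub>"
    have "\<exists>\<psi>. lin_map R (F p) (N i) \<psi> \<and> (\<forall>v\<in>carrier (F (Suc p)). \<phi> v i = \<psi> (fdiff X p v))"
      if i: "i \<in> J" for i
    proof -
      have "\<forall>v\<in>carrier (F (Suc (Suc p))). \<phi> (fdiff X (Suc p) v) i = \<zero>\<^bsub>N i\<^esub>"
        using \<phi>(2) i zero by simp
      then show ?thesis
        using acyc[OF i] comp[OF \<phi>(1) i] unfolding hom_acyclic_def by blast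
    qed
    then obtain \<psi> where \<psi>: "\<And>i. i \<in> J \<Longrightarrow> lin_map R (F p) (N i) (\<psi> i)"
      "\<And>i v. i \<in> J \<Longrightarrow> v \<in> carrier (F (Suc p)) \<Longrightarrow> \<phi> v i = \<psi> i (fdiff X p v)" by metis
    have "lin_map R (F p) P (\<lambda>v. \<lambda>i\<in>J. \<psi> i v)"
      by (rule lin_mapI) (auto simp: car add smult lin_map_closed[OF \<psi>(1)] lin_map_add[OF \<psi>(1)]
          lin_map_smult[OF \<psi>(1)] intro!: restrict_ext)
    moreover have "\<phi> v = (\<lambda>i\<in>J. \<psi> i (fdiff X p v))" if v: "v \<in> carrier (F (Suc p))" for v
      using lin_map_closed[OF \<phi>(1) v] v \<psi>(2)
      by (intro extensionalityI[of _ J]) (auto simp: car PiE_iff)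
    ultimately show "\<exists>\<psi>. lin_map R (F p) P \<psi> \<and> (\<forall>v\<in>carrier (F (Suc p)). \<phi> v = \<psi> (fdiff X p v))"
      by (intro exI[of _ "\<lambda>v. \<lambda>i\<in>J. \<psi> i v"]) simp
  qed
qed

section \<open>Exploiting the vanishing of Ext in one degree\<close>

text \<open>The body of \<open>Ext\<close> with the resolution of the locale in place of the chosen
  one; the two agree once \<open>X\<close> is taken to be the chosen one.\<close>

definition ext_complex :: "nat \<Rightarrow> ('a, 'c) graded_module \<Rightarrow> ('a, ((nat \<Rightarrow> 'a) \<Rightarrow> 'c) set) graded_module" where
  "ext_complex i N = cohomology (\<lambda>p. hom_module R (F p) N)
      (\<lambda>p \<phi>. \<lambda>v\<in>carrier (F (Suc p)). \<phi> (fdiff X p v)) i"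

text \<open>A vanishing component says that the coset of a homogeneous cocycle is the zero coset.
  The resulting \<open>\<chi>\<close> carries no degree; \<open>ext_lift\<close> makes up for
  this.\<close>

lemma ext_complex_vanish:
  assumes N: "Module.module R N"
    and van: "component (ext_complex (Suc p) N) a = {\<zero>\<^bsub>ext_complex (Suc p) N\<^esub>}"
    and \<phi>: "lin_map R (F (Suc p)) N \<phi>" "\<And>c v. v \<in> component (F (Suc p)) c \<Longrightarrow> \<phi> v \<in> component N (c + a)"
    and cyc: "\<And>v. v \<in> carrier (F (Suc (Suc p))) \<Longrightarrow> \<phi> (fdiff X (Suc p) v) = \<zero>\<^bsub>N\<^esub>"
  obtains \<chi> where "lin_map R (F p) N \<chi>" "\<And>v. v \<in> carrier (F (Suc p)) \<Longrightarrow> \<phi> v = \<chi> (fdiff X p v)"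
proof -
  interpret N: Module.module R N by fact
  let ?H = "\<lambda>p. hom_module R (F p) N"
  let ?D = "\<lambda>p \<phi>. \<lambda>v\<in>carrier (F (Suc p)). \<phi> (fdiff X p v)"
  let ?f = "restrict \<phi> (carrier (F (Suc p)))"
  let ?Z = "{z \<in> carrier (?H (Suc p)). ?D (Suc p) z = \<zero>\<^bsub>?H (Suc (Suc p))\<^esub>}"
  let ?B = "?D p ` carrier (?H p)"
  have Fsub: "component (F q) c \<subseteq> carrier (F q)" for q c
    unfolding fmod_def by (rule gmod.comp_sub[OF gmod_free])
  have fc: "?f \<in> component (?H (Suc p)) a"
    unfolding hom_module_component hom_module_carrier lin_map_restrict[OF module_F]
    using \<phi> Fsub by (auto simp: image_subset_iff subset_iff)
  have Df: "?D (Suc p) ?f = \<zero>\<^bsub>?H (Suc (Suc p))\<^esub>"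
    using cyc diff_closed by (auto simp: hom_module_def intro!: restrict_ext)
  have fH: "?f \<in> carrier (?H (Suc p))"
    using fc unfolding hom_module_component by (rule conjunct1)
  have fZ: "?f \<in> ?Z \<inter> component (?H (Suc p)) a"
    by (intro IntI CollectI conjI fH Df fc)
  have "?B +>\<^bsub>?H (Suc p)\<^esub> ?f \<in> component (ext_complex (Suc p) N) a"
    unfolding ext_complex_def cohomology_def subquotient_def
    by (simp only: graded_module.simps nat.case) (rule imageI[OF fZ])
  then have fB: "?B +>\<^bsub>?H (Suc p)\<^esub> ?f = ?B"
    unfolding van by (simp add: ext_complex_def cohomology_def subquotient_def)
  \<comment> \<open>The map \<open>?f\<close> is found in its own coset as zero plus
    \<open>?f\<close>. This is computed directly, because no module structure on
    \<open>hom_module\<close> has been established.\<close>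
  have "(\<lambda>v\<in>carrier (F p). \<zero>\<^bsub>N\<^esub>) \<in> carrier (?H p)"
    unfolding hom_module_carrier
    using lin_map_zero_map[OF N] lin_map_restrict[OF module_F, where N = N and \<phi> = "\<lambda>_. \<zero>\<^bsub>N\<^esub>"] by auto
  then have "?D p (\<lambda>v\<in>carrier (F p). \<zero>\<^bsub>N\<^esub>) \<in> ?B" by (rule imageI)
  moreover have "?D p (\<lambda>v\<in>carrier (F p). \<zero>\<^bsub>N\<^esub>) = (\<lambda>v\<in>carrier (F (Suc p)). \<zero>\<^bsub>N\<^esub>)"
    by (rule restrict_ext) (simp add: diff_closed)
  ultimately have z: "(\<lambda>v\<in>carrier (F (Suc p)). \<zero>\<^bsub>N\<^esub>) \<in> ?B" by (simp only:)
  have "(\<lambda>v\<in>carrier (F (Suc p)). \<zero>\<^bsub>N\<^esub>) \<oplus>\<^bsub>?H (Suc p)\<^esub> ?f = ?f"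
    using lin_map_closed[OF \<phi>(1)] by (auto simp: hom_module_def intro!: restrict_ext)
  then have "?f \<in> ?B +>\<^bsub>?H (Suc p)\<^esub> ?f"
    using z unfolding a_r_coset_def' by (intro UN_I[OF z]) simp
  then obtain \<chi> where \<chi>: "\<chi> \<in> carrier (?H p)" "?f = ?D p \<chi>" unfolding fB by blast
  show ?thesis
  proof
    show "lin_map R (F p) N \<chi>" using \<chi>(1) unfolding hom_module_carrier by blast
    show "\<phi> v = \<chi> (fdiff X p v)" if "v \<in> carrier (F (Suc p))" for v
      using fun_cong[OF \<chi>(2), of v] that by simp
  qed
qed

text \<open>Turns the vanishing for the subquotient \<open>Z/B\<close> into a statement about maps
  into \<open>C\<close>. Modulo \<open>B\<close> the map \<open>\<phi>\<close> is a cocycle, hence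
  equal to \<open>\<chi>' d\<close> for some \<open>\<chi>'\<close>, and \<open>\<chi>'\<close>
  lifts to \<open>Z\<close> because \<open>F p\<close> is free.\<close>

lemma ext_lift:
  assumes "gmod R C \<rho>" and Z: "submodule Z R C" and B: "submodule B R C" and BZ: "B \<subseteq> Z"
    and \<rho>Z: "\<And>c z. z \<in> Z \<Longrightarrow> \<rho> c z \<in> Z" and \<rho>B: "\<And>c z. z \<in> B \<Longrightarrow> \<rho> c z \<in> B"
    and van: "component (ext_complex (Suc p) (subquotient C Z B)) a
        = {\<zero>\<^bsub>ext_complex (Suc p) (subquotient C Z B)\<^esub>}"
    and \<phi>: "lin_map R (F (Suc p)) C \<phi>" "\<And>c v. v \<in> component (F (Suc p)) c \<Longrightarrow> \<phi> v \<in> component C (c + a)"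
    and \<phi>Z: "\<And>v. v \<in> carrier (F (Suc p)) \<Longrightarrow> \<phi> v \<in> Z"
    and \<phi>B: "\<And>v. v \<in> carrier (F (Suc (Suc p))) \<Longrightarrow> \<phi> (fdiff X (Suc p) v) \<in> B"
  obtains \<chi> where "lin_map R (F p) C \<chi>" "\<And>l. l < frank X p \<Longrightarrow> \<chi> (e p l) \<in> component C (fshift X p l + a)"
    "\<And>v. v \<in> carrier (F p) \<Longrightarrow> \<chi> v \<in> Z"
    "\<And>v. v \<in> carrier (F (Suc p)) \<Longrightarrow> \<phi> v \<ominus>\<^bsub>C\<^esub> \<chi> (fdiff X p v) \<in> B"
proof -
  interpret C: gmod R C \<rho> by fact
  note mC = C.module_M
  let ?Q = "subquotient C Z B" and ?CZ = "C\<lparr>carrier := Z\<rparr>" and ?q = "\<lambda>z. B +>\<^bsub>C\<^esub> z"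
  have mZ: "Module.module R ?CZ" by (rule submodule.submodule_is_module[OF Z mC])
  have Zc: "z \<in> carrier C" if "z \<in> Z" for z using that C.submoduleE(1)[OF Z] by blast
  note mQ = subquotient_module(1)[OF mC Z B] and q = subquotient_module(2)[OF mC Z B]
  have \<phi>': "lin_map R (F (Suc p)) ?CZ \<phi>"
    using \<phi>(1) \<phi>Z unfolding lin_map_def by auto
  have "?q (\<phi> v) \<in> component ?Q (c + a)" if v: "v \<in> component (F (Suc p)) c" for v c
  proof -
    have "v \<in> carrier (F (Suc p))" using v gmod.comp_sub[OF gmod_free] unfolding fmod_def by blast
    then show ?thesis using \<phi>(2)[OF v] \<phi>Z by (auto simp: subquotient_def)
  qed
  moreover have "?q (\<phi> (fdiff X (Suc p) v)) = \<zero>\<^bsub>?Q\<^esub>" if "v \<in> carrier (F (Suc (Suc p)))" for v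
    using coset_eq_self_iff[OF mC B] \<phi>B[OF that] lin_map_closed[OF \<phi>(1) diff_closed[OF that]]
    by (simp add: subquotient_def)
  ultimately obtain \<chi>' where \<chi>': "lin_map R (F p) ?Q \<chi>'"
    "\<And>v. v \<in> carrier (F (Suc p)) \<Longrightarrow> ?q (\<phi> v) = \<chi>' (fdiff X p v)"
    using ext_complex_vanish[OF mQ van lin_map_compose[OF \<phi>' q]] by metis
  have "\<exists>y\<in>UNIV. y \<in> carrier ?CZ \<and> ?q y = \<chi>' (e p l)" for l
    using lin_map_closed[OF \<chi>'(1) e_carrier, of l] by (auto simp: subquotient_def)
  then obtain \<eta> where \<eta>: "lin_map R (F p) ?CZ \<eta>" "\<And>v. v \<in> carrier (F p) \<Longrightarrow> ?q (\<eta> v) = \<chi>' v"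
    by (rule F_lift[OF mZ mQ q \<chi>'(1)]) blast
  have \<eta>Z: "\<eta> v \<in> Z" if "v \<in> carrier (F p)" for v using lin_map_closed[OF \<eta>(1) that] by simp
  have \<eta>l: "lin_map R (F p) C \<eta>" using \<eta>(1) Zc unfolding lin_map_def by auto
  \<comment> \<open>The lift \<open>\<eta>\<close> may be inhomogeneous. Its degree \<open>a\<close>
    part serves as well: the projection fixes the values of \<open>\<phi>\<close> on basis vectors
    and maps \<open>B\<close> into itself.\<close>
  obtain \<chi> where \<chi>: "lin_map R (F p) C \<chi>"
    "\<And>l. l < frank X p \<Longrightarrow> \<chi> (e p l) = \<rho> (fshift X p l + a) (\<eta> (e p l))"
    "\<And>c v. v \<in> component (F p) c \<Longrightarrow> \<chi> v = \<rho> (c + a) (\<eta> v)"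
    using F_homogenize[OF assms(1) \<eta>l, of a] by metis
  show ?thesis
  proof
    show "\<chi> (e p l) \<in> component C (fshift X p l + a)" if "l < frank X p" for l
      using \<chi>(2)[OF that] C.gproj_in Zc[OF \<eta>Z[OF e_carrier]] by simp
    show "\<chi> v \<in> Z" if "v \<in> carrier (F p)" for v
      by (rule F_submodule[OF mC Z \<chi>(1) _ that]) (simp add: \<chi>(2) \<rho>Z \<eta>Z e_carrier)
    show "\<phi> v \<ominus>\<^bsub>C\<^esub> \<chi> (fdiff X p v) \<in> B" if v: "v \<in> carrier (F (Suc p))" for v
    proof (rule F_submodule[OF mC B lin_map_diff[OF mC \<phi>(1) lin_map_compose[OF diff_lin \<chi>(1)]] _ v])
      fix l assume "l < frank X (Suc p)"
      let ?u = "e (Suc p) l" and ?c = "fshift X (Suc p) l"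
      have c1: "\<phi> ?u \<in> carrier C" by (rule lin_map_closed[OF \<phi>(1) e_carrier])
      have c2: "\<eta> (fdiff X p ?u) \<in> carrier C"
        by (rule lin_map_closed[OF \<eta>l diff_closed[OF e_carrier]])
      have "?q (\<phi> ?u) = ?q (\<eta> (fdiff X p ?u))"
        using \<chi>'(2)[OF e_carrier] \<eta>(2)[OF diff_closed[OF e_carrier]] by simp
      then have "\<phi> ?u \<ominus>\<^bsub>C\<^esub> \<eta> (fdiff X p ?u) \<in> B"
        using coset_eq_iff[OF mC B c1 c2] by simp
      then have "\<rho> (?c + a) (\<phi> ?u \<ominus>\<^bsub>C\<^esub> \<eta> (fdiff X p ?u)) \<in> B" by (rule \<rho>B)
      moreover have "\<rho> (?c + a) (\<phi> ?u) = \<phi> ?u"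
        by (rule C.gproj_id[OF \<phi>(2)[OF e_component]])
      moreover have "\<rho> (?c + a) (\<eta> (fdiff X p ?u)) = \<chi> (fdiff X p ?u)"
        using \<chi>(3)[OF diff_deg[OF e_component]] by simp
      ultimately show "\<phi> ?u \<ominus>\<^bsub>C\<^esub> \<chi> (fdiff X p ?u) \<in> B"
        using c1 c2 by (simp add: a_minus_def C.gproj_add C.gproj_a_inv)
    qed
  qed (rule \<chi>(1))
qed

end

section \<open>The double complex\<close>

lemma module_minus_zero:
  assumes "Module.module R M" "v \<in> carrier M"
  shows "v \<ominus>\<^bsub>M\<^esub> \<zero>\<^bsub>M\<^esub> = v"
proof -
  interpret M: Module.module R M by fact
  have "\<ominus>\<^bsub>M\<^esub> \<zero>\<^bsub>M\<^esub> = \<zero>\<^bsub>M\<^esub>" by (rule M.minus_equality) auto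
  then show ?thesis using assms(2) by (simp add: a_minus_def)
qed

text \<open>The chase works for any complex \<open>C\<close> of graded modules with these
  properties. Here \<open>a\<close> is the one degree under consideration and \<open>d\<close> the
  cohomological degree of the socle. By \<open>low\<close>, a map of degree \<open>a\<close> from
  \<open>F d\<close> to \<open>C 0\<close> vanishes on the basis vectors.\<close>

locale chase = gres R \<pi> K X
  for R :: "'a graded_ring" (structure) and \<pi> and K :: "('a, 'b) graded_module" and X +
  fixes C :: "nat \<Rightarrow> ('a, 'c) graded_module" and \<delta> :: "nat \<Rightarrow> 'c \<Rightarrow> 'c"
    and \<rho> :: "nat \<Rightarrow> int \<Rightarrow> 'c \<Rightarrow> 'c" and a :: int and d :: nat
  assumes gmod_C: "gmod R (C q) (\<rho> q)"
    and \<delta>_lin: "lin_map R (C q) (C (Suc q)) (\<delta> q)"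
    and \<delta>_\<delta>: "v \<in> carrier (C q) \<Longrightarrow> \<delta> (Suc q) (\<delta> q v) = \<zero>\<^bsub>C (Suc (Suc q))\<^esub>"
    and \<rho>_\<delta>: "v \<in> carrier (C q) \<Longrightarrow> \<rho> (Suc q) (c::int) (\<delta> q v) = \<delta> q (\<rho> q c v)"
    and acyclic_C: "hom_acyclic (C (Suc q))"
    and ext_van: "j < d \<Longrightarrow> i < d + 2 \<Longrightarrow>
      component (ext_complex i (cohomology C \<delta> j)) a = {\<zero>\<^bsub>ext_complex i (cohomology C \<delta> j)\<^esub>}"
    and low: "l < frank X d \<Longrightarrow> component (C 0) (fshift X d l + a) = {\<zero>\<^bsub>C 0\<^esub>}"
begin

text \<open>The case distinction is that of \<open>cohomology\<close>, so that cohomology becomes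
  literally the subquotient of \<open>cyc q\<close> by \<open>bd q\<close>.\<close>

definition bd :: "nat \<Rightarrow> 'c set" where
  "bd q = (case q of 0 \<Rightarrow> {\<zero>\<^bsub>C 0\<^esub>} | Suc l \<Rightarrow> \<delta> l ` carrier (C l))"

definition cyc :: "nat \<Rightarrow> 'c set" where
  "cyc q = {z \<in> carrier (C q). \<delta> q z = \<zero>\<^bsub>C (Suc q)\<^esub>}"

lemma module_C: "Module.module R (C q)"
  using gmod_C gmod.module_M by blast

lemma cohomology_eq: "cohomology C \<delta> q = subquotient (C q) (cyc q) (bd q)"
  by (simp add: cohomology_def cyc_def bd_def)

lemma submodule_cyc: "submodule (cyc q) R (C q)"
  unfolding cyc_def by (rule submodule_kernel[OF module_C module_C \<delta>_lin])

lemma submodule_bd: "submodule (bd q) R (C q)"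
proof (cases q)
  case 0
  then show ?thesis using submodule_zero_set[OF module_C] by (simp add: bd_def)
next
  case (Suc l)
  then show ?thesis
    using submodule_image[OF module_C module_C \<delta>_lin Module.module.carrier_is_submodule[OF module_C], of l]
    by (simp add: bd_def)
qed

lemma bd_cyc: "bd q \<subseteq> cyc q"
proof (cases q)
  case 0
  then show ?thesis
    using submodule_zero[OF module_C submodule_cyc, of 0] by (simp add: bd_def)
next
  case (Suc l)
  then show ?thesis using \<delta>_\<delta>[of _ l] lin_map_closed[OF \<delta>_lin] by (auto simp: bd_def cyc_def)
qed

lemma \<rho>_zero: "\<rho> q c \<zero>\<^bsub>C q\<^esub> = \<zero>\<^bsub>C q\<^esub>"
  by (rule gmod.gproj_zero[OF gmod_C])

lemma \<rho>_cyc: "z \<in> cyc q \<Longrightarrow> \<rho> q c z \<in> cyc q"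
  using gmod.gproj_closed[OF gmod_C] \<rho>_\<delta>[of z q c, symmetric] \<rho>_zero by (simp add: cyc_def)

lemma \<rho>_bd: "z \<in> bd q \<Longrightarrow> \<rho> q c z \<in> bd q"
  using gmod.gproj_closed[OF gmod_C] \<rho>_\<delta> \<rho>_zero by (cases q) (auto simp: bd_def)

definition homog :: "nat \<Rightarrow> nat \<Rightarrow> ((nat \<Rightarrow> 'a) \<Rightarrow> 'c) \<Rightarrow> bool" where
  "homog p q \<phi> \<longleftrightarrow> lin_map R (F p) (C q) \<phi> \<and>
     (\<forall>l<frank X p. \<phi> (e p l) \<in> component (C q) (fshift X p l + a))"

text \<open>Coboundaries of the complex \<open>Hom(F, C q)\<close>, which are zero in degree 0. No
  degree is required of \<open>\<psi>\<close>, since \<open>hom_acyclic\<close> provides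
  none.\<close>

definition cobd :: "nat \<Rightarrow> nat \<Rightarrow> ((nat \<Rightarrow> 'a) \<Rightarrow> 'c) \<Rightarrow> bool" where
  "cobd p q \<theta> \<longleftrightarrow> (case p of 0 \<Rightarrow> \<theta> = (\<lambda>v. \<zero>\<^bsub>C q\<^esub>)
     | Suc p' \<Rightarrow> \<exists>\<psi>. lin_map R (F p') (C q) \<psi> \<and> \<theta> = (\<lambda>v. \<psi> (fdiff X p' v)))"

lemma homog_degree:
  assumes "homog p q \<phi>" "v \<in> component (F p) c"
  shows "\<phi> v \<in> component (C q) (c + a)"
  by (rule F_degree[OF gmod_C]) (use assms in \<open>auto simp: homog_def\<close>)

text \<open>For each basis vector a preimage under \<open>\<delta> q\<close> is chosen and projected
  to the required degree. It stays a preimage because the projections commute with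
  \<open>\<delta>\<close> and fix the homogeneous value of \<open>\<phi>\<close>.\<close>

lemma homog_lift:
  assumes \<phi>: "homog p (Suc q) \<phi>"
    and bd: "\<And>v. v \<in> carrier (F (Suc p)) \<Longrightarrow> \<phi> (fdiff X p v) \<in> bd (Suc q)"
  obtains \<phi>' where "homog (Suc p) q \<phi>'"
    "\<And>v. v \<in> carrier (F (Suc p)) \<Longrightarrow> \<delta> q (\<phi>' v) = \<phi> (fdiff X p v)"
proof -
  have l: "lin_map R (F p) (C (Suc q)) \<phi>" using \<phi> by (simp add: homog_def)
  let ?A = "\<lambda>l. component (C q) (fshift X (Suc p) l + a)"
  have "\<exists>y\<in>?A l. y \<in> carrier (C q) \<and> \<delta> q y = \<phi> (fdiff X p (e (Suc p) l))" for l
  proof -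
    obtain y where y: "y \<in> carrier (C q)" "\<delta> q y = \<phi> (fdiff X p (e (Suc p) l))"
      using bd[OF e_carrier, of l] by (auto simp: bd_def)
    let ?y = "\<rho> q (fshift X (Suc p) l + a) y"
    have "\<delta> q ?y = \<rho> (Suc q) (fshift X (Suc p) l + a) (\<phi> (fdiff X p (e (Suc p) l)))"
      using \<rho>_\<delta>[OF y(1)] y(2) by simp
    also have "\<dots> = \<phi> (fdiff X p (e (Suc p) l))"
      by (rule gmod.gproj_id[OF gmod_C homog_degree[OF \<phi> diff_deg[OF e_component]]])
    finally have "\<delta> q ?y = \<phi> (fdiff X p (e (Suc p) l))" .
    then show ?thesis
      using gmod.gproj_in[OF gmod_C y(1)] gmod.gproj_closed[OF gmod_C y(1)] by blast
  qed
  then obtain \<phi>' where "lin_map R (F (Suc p)) (C q) \<phi>'"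
    "\<And>v. v \<in> carrier (F (Suc p)) \<Longrightarrow> \<delta> q (\<phi>' v) = \<phi> (fdiff X p v)"
    "\<And>l. l < frank X (Suc p) \<Longrightarrow> \<phi>' (e (Suc p) l) \<in> ?A l"
    by (rule F_lift[OF module_C module_C \<delta>_lin lin_map_compose[OF diff_lin l]]) blast+
  then show ?thesis using that[of \<phi>'] unfolding homog_def by blast
qed

text \<open>By the vanishing of \<open>Ext\<close> in degree \<open>a\<close> a lift can be changed by a cocycle so that the zigzag
  continues by one more step.\<close>

lemma homog_correct:
  assumes \<phi>: "homog (Suc p) q \<phi>" and q: "0 < q" "q < d" and p: "p < d"
    and cyc: "\<And>v. v \<in> carrier (F (Suc (Suc p))) \<Longrightarrow> \<delta> q (\<phi> (fdiff X (Suc p) v)) = \<zero>\<^bsub>C (Suc q)\<^esub>"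
  obtains \<chi> where "homog (Suc p) q \<chi>" "\<And>v. v \<in> carrier (F (Suc p)) \<Longrightarrow> \<delta> q (\<chi> v) = \<delta> q (\<phi> v)"
    "\<And>v. v \<in> carrier (F (Suc (Suc p))) \<Longrightarrow> \<chi> (fdiff X (Suc p) v) \<in> bd q"
proof -
  have l: "lin_map R (F (Suc p)) (C q) \<phi>" using \<phi> by (simp add: homog_def)
  interpret C: Module.module R "C q" by (rule module_C)
  interpret CS: Module.module R "C (Suc q)" by (rule module_C)
  let ?f = "\<lambda>v. \<phi> (fdiff X (Suc p) v)"
  have f: "lin_map R (F (Suc (Suc p))) (C q) ?f" by (rule lin_map_compose[OF diff_lin l])
  \<comment> \<open>The composite of \<open>\<phi>\<close> with the differential lives on
    \<open>F (p + 2)\<close>, and \<open>p < d\<close> puts this index below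
    \<open>d + 2\<close>.\<close>
  have van: "component (ext_complex (Suc (Suc p)) (subquotient (C q) (cyc q) (bd q))) a
      = {\<zero>\<^bsub>ext_complex (Suc (Suc p)) (subquotient (C q) (cyc q) (bd q))\<^esub>}"
    using ext_van[of q "Suc (Suc p)"] q p by (simp add: cohomology_eq)
  have deg: "?f v \<in> component (C q) (c + a)" if "v \<in> component (F (Suc (Suc p))) c" for v c
    by (rule homog_degree[OF \<phi> diff_deg[OF that]])
  have fZ: "?f v \<in> cyc q" if "v \<in> carrier (F (Suc (Suc p)))" for v
    using cyc[OF that] lin_map_closed[OF f that] by (simp add: cyc_def)
  have fB: "?f (fdiff X (Suc (Suc p)) v) \<in> bd q" if "v \<in> carrier (F (Suc (Suc (Suc p))))" for v
    using diff_diff[OF that] lin_map_zero[OF module_F module_C l] submodule_zero[OF module_C submodule_bd]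
    by simp
  obtain \<chi> where \<chi>: "lin_map R (F (Suc p)) (C q) \<chi>"
    "\<And>l. l < frank X (Suc p) \<Longrightarrow> \<chi> (e (Suc p) l) \<in> component (C q) (fshift X (Suc p) l + a)"
    "\<And>v. v \<in> carrier (F (Suc p)) \<Longrightarrow> \<chi> v \<in> cyc q"
    "\<And>v. v \<in> carrier (F (Suc (Suc p))) \<Longrightarrow> ?f v \<ominus>\<^bsub>C q\<^esub> \<chi> (fdiff X (Suc p) v) \<in> bd q"
    by (rule ext_lift[OF gmod_C submodule_cyc submodule_bd bd_cyc \<rho>_cyc \<rho>_bd van f deg fZ fB]) (assumption | blast)+
  show ?thesis
  proof
    show "homog (Suc p) q (\<lambda>v. \<phi> v \<ominus>\<^bsub>C q\<^esub> \<chi> v)"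
      using \<phi> \<chi>(2) gmod.comp_minus[OF gmod_C] lin_map_diff[OF module_C l \<chi>(1)] unfolding homog_def by blast
    show "\<delta> q (\<phi> v \<ominus>\<^bsub>C q\<^esub> \<chi> v) = \<delta> q (\<phi> v)" if v: "v \<in> carrier (F (Suc p))" for v
      using \<chi>(3)[OF v] lin_map_closed[OF l v] lin_map_closed[OF \<delta>_lin lin_map_closed[OF l v]]
      by (simp add: lin_map_minus[OF module_C module_C \<delta>_lin] cyc_def module_minus_zero[OF module_C])
  qed (rule \<chi>(4))
qed

text \<open>The induction runs along the antidiagonal \<open>r + q = d\<close>, starting from \<open>Hom(F\<^sub>d, C\<^sup>0)\<close>, whose part
  of degree \<open>a\<close> is zero.\<close>

lemma zigzag:
  assumes "r + q = d" "homog r q \<phi>"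
    "0 < q \<Longrightarrow> (\<And>v. v \<in> carrier (F (Suc r)) \<Longrightarrow> \<phi> (fdiff X r v) \<in> bd q)"
  shows "\<exists>\<theta>. cobd r q \<theta> \<and> (\<forall>v\<in>carrier (F r). \<phi> v \<ominus>\<^bsub>C q\<^esub> \<theta> v \<in> bd q)"
  using assms
proof (induction q arbitrary: r \<phi>)
  case 0
  interpret C: Module.module R "C 0" by (rule module_C)
  have l: "lin_map R (F r) (C 0) \<phi>" using 0 by (simp add: homog_def)
  \<comment> \<open>Here \<open>r = d\<close>, so \<open>low\<close> applies to every basis
    vector.\<close>
  have z: "\<phi> v \<in> {\<zero>\<^bsub>C 0\<^esub>}" if "v \<in> carrier (F r)" for v
    by (rule F_submodule[OF module_C submodule_zero_set[OF module_C] l _ that])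
      (use 0 low in \<open>auto simp: homog_def\<close>)
  have "cobd r 0 (\<lambda>v. \<zero>\<^bsub>C 0\<^esub>)"
    using lin_map_zero_map[OF module_C] by (cases r) (auto simp: cobd_def)
  then show ?case using z by (intro exI[of _ "\<lambda>v. \<zero>\<^bsub>C 0\<^esub>"]) (simp add: bd_def a_minus_def)
next
  case (Suc q)
  interpret C: Module.module R "C q" by (rule module_C)
  interpret CS: Module.module R "C (Suc q)" by (rule module_C)
  have l: "lin_map R (F r) (C (Suc q)) \<phi>" using Suc.prems(2) by (simp add: homog_def)
  have im: "\<phi> (fdiff X r v) \<in> bd (Suc q)" if "v \<in> carrier (F (Suc r))" for v
    using Suc.prems(3) that by simp
  obtain \<phi>1 where \<phi>1: "homog (Suc r) q \<phi>1"
    "\<And>v. v \<in> carrier (F (Suc r)) \<Longrightarrow> \<delta> q (\<phi>1 v) = \<phi> (fdiff X r v)"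
    using homog_lift[OF Suc.prems(2) im] by blast
  \<comment> \<open>For \<open>q = 0\<close> the lift is kept as it is: the induction claim on
    \<open>C 0\<close> demands nothing of the composite with the differential.\<close>
  have "\<exists>\<phi>2. homog (Suc r) q \<phi>2 \<and> (\<forall>v\<in>carrier (F (Suc r)). \<delta> q (\<phi>2 v) = \<phi> (fdiff X r v)) \<and>
     (0 < q \<longrightarrow> (\<forall>v\<in>carrier (F (Suc (Suc r))). \<phi>2 (fdiff X (Suc r) v) \<in> bd q))"
  proof (cases "q = 0")
    case True
    then show ?thesis using \<phi>1 by blast
  next
    case False
    have cyc: "\<delta> q (\<phi>1 (fdiff X (Suc r) v)) = \<zero>\<^bsub>C (Suc q)\<^esub>" if v: "v \<in> carrier (F (Suc (Suc r)))" for v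
      using \<phi>1(2)[OF diff_closed[OF v]] diff_diff[OF v] lin_map_zero[OF module_F module_C l] by simp
    obtain \<chi> where "homog (Suc r) q \<chi>" "\<And>v. v \<in> carrier (F (Suc r)) \<Longrightarrow> \<delta> q (\<chi> v) = \<delta> q (\<phi>1 v)"
      "\<And>v. v \<in> carrier (F (Suc (Suc r))) \<Longrightarrow> \<chi> (fdiff X (Suc r) v) \<in> bd q"
      by (rule homog_correct[OF \<phi>1(1) _ _ _ cyc]) (use False Suc.prems(1) in auto)
    then show ?thesis using \<phi>1(2) by (intro exI[of _ \<chi>]) simp
  qed
  then obtain \<phi>2 where \<phi>2: "homog (Suc r) q \<phi>2"
    "\<And>v. v \<in> carrier (F (Suc r)) \<Longrightarrow> \<delta> q (\<phi>2 v) = \<phi> (fdiff X r v)"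
    "\<And>v. 0 < q \<Longrightarrow> v \<in> carrier (F (Suc (Suc r))) \<Longrightarrow> \<phi>2 (fdiff X (Suc r) v) \<in> bd q" by blast
  have l2: "lin_map R (F (Suc r)) (C q) \<phi>2" using \<phi>2(1) by (simp add: homog_def)
  obtain \<theta> where \<theta>: "cobd (Suc r) q \<theta>" "\<And>v. v \<in> carrier (F (Suc r)) \<Longrightarrow> \<phi>2 v \<ominus>\<^bsub>C q\<^esub> \<theta> v \<in> bd q"
    using Suc.IH[OF _ \<phi>2(1) \<phi>2(3)] Suc.prems(1) by auto
  then obtain \<psi> where \<psi>: "lin_map R (F r) (C q) \<psi>" and \<theta>_eq: "\<theta> = (\<lambda>v. \<psi> (fdiff X r v))"
    by (auto simp: cobd_def)
  \<comment> \<open>By induction \<open>\<phi>2\<close> agrees with \<open>\<psi> d\<close> up to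
    elements of \<open>bd q\<close>, which \<open>\<delta> q\<close> kills. So
    \<open>\<phi> d = \<delta> \<phi>2 = \<delta> \<psi> d\<close>: the map \<open>?\<Phi>\<close>
    is a cocycle of \<open>Hom(F, C (q + 1))\<close>, and it differs from \<open>\<phi>\<close> only
    by values in \<open>bd (q + 1)\<close>.\<close>
  let ?\<Phi> = "\<lambda>v. \<phi> v \<ominus>\<^bsub>C (Suc q)\<^esub> \<delta> q (\<psi> v)"
  have \<delta>\<psi>: "lin_map R (F r) (C (Suc q)) (\<lambda>v. \<delta> q (\<psi> v))" by (rule lin_map_compose[OF \<psi> \<delta>_lin])
  have \<Phi>: "lin_map R (F r) (C (Suc q)) ?\<Phi>"
    by (rule lin_map_diff[OF module_C l \<delta>\<psi>])
  have \<Phi>0: "?\<Phi> (fdiff X r v) = \<zero>\<^bsub>C (Suc q)\<^esub>" if v: "v \<in> carrier (F (Suc r))" for v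
  proof -
    have c: "\<phi>2 v \<in> carrier (C q)" "\<psi> (fdiff X r v) \<in> carrier (C q)"
      using lin_map_closed[OF l2 v] lin_map_closed[OF \<psi> diff_closed[OF v]] by auto
    have "\<phi>2 v \<ominus>\<^bsub>C q\<^esub> \<psi> (fdiff X r v) \<in> cyc q" using \<theta>(2)[OF v] bd_cyc \<theta>_eq by blast
    then have "\<delta> q (\<phi>2 v \<ominus>\<^bsub>C q\<^esub> \<psi> (fdiff X r v)) = \<zero>\<^bsub>C (Suc q)\<^esub>" by (simp add: cyc_def)
    then show ?thesis using \<phi>2(2)[OF v] c by (simp add: lin_map_minus[OF module_C module_C \<delta>_lin])
  qed
  have \<delta>bd: "\<delta> q (\<psi> v) \<in> bd (Suc q)" if "v \<in> carrier (F r)" for v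
    using lin_map_closed[OF \<psi> that] by (simp add: bd_def)
  have sub: "\<phi> v \<ominus>\<^bsub>C (Suc q)\<^esub> (\<phi> v \<ominus>\<^bsub>C (Suc q)\<^esub> \<delta> q (\<psi> v)) = \<delta> q (\<psi> v)" if v: "v \<in> carrier (F r)" for v
    using lin_map_closed[OF l v] lin_map_closed[OF \<delta>\<psi> v]
    by (simp add: a_minus_def CS.minus_add CS.a_assoc[symmetric] CS.r_neg)
  \<comment> \<open>Exactness makes \<open>?\<Phi>\<close> zero for \<open>r = 0\<close> and a
    coboundary otherwise, which are the two cases of \<open>cobd\<close>.\<close>
  show ?case
  proof (cases r)
    case 0
    have "?\<Phi> v = \<zero>\<^bsub>C (Suc q)\<^esub>" if "v \<in> carrier (F 0)" for v
      using acyclic_C[of q] \<Phi> \<Phi>0 that unfolding hom_acyclic_def 0 by blast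
    then have "\<phi> v \<ominus>\<^bsub>C (Suc q)\<^esub> \<zero>\<^bsub>C (Suc q)\<^esub> \<in> bd (Suc q)" if "v \<in> carrier (F 0)" for v
      using sub[of v] \<delta>bd[of v] that 0 by simp
    then show ?thesis using 0 by (intro exI[of _ "\<lambda>v. \<zero>\<^bsub>C (Suc q)\<^esub>"]) (simp add: cobd_def)
  next
    case (Suc r')
    obtain \<psi>' where \<psi>': "lin_map R (F r') (C (Suc q)) \<psi>'" "\<forall>v\<in>carrier (F r). ?\<Phi> v = \<psi>' (fdiff X r' v)"
      using acyclic_C[of q] \<Phi> \<Phi>0 unfolding hom_acyclic_def Suc by blast
    have "\<phi> v \<ominus>\<^bsub>C (Suc q)\<^esub> \<psi>' (fdiff X r' v) \<in> bd (Suc q)" if "v \<in> carrier (F r)" for v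
      using sub[of v] \<delta>bd[of v] that \<psi>'(2) by simp
    then show ?thesis using \<psi>'(1) Suc
      by (intro exI[of _ "\<lambda>v. \<psi>' (fdiff X r' v)"]) (auto simp: cobd_def)
  qed
qed

end

locale socle_chase = chase R \<pi> "quotient_module R J" X C \<delta> \<rho> a d
  for R :: "'a graded_ring" (structure) and \<pi> and J :: "'a set" and X
    and C :: "nat \<Rightarrow> ('a, 'c) graded_module" and \<delta> \<rho> a d +
  assumes J: "submodule J R (regular_module R)"

text \<open>The resolution is arbitrary, so \<open>F 0\<close> need not be the ring itself; a lift
  \<open>\<alpha>\<close> of the augmentation to the ring takes the place of the identity. The map
  \<open>\<alpha> z\<close> sends boundaries into \<open>J z\<close>, hence into
  \<open>bd d\<close>, and the zigzag with \<open>r = 0\<close> shows that all its values lie in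
  \<open>bd d\<close>.\<close>

lemma (in socle_chase) socle_cocycle_bd:
  assumes z: "z \<in> cyc d" "z \<in> component (C d) a" and soc: "\<And>r. r \<in> J \<Longrightarrow> r \<odot>\<^bsub>C d\<^esub> z \<in> bd d"
  shows "z \<in> bd d"
proof -
  interpret C: Module.module R "C d" by (rule module_C)
  let ?K = "quotient_module R J"
  let ?R = "regular_module R" and ?q = "\<lambda>r. J +>\<^bsub>regular_module R\<^esub> r"
  have zc: "z \<in> carrier (C d)" using z by (simp add: cyc_def)
  have Jc: "J \<subseteq> carrier R" using Module.module.submoduleE(1)[OF module_regular J] by simp
  have q: "lin_map R ?R ?K ?q"
    using subquotient_module(2)[OF module_regular Module.module.carrier_is_submodule[OF module_regular] J]
    by (simp add: regular_module_def)
  have zK: "\<zero>\<^bsub>?K\<^esub> = J" unfolding subquotient_def by simp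
  have "\<exists>y\<in>part R (fshift X 0 l). y \<in> carrier ?R \<and> ?q y = faug X (e 0 l)" for l
    using aug_deg[OF e_component, of l] part_carr by (auto simp: subquotient_def)
  then obtain \<alpha> where \<alpha>: "lin_map R (F 0) ?R \<alpha>" "\<And>v. v \<in> carrier (F 0) \<Longrightarrow> ?q (\<alpha> v) = faug X v"
    "\<And>l. l < frank X 0 \<Longrightarrow> \<alpha> (e 0 l) \<in> part R (fshift X 0 l)"
    by (rule F_lift[OF module_regular module_K q aug_lin, of "\<lambda>l. part R (fshift X 0 l)"]) blast+
  have \<alpha>c: "\<alpha> v \<in> carrier R" if "v \<in> carrier (F 0)" for v using lin_map_closed[OF \<alpha>(1) that] by simp
  let ?\<phi> = "\<lambda>v. \<alpha> v \<odot>\<^bsub>C d\<^esub> z"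
  have "lin_map R (F 0) (C d) ?\<phi>"
    using \<alpha>c zc lin_map_add[OF \<alpha>(1)] lin_map_smult[OF \<alpha>(1)]
    by (intro lin_mapI) (auto simp: C.smult_l_distr C.smult_assoc1)
  moreover have "?\<phi> (e 0 l) \<in> component (C d) (fshift X 0 l + a)" if "l < frank X 0" for l
    using gmod.comp_smult[OF gmod_C \<alpha>(3)[OF that] z(2)] by (simp add: add.commute)
  ultimately have hom: "homog 0 d ?\<phi>" by (simp add: homog_def)
  have "?\<phi> (fdiff X 0 v) \<in> bd d" if v: "v \<in> carrier (F (Suc 0))" for v
  proof (rule soc)
    have "?q (\<alpha> (fdiff X 0 v)) = J" using \<alpha>(2)[OF diff_closed[OF v]] aug_diff[OF v] zK by simp
    then show "\<alpha> (fdiff X 0 v) \<in> J"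
      using coset_eq_self_iff[OF module_regular J] \<alpha>c[OF diff_closed[OF v]] by simp
  qed
  then have bd: "?\<phi> v \<in> bd d" if "v \<in> carrier (F 0)" for v
    using zigzag[of 0 d, OF _ hom] that zc \<alpha>c[OF that] by (auto simp: cobd_def module_minus_zero[OF module_C])
  have "?q \<one> \<in> carrier ?K" using lin_map_closed[OF q] by simp
  then have "?q \<one> \<in> faug X ` carrier (F 0)" by (simp only: aug_surj)
  then obtain v where v: "?q \<one> = faug X v" "v \<in> carrier (F 0)" by (rule imageE)
  \<comment> \<open>Some value \<open>\<alpha> v\<close> is congruent to 1 modulo \<open>J\<close>.
    So \<open>z\<close> is the sum of \<open>\<alpha> v\<close> times \<open>z\<close> and of a
    multiple of \<open>z\<close> that lies in \<open>bd d\<close> by the socle condition.\<close>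
  have "\<one> \<ominus>\<^bsub>?R\<^esub> \<alpha> v \<in> J"
    using \<alpha>(2)[OF v(2)] v(1) \<alpha>c[OF v(2)]
      coset_eq_iff[OF module_regular J, of \<one> "\<alpha> v"] by simp
  moreover have "\<one> \<ominus>\<^bsub>?R\<^esub> \<alpha> v = \<one> \<ominus> \<alpha> v"
    by (simp add: a_minus_def a_inv_def m_inv_def regular_module_def)
  ultimately have "(\<one> \<ominus> \<alpha> v) \<odot>\<^bsub>C d\<^esub> z \<in> bd d" using soc by simp
  then have "(\<one> \<ominus> \<alpha> v) \<odot>\<^bsub>C d\<^esub> z \<oplus>\<^bsub>C d\<^esub> \<alpha> v \<odot>\<^bsub>C d\<^esub> z \<in> bd d"
    using bd[OF v(2)] C.submoduleE(5)[OF submodule_bd] by blast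
  moreover have "(\<one> \<ominus> \<alpha> v) \<odot>\<^bsub>C d\<^esub> z \<oplus>\<^bsub>C d\<^esub> \<alpha> v \<odot>\<^bsub>C d\<^esub> z = z"
    using \<alpha>c[OF v(2)] zc
    by (simp add: C.smult_l_distr[symmetric] a_minus_def a_assoc l_neg)
  ultimately show ?thesis by simp
qed

section \<open>Localizations\<close>

lemma lin_map_finsum_map:
  assumes "Module.module R N" "finite A" "\<And>i. i \<in> A \<Longrightarrow> lin_map R M N (f i)"
  shows "lin_map R M N (\<lambda>v. \<Oplus>\<^bsub>N\<^esub>i\<in>A. f i v)"
proof -
  interpret N: Module.module R N by fact
  show ?thesis
  proof (rule lin_mapI)
    fix v assume v: "v \<in> carrier M"
    then show "(\<Oplus>\<^bsub>N\<^esub>i\<in>A. f i v) \<in> carrier N"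
      by (intro N.finsum_closed Pi_I lin_map_closed[OF assms(3)])
    fix w assume w: "w \<in> carrier M"
    have "(\<Oplus>\<^bsub>N\<^esub>i\<in>A. f i (v \<oplus>\<^bsub>M\<^esub> w)) = (\<Oplus>\<^bsub>N\<^esub>i\<in>A. f i v \<oplus>\<^bsub>N\<^esub> f i w)"
      by (rule N.finsum_cong')
        (use v w lin_map_add[OF assms(3)] lin_map_closed[OF assms(3)] in auto)
    then show "(\<Oplus>\<^bsub>N\<^esub>i\<in>A. f i (v \<oplus>\<^bsub>M\<^esub> w)) = (\<Oplus>\<^bsub>N\<^esub>i\<in>A. f i v) \<oplus>\<^bsub>N\<^esub> (\<Oplus>\<^bsub>N\<^esub>i\<in>A. f i w)"
      using v w lin_map_closed[OF assms(3)] by (simp add: N.finsum_addf Pi_iff)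
  next
    fix r v assume rv: "r \<in> carrier R" "v \<in> carrier M"
    have "(\<Oplus>\<^bsub>N\<^esub>i\<in>A. f i (r \<odot>\<^bsub>M\<^esub> v)) = (\<Oplus>\<^bsub>N\<^esub>i\<in>A. r \<odot>\<^bsub>N\<^esub> f i v)"
      by (rule N.finsum_cong')
        (use rv lin_map_smult[OF assms(3)] lin_map_closed[OF assms(3)] in auto)
    then show "(\<Oplus>\<^bsub>N\<^esub>i\<in>A. f i (r \<odot>\<^bsub>M\<^esub> v)) = r \<odot>\<^bsub>N\<^esub> (\<Oplus>\<^bsub>N\<^esub>i\<in>A. f i v)"
      using rv lin_map_closed[OF assms(3)] assms(2) by (simp add: N.finsum_smult_ldistr Pi_iff)
  qed
qed

lemma lin_map_neg:
  assumes "Module.module R N" "lin_map R M N f"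
  shows "lin_map R M N (\<lambda>v. \<ominus>\<^bsub>N\<^esub> f v)"
proof -
  interpret N: Module.module R N by fact
  show ?thesis
    by (rule lin_mapI)
      (auto simp: lin_map_closed[OF assms(2)] lin_map_add[OF assms(2)] lin_map_smult[OF assms(2)]
        N.minus_add N.smult_r_minus)
qed

lemma (in gmod) gproj_finsum:
  "finite A \<Longrightarrow> g \<in> A \<rightarrow> carrier M \<Longrightarrow> \<rho> i (\<Oplus>\<^bsub>M\<^esub>l\<in>A. g l) = (\<Oplus>\<^bsub>M\<^esub>l\<in>A. \<rho> i (g l))"
proof (induction A rule: finite_induct)
  case empty
  then show ?case using gproj_zero by simp
next
  case (insert x F)
  then show ?case by (simp add: Pi_iff gproj_add)
qed

lemma gmod_pointwise:
  fixes P :: "('a, 'i \<Rightarrow> 'b) graded_module" and N :: "'i \<Rightarrow> ('a, 'b) graded_module"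
  assumes "gring R \<pi>" and gm: "\<And>i. i \<in> J \<Longrightarrow> gmod R (N i) (\<rho> i)"
    and car: "carrier P = (\<Pi>\<^sub>E i\<in>J. carrier (N i))"
    and zero: "\<zero>\<^bsub>P\<^esub> = (\<lambda>i\<in>J. \<zero>\<^bsub>N i\<^esub>)"
    and add: "\<And>v w. v \<oplus>\<^bsub>P\<^esub> w = (\<lambda>i\<in>J. v i \<oplus>\<^bsub>N i\<^esub> w i)"
    and smult: "\<And>r v. r \<odot>\<^bsub>P\<^esub> v = (\<lambda>i\<in>J. r \<odot>\<^bsub>N i\<^esub> v i)"
    and comp: "\<And>c. component P c = (\<Pi>\<^sub>E i\<in>J. component (N i) c)"
  shows "gmod R P (\<lambda>c v. \<lambda>i\<in>J. \<rho> i c (v i))"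
proof -
  interpret gring R \<pi> by fact
  show ?thesis
  proof (intro gmod.intro gmod_axioms.intro)
    show "Module.module R P"
      by (rule module_pointwise[where N = N and J = J])
        (auto simp: car zero add smult is_cring gmod.module_M[OF gm])
    show "part R i \<subseteq> carrier R" for i by (rule part_sub)
    show "component P c \<subseteq> carrier P" for c
      unfolding car comp using gmod.comp_sub[OF gm] by (intro PiE_mono) auto
    show "(\<lambda>i\<in>J. \<rho> i c (v i)) \<in> component P c" if "v \<in> carrier P" for v c
      using that gmod.gproj_in[OF gm] by (auto simp: car comp)
    show "(\<lambda>i\<in>J. \<rho> i c (v i)) = v" if "v \<in> component P c" for v c
      using that gmod.gproj_id[OF gm] by (intro extensionalityI[of _ J]) (auto simp: comp PiE_iff)
    show "(\<lambda>i\<in>J. \<rho> i c ((v \<oplus>\<^bsub>P\<^esub> w) i)) = (\<lambda>i\<in>J. \<rho> i c (v i)) \<oplus>\<^bsub>P\<^esub> (\<lambda>i\<in>J. \<rho> i c (w i))"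
      if "v \<in> carrier P" "w \<in> carrier P" for v w c
      using that gmod.gproj_add[OF gm] by (auto simp: car add PiE_iff intro!: restrict_ext)
    show "(\<lambda>i\<in>J. \<rho> i (c + e) ((r \<odot>\<^bsub>P\<^esub> v) i)) = r \<odot>\<^bsub>P\<^esub> (\<lambda>i\<in>J. \<rho> i c (v i))"
      if "r \<in> part R e" "v \<in> carrier P" for r e v c
      using that gmod.gproj_smult[OF gm] by (auto simp: car smult PiE_iff intro!: restrict_ext)
  qed
qed

locale loc_module = Module.module R M
  for R :: "'a graded_ring" (structure) and M :: "('a, 'b) graded_module" (structure) +
  fixes f :: 'a
  assumes f: "f \<in> carrier R"
begin

abbreviation frac where "frac \<equiv> fraction R M f"

lemma pow_smult [simp]: "m \<in> carrier M \<Longrightarrow> (f [^] (k::nat)) \<odot>\<^bsub>M\<^esub> ((f [^] (l::nat)) \<odot>\<^bsub>M\<^esub> m) = (f [^] (k + l)) \<odot>\<^bsub>M\<^esub> m"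
  using f by (simp add: smult_assoc1[symmetric] R.nat_pow_mult)

lemma pow_smult_closed [simp]: "m \<in> carrier M \<Longrightarrow> (f [^] (k::nat)) \<odot>\<^bsub>M\<^esub> m \<in> carrier M"
  using f by simp

lemma pow_comm: "m \<in> carrier M \<Longrightarrow> r \<in> carrier R \<Longrightarrow> (f [^] (k::nat)) \<odot>\<^bsub>M\<^esub> (r \<odot>\<^bsub>M\<^esub> m) = r \<odot>\<^bsub>M\<^esub> ((f [^] k) \<odot>\<^bsub>M\<^esub> m)"
  using f by (simp add: smult_assoc1[symmetric] R.m_comm)

lemma frac_memI: "m \<in> carrier M \<Longrightarrow> (m, s) \<in> frac m s"
  by (auto simp: fraction_def)

lemma frac_eqI:
  assumes m: "m \<in> carrier M" "m' \<in> carrier M" and u: "(f [^] (u + s')) \<odot>\<^bsub>M\<^esub> m = (f [^] (u + s)) \<odot>\<^bsub>M\<^esub> m'"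
  shows "frac m s = frac m' s'"
proof -
  have sub: "frac m s \<subseteq> frac m' s'"
    if m: "m \<in> carrier M" "m' \<in> carrier M" and u: "(f [^] (u + s')) \<odot>\<^bsub>M\<^esub> m = (f [^] (u + s)) \<odot>\<^bsub>M\<^esub> m'"
    for m m' s s' u
  proof
    fix p assume "p \<in> frac m s"
    then obtain n t v where p: "p = (n, t)" "n \<in> carrier M"
      and v: "(f [^] (v + t)) \<odot>\<^bsub>M\<^esub> m = (f [^] (v + s)) \<odot>\<^bsub>M\<^esub> n"
      by (auto simp: fraction_def)
    have "(f [^] (v + t)) \<odot>\<^bsub>M\<^esub> ((f [^] (u + s)) \<odot>\<^bsub>M\<^esub> m') = (f [^] (v + t)) \<odot>\<^bsub>M\<^esub> ((f [^] (u + s')) \<odot>\<^bsub>M\<^esub> m)"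
      by (simp only: u)
    also have "\<dots> = (f [^] (u + s')) \<odot>\<^bsub>M\<^esub> ((f [^] (v + t)) \<odot>\<^bsub>M\<^esub> m)"
      using m by (simp add: add_ac)
    also have "\<dots> = (f [^] (u + s')) \<odot>\<^bsub>M\<^esub> ((f [^] (v + s)) \<odot>\<^bsub>M\<^esub> n)"
      by (simp only: v)
    \<comment> \<open>Transitivity of the relation behind fractions, with witness
      \<open>u + v + s\<close>.\<close>
    finally have "(f [^] ((u + v + s) + t)) \<odot>\<^bsub>M\<^esub> m' = (f [^] ((u + v + s) + s')) \<odot>\<^bsub>M\<^esub> n"
      using m p by (simp add: add_ac)
    then show "p \<in> frac m' s'" using p by (auto simp: fraction_def)
  qed
  show ?thesis by (rule equalityI[OF sub[OF m u] sub[OF m(2,1) u[symmetric]]])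
qed

lemma frac_eqD:
  assumes "m \<in> carrier M" "m' \<in> carrier M" "frac m s = frac m' s'"
  obtains u :: nat where "(f [^] (u + s')) \<odot>\<^bsub>M\<^esub> m = (f [^] (u + s)) \<odot>\<^bsub>M\<^esub> m'"
proof -
  have "(m', s') \<in> frac m s" using frac_memI[OF assms(2), of s'] by (simp only: assms(3))
  then show ?thesis using that by (auto simp: fraction_def)
qed

lemma frac_mem: "(m', s') \<in> frac m s \<Longrightarrow> m \<in> carrier M \<Longrightarrow> m' \<in> carrier M \<and> frac m' s' = frac m s"
proof -
  assume *: "(m', s') \<in> frac m s" "m \<in> carrier M"
  then obtain u where "m' \<in> carrier M" "(f [^] (u + s')) \<odot>\<^bsub>M\<^esub> m = (f [^] (u + s)) \<odot>\<^bsub>M\<^esub> m'"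
    by (auto simp: fraction_def)
  then show "m' \<in> carrier M \<and> frac m' s' = frac m s" using frac_eqI[of m m' u s' s] *(2) by simp
qed

lemma frac_expand: "m \<in> carrier M \<Longrightarrow> frac m s = frac ((f [^] t) \<odot>\<^bsub>M\<^esub> m) (s + t)"
  by (rule frac_eqI[of _ _ 0]) (auto)

text \<open>Operations on fractions are written as unions over all representatives; such a union
  collapses once its terms do not depend on the representative.\<close>

lemma frac_cong_map:
  assumes m: "m \<in> carrier M"
    and h: "\<And>m' s' u. m' \<in> carrier M \<Longrightarrow> (f [^] (u + s')) \<odot>\<^bsub>M\<^esub> m = (f [^] (u + s)) \<odot>\<^bsub>M\<^esub> m' \<Longrightarrow> h m' s' = h m s"
  shows "(\<Union>(m', s')\<in>frac m s. h m' s') = h m s"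
proof -
  have "h m' s' = h m s" if "(m', s') \<in> frac m s" for m' s'
    using that h by (auto simp: fraction_def)
  then have "(\<Union>(m', s')\<in>frac m s. h m' s') = (\<Union>p\<in>frac m s. h m s)"
    by (intro SUP_cong) auto
  then show ?thesis using frac_memI[OF m] by (metis SUP_const empty_iff)
qed

abbreviation L where "L \<equiv> localization R M f"

lemma L_simps:
  "carrier (L k) = {frac m s | m s. m \<in> carrier M}" "\<zero>\<^bsub>L k\<^esub> = frac \<zero>\<^bsub>M\<^esub> 0"
  "component (L k) c = {frac m s | m s. m \<in> component M (c + int s * k)}"
  by (auto simp: localization_def)

lemma frac_carrier [simp]: "m \<in> carrier M \<Longrightarrow> frac m s \<in> carrier (L k)"
  by (auto simp: L_simps)

text \<open>Independence of the representative is checked in the first argument and transferred to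
  the second by the symmetry of the formula.\<close>

lemma L_add:
  assumes m: "m \<in> carrier M" "m' \<in> carrier M"
  shows "frac m s \<oplus>\<^bsub>L k\<^esub> frac m' s'
    = frac ((f [^] s') \<odot>\<^bsub>M\<^esub> m \<oplus>\<^bsub>M\<^esub> (f [^] s) \<odot>\<^bsub>M\<^esub> m') (s + s')"
proof -
  let ?g = "\<lambda>m s m' s'. frac ((f [^] s') \<odot>\<^bsub>M\<^esub> m \<oplus>\<^bsub>M\<^esub> (f [^] s) \<odot>\<^bsub>M\<^esub> m') (s + s')"
  have cong: "?g m1 s1 m' s' = ?g m s m' s'"
    if "m \<in> carrier M" "m' \<in> carrier M" "m1 \<in> carrier M"
      and u: "(f [^] (u + s1)) \<odot>\<^bsub>M\<^esub> m = (f [^] (u + s)) \<odot>\<^bsub>M\<^esub> m1" for m1 s1 m s m' s' u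
  proof (rule frac_eqI[of _ _ u])
    have "(f [^] (s' + s')) \<odot>\<^bsub>M\<^esub> ((f [^] (u + s)) \<odot>\<^bsub>M\<^esub> m1) = (f [^] (s' + s')) \<odot>\<^bsub>M\<^esub> ((f [^] (u + s1)) \<odot>\<^bsub>M\<^esub> m)"
      by (simp only: u)
    then show "(f [^] (u + (s + s'))) \<odot>\<^bsub>M\<^esub> ((f [^] s') \<odot>\<^bsub>M\<^esub> m1 \<oplus>\<^bsub>M\<^esub> (f [^] s1) \<odot>\<^bsub>M\<^esub> m') =
       (f [^] (u + (s1 + s'))) \<odot>\<^bsub>M\<^esub> ((f [^] s') \<odot>\<^bsub>M\<^esub> m \<oplus>\<^bsub>M\<^esub> (f [^] s) \<odot>\<^bsub>M\<^esub> m')"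
      using that f by (simp add: smult_r_distr add_ac)
  qed (use that in auto)
  have sym: "?g m s m' s' = ?g m' s' m s" if "m \<in> carrier M" "m' \<in> carrier M" for m s m' s'
    using that M.a_comm by (simp add: add.commute)
  have inner: "(\<Union>(m2, s2)\<in>frac m' s'. ?g m1 s1 m2 s2) = ?g m1 s1 m' s'" if m1: "m1 \<in> carrier M" for m1 s1
  proof (rule frac_cong_map[OF m(2)])
    fix m2 s2 u assume *: "m2 \<in> carrier M" "(f [^] (u + s2)) \<odot>\<^bsub>M\<^esub> m' = (f [^] (u + s')) \<odot>\<^bsub>M\<^esub> m2"
    show "?g m1 s1 m2 s2 = ?g m1 s1 m' s'"
      by (rule trans[OF sym[OF m1 *(1)] trans[OF cong[OF m(2) m1 *] sym[OF m(2) m1]]])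
  qed
  have "frac m s \<oplus>\<^bsub>L k\<^esub> frac m' s' = (\<Union>(m1, s1)\<in>frac m s. \<Union>(m2, s2)\<in>frac m' s'. ?g m1 s1 m2 s2)"
    by (simp add: localization_def)
  also have "\<dots> = (\<Union>(m1, s1)\<in>frac m s. ?g m1 s1 m' s')"
  proof (rule SUP_cong[OF refl])
    fix p assume p: "p \<in> frac m s"
    obtain m1 s1 where p1: "p = (m1, s1)" by fastforce
    then have "m1 \<in> carrier M" using frac_mem[of m1 s1 m s] p m(1) by simp
    then show "(case p of (m1, s1) \<Rightarrow> \<Union>(m2, s2)\<in>frac m' s'. ?g m1 s1 m2 s2)
        = (case p of (m1, s1) \<Rightarrow> ?g m1 s1 m' s')"
      unfolding p1 prod.case by (rule inner)
  qed
  also have "\<dots> = ?g m s m' s'"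
    by (rule frac_cong_map[OF m(1)]) (use cong m in blast)
  finally show ?thesis .
qed

lemma L_add_common:
  assumes "m \<in> carrier M" "m' \<in> carrier M"
  shows "frac m s \<oplus>\<^bsub>L k\<^esub> frac m' s = frac (m \<oplus>\<^bsub>M\<^esub> m') s"
  using assms f frac_expand[of "m \<oplus>\<^bsub>M\<^esub> m'" s s] by (simp add: L_add smult_r_distr)

lemma L_smult:
  assumes m: "m \<in> carrier M" and r: "r \<in> carrier R"
  shows "r \<odot>\<^bsub>L k\<^esub> frac m s = frac (r \<odot>\<^bsub>M\<^esub> m) s"
proof -
  have "(\<Union>(m', s')\<in>frac m s. frac (r \<odot>\<^bsub>M\<^esub> m') s') = frac (r \<odot>\<^bsub>M\<^esub> m) s"
  proof (rule frac_cong_map[OF m])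
    fix m' s' u assume *: "m' \<in> carrier M" "(f [^] (u + s')) \<odot>\<^bsub>M\<^esub> m = (f [^] (u + s)) \<odot>\<^bsub>M\<^esub> m'"
    show "frac (r \<odot>\<^bsub>M\<^esub> m') s' = frac (r \<odot>\<^bsub>M\<^esub> m) s"
      by (rule frac_eqI[of _ _ u]) (use * m r in \<open>simp_all add: pow_comm\<close>)
  qed
  then show ?thesis by (simp add: localization_def)
qed

lemma frac_zero: "frac \<zero>\<^bsub>M\<^esub> s = \<zero>\<^bsub>L k\<^esub>"
  unfolding L_simps by (rule frac_eqI[of _ _ 0]) (use f in auto)

lemma L_cases:
  assumes "X \<in> carrier (L k)"
  obtains m s where "m \<in> carrier M" "X = frac m s"
  using assms by (auto simp: L_simps)

text \<open>Over a common denominator addition is addition of numerators, which reduces the axioms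
  in \<open>module_L\<close> to those of \<open>M\<close>.\<close>

lemma L_common2:
  assumes "X \<in> carrier (L k)" "Y \<in> carrier (L k)"
  obtains m m' s where "m \<in> carrier M" "m' \<in> carrier M" "X = frac m s" "Y = frac m' s"
proof -
  obtain m s m' s' where *: "m \<in> carrier M" "X = frac m s" "m' \<in> carrier M" "Y = frac m' s'"
    using assms by (metis L_cases)
  show ?thesis
    by (rule that[of "(f [^] s') \<odot>\<^bsub>M\<^esub> m" "(f [^] s) \<odot>\<^bsub>M\<^esub> m'" "s + s'"])
      (use * frac_expand[of m s s'] frac_expand[of m' s' s] in \<open>auto simp: add.commute\<close>)
qed

lemma L_common3:
  assumes "X \<in> carrier (L k)" "Y \<in> carrier (L k)" "Z \<in> carrier (L k)"
  obtains m m' m'' s where "m \<in> carrier M" "m' \<in> carrier M" "m'' \<in> carrier M"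
    "X = frac m s" "Y = frac m' s" "Z = frac m'' s"
proof -
  obtain m m' s m'' s' where *: "m \<in> carrier M" "X = frac m s" "m' \<in> carrier M" "Y = frac m' s"
    "m'' \<in> carrier M" "Z = frac m'' s'"
    using assms by (metis L_cases L_common2)
  show ?thesis
    by (rule that[of "(f [^] s') \<odot>\<^bsub>M\<^esub> m" "(f [^] s') \<odot>\<^bsub>M\<^esub> m'" "(f [^] s) \<odot>\<^bsub>M\<^esub> m''" "s + s'"])
      (use * frac_expand[of m s s'] frac_expand[of m' s s'] frac_expand[of m'' s' s] in \<open>auto simp: add.commute\<close>)
qed

lemma module_L: "Module.module R (L k)"
proof -
  have "abelian_group (L k)"
  proof (rule abelian_groupI)
    show "\<zero>\<^bsub>L k\<^esub> \<in> carrier (L k)" using frac_zero[symmetric, of k 0] by simp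
    fix X assume X: "X \<in> carrier (L k)"
    then obtain m s where m: "m \<in> carrier M" "X = frac m s" by (rule L_cases)
    show "\<zero>\<^bsub>L k\<^esub> \<oplus>\<^bsub>L k\<^esub> X = X"
      unfolding frac_zero[symmetric, of k s] using m by (simp add: L_add_common)
    have "frac (\<ominus>\<^bsub>M\<^esub> m) s \<oplus>\<^bsub>L k\<^esub> X = \<zero>\<^bsub>L k\<^esub>"
      unfolding frac_zero[symmetric, of k s] using m by (simp add: L_add_common M.l_neg)
    then show "\<exists>Y\<in>carrier (L k). Y \<oplus>\<^bsub>L k\<^esub> X = \<zero>\<^bsub>L k\<^esub>" using m by (metis frac_carrier M.a_inv_closed)
    fix Y assume Y: "Y \<in> carrier (L k)"
    obtain m1 m2 t where 2: "m1 \<in> carrier M" "m2 \<in> carrier M" "X = frac m1 t" "Y = frac m2 t"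
      using X Y by (rule L_common2)
    show "X \<oplus>\<^bsub>L k\<^esub> Y \<in> carrier (L k)" "X \<oplus>\<^bsub>L k\<^esub> Y = Y \<oplus>\<^bsub>L k\<^esub> X"
      using 2 by (simp_all add: L_add_common M.a_comm)
    fix Z assume Z: "Z \<in> carrier (L k)"
    obtain m1 m2 m3 t where 3: "m1 \<in> carrier M" "m2 \<in> carrier M" "m3 \<in> carrier M"
      "X = frac m1 t" "Y = frac m2 t" "Z = frac m3 t"
      using X Y Z by (rule L_common3)
    show "X \<oplus>\<^bsub>L k\<^esub> Y \<oplus>\<^bsub>L k\<^esub> Z = X \<oplus>\<^bsub>L k\<^esub> (Y \<oplus>\<^bsub>L k\<^esub> Z)"
      using 3 by (simp add: L_add_common M.a_assoc)
  qed
  then show ?thesis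
  proof (rule moduleI[OF is_cring])
    fix a b X Y assume ab: "a \<in> carrier R" "b \<in> carrier R"
      and X: "X \<in> carrier (L k)" and Y: "Y \<in> carrier (L k)"
    obtain m1 m2 t where 2: "m1 \<in> carrier M" "m2 \<in> carrier M" "X = frac m1 t" "Y = frac m2 t"
      using X Y by (rule L_common2)
    show "(a \<oplus> b) \<odot>\<^bsub>L k\<^esub> X = a \<odot>\<^bsub>L k\<^esub> X \<oplus>\<^bsub>L k\<^esub> b \<odot>\<^bsub>L k\<^esub> X"
      "a \<odot>\<^bsub>L k\<^esub> (X \<oplus>\<^bsub>L k\<^esub> Y) = a \<odot>\<^bsub>L k\<^esub> X \<oplus>\<^bsub>L k\<^esub> a \<odot>\<^bsub>L k\<^esub> Y"
      "a \<otimes> b \<odot>\<^bsub>L k\<^esub> X = a \<odot>\<^bsub>L k\<^esub> (b \<odot>\<^bsub>L k\<^esub> X)"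
      using 2 ab by (simp_all add: L_add_common L_smult smult_l_distr smult_r_distr smult_assoc1)
  next
    fix a X assume a: "a \<in> carrier R" and "X \<in> carrier (L k)"
    then obtain m s where m: "m \<in> carrier M" "X = frac m s" by (metis L_cases)
    then show "a \<odot>\<^bsub>L k\<^esub> X \<in> carrier (L k)" using a by (simp add: L_smult)
  next
    fix X assume "X \<in> carrier (L k)"
    then obtain m s where m: "m \<in> carrier M" "X = frac m s" by (rule L_cases)
    then show "\<one> \<odot>\<^bsub>L k\<^esub> X = X" by (simp add: L_smult)
  qed
qed

text \<open>As \<open>x\<close> divides \<open>f\<close>, it becomes invertible with inverse
  \<open>g/f\<close>. For injectivity, multiplying by \<open>g\<close> turns \<open>x\<close> into
  one more power of \<open>f\<close>, whence the exponent \<open>u + 1\<close>.\<close>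

lemma smult_bij_L:
  assumes x: "x \<in> carrier R" "g \<in> carrier R" "f = x \<otimes> g"
  shows "bij_betw (\<lambda>X. x \<odot>\<^bsub>L k\<^esub> X) (carrier (L k)) (carrier (L k))"
proof (rule bij_betwI')
  fix X Y assume XY: "X \<in> carrier (L k)" "Y \<in> carrier (L k)"
  obtain m1 m2 t where 2: "m1 \<in> carrier M" "m2 \<in> carrier M" "X = frac m1 t" "Y = frac m2 t"
    using XY by (rule L_common2)
  have fx: "f [^] (1::nat) = g \<otimes> x" using x f by (simp add: R.m_comm)
  show "x \<odot>\<^bsub>L k\<^esub> X = x \<odot>\<^bsub>L k\<^esub> Y \<longleftrightarrow> X = Y"
  proof
    assume "x \<odot>\<^bsub>L k\<^esub> X = x \<odot>\<^bsub>L k\<^esub> Y"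
    then have "frac (x \<odot>\<^bsub>M\<^esub> m1) t = frac (x \<odot>\<^bsub>M\<^esub> m2) t" using 2 x(1) by (simp add: L_smult)
    then obtain u where u: "(f [^] (u + t)) \<odot>\<^bsub>M\<^esub> (x \<odot>\<^bsub>M\<^esub> m1) = (f [^] (u + t)) \<odot>\<^bsub>M\<^esub> (x \<odot>\<^bsub>M\<^esub> m2)"
      using frac_eqD[of "x \<odot>\<^bsub>M\<^esub> m1" "x \<odot>\<^bsub>M\<^esub> m2" t t] 2 x by auto
    have *: "g \<odot>\<^bsub>M\<^esub> ((f [^] (u + t)) \<odot>\<^bsub>M\<^esub> (x \<odot>\<^bsub>M\<^esub> m)) = (f [^] (u + 1 + t)) \<odot>\<^bsub>M\<^esub> m" if "m \<in> carrier M" for m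
    proof -
      have "g \<odot>\<^bsub>M\<^esub> ((f [^] (u + t)) \<odot>\<^bsub>M\<^esub> (x \<odot>\<^bsub>M\<^esub> m)) = (f [^] (u + t)) \<odot>\<^bsub>M\<^esub> ((f [^] (1::nat)) \<odot>\<^bsub>M\<^esub> m)"
        unfolding fx using that x(1,2) by (simp add: pow_comm smult_assoc1)
      also have "\<dots> = (f [^] (u + t + 1)) \<odot>\<^bsub>M\<^esub> m" by (rule pow_smult[OF that])
      also have "u + t + 1 = u + 1 + t" by simp
      finally show ?thesis .
    qed
    show "X = Y" unfolding 2 by (rule frac_eqI[of _ _ "u + 1"]) (use 2 *[of m1] *[of m2] u in auto)
  qed simp
next
  fix X assume "X \<in> carrier (L k)"
  then obtain m s where m: "m \<in> carrier M" "X = frac m s" by (rule L_cases)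
  then show "x \<odot>\<^bsub>L k\<^esub> X \<in> carrier (L k)" using x(1) by (simp add: L_smult)
next
  fix X assume "X \<in> carrier (L k)"
  then obtain m s where m: "m \<in> carrier M" "X = frac m s" by (rule L_cases)
  have "f \<odot>\<^bsub>M\<^esub> m = x \<odot>\<^bsub>M\<^esub> (g \<odot>\<^bsub>M\<^esub> m)" using m x by (simp add: smult_assoc1)
  then have "X = x \<odot>\<^bsub>L k\<^esub> frac (g \<odot>\<^bsub>M\<^esub> m) (s + 1)"
    using m x(1,2) frac_expand[OF m(1), of s 1] f by (simp add: L_smult)
  moreover have "frac (g \<odot>\<^bsub>M\<^esub> m) (s + 1) \<in> carrier (L k)" using m(1) x(2) by simp
  ultimately show "\<exists>Y\<in>carrier (L k). X = x \<odot>\<^bsub>L k\<^esub> Y" by blast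
qed

end

text \<open>A denominator \<open>f^s\<close> has degree \<open>s * k\<close>, hence the shift for
  the numerator. The union over representatives avoids a choice; \<open>loc_proj_frac\<close>
  evaluates it.\<close>

definition loc_proj ::
  "'a graded_ring \<Rightarrow> ('a, 'b) graded_module \<Rightarrow> (int \<Rightarrow> 'b \<Rightarrow> 'b) \<Rightarrow> 'a \<Rightarrow> int \<Rightarrow> int \<Rightarrow> ('b \<times> nat) set \<Rightarrow> ('b \<times> nat) set" where
  "loc_proj R M \<rho> f k c Y = (\<Union>(m, s)\<in>Y. fraction R M f (\<rho> (c + int s * k) m) s)"

locale gloc = R?: gring R \<pi> + gmod R M \<rho> + loc_module R M f
  for R :: "'a graded_ring" (structure) and \<pi> and M :: "('a, 'b) graded_module" (structure) and \<rho> f +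
  fixes k :: int
  assumes fk: "f \<in> part R k"
begin

lemma pow_part: "f [^] (u::nat) \<in> part R (int u * k)"
proof (induction u)
  case 0
  then show ?case by (simp add: one_part)
next
  case (Suc u)
  then show ?case using part_mult[OF Suc fk] by (simp add: algebra_simps)
qed

lemma loc_proj_frac:
  assumes m: "m \<in> carrier M"
  shows "loc_proj R M \<rho> f k c (frac m s) = frac (\<rho> (c + int s * k) m) s"
  unfolding loc_proj_def
proof (rule frac_cong_map[OF m])
  fix m' s' u assume *: "m' \<in> carrier M" "(f [^] (u + s')) \<odot>\<^bsub>M\<^esub> m = (f [^] (u + s)) \<odot>\<^bsub>M\<^esub> m'"
  \<comment> \<open>Both sides are compared in the same degree, because
    \<open>s + (u + s') = s' + (u + s)\<close>.\<close>
  let ?c = "c + int s * k + int (u + s') * k"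
  have "(f [^] (u + s')) \<odot>\<^bsub>M\<^esub> \<rho> (c + int s * k) m = \<rho> ?c ((f [^] (u + s')) \<odot>\<^bsub>M\<^esub> m)"
    using gproj_smult[OF pow_part m, of "c + int s * k" "u + s'"] by simp
  also have "\<dots> = \<rho> (c + int s' * k + int (u + s) * k) ((f [^] (u + s)) \<odot>\<^bsub>M\<^esub> m')"
    unfolding *(2) by (simp add: algebra_simps)
  also have "\<dots> = (f [^] (u + s)) \<odot>\<^bsub>M\<^esub> \<rho> (c + int s' * k) m'"
    by (rule gproj_smult[OF pow_part *(1)])
  finally show "frac (\<rho> (c + int s' * k) m') s' = frac (\<rho> (c + int s * k) m) s"
    by (intro frac_eqI[of _ _ u]) (use * m in simp_all)
qed

lemma gmod_L: "gmod R (L k) (loc_proj R M \<rho> f k)"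
proof (intro gmod.intro module_L gmod_axioms.intro)
  show "component (L k) c \<subseteq> carrier (L k)" for c
    using comp_sub unfolding L_simps by blast
  show "loc_proj R M \<rho> f k c X \<in> component (L k) c" if X: "X \<in> carrier (L k)" for c X
  proof -
    obtain m s where m: "m \<in> carrier M" "X = frac m s" using X by (rule L_cases)
    show ?thesis using m gproj_in[OF m(1), of "c + int s * k"] by (auto simp: loc_proj_frac L_simps)
  qed
  show "loc_proj R M \<rho> f k c X = X" if X: "X \<in> component (L k) c" for c X
  proof -
    obtain m s where m: "m \<in> component M (c + int s * k)" "X = frac m s" using X by (auto simp: L_simps)
    then have "m \<in> carrier M" using comp_sub by blast
    then show ?thesis using m by (simp add: loc_proj_frac gproj_id)
  qed
  show "loc_proj R M \<rho> f k c (X \<oplus>\<^bsub>L k\<^esub> Y) = loc_proj R M \<rho> f k c X \<oplus>\<^bsub>L k\<^esub> loc_proj R M \<rho> f k c Y"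
    if XY: "X \<in> carrier (L k)" "Y \<in> carrier (L k)" for c X Y
  proof -
    obtain m1 m2 t where 2: "m1 \<in> carrier M" "m2 \<in> carrier M" "X = frac m1 t" "Y = frac m2 t"
      using XY by (rule L_common2)
    then show ?thesis by (simp add: L_add_common loc_proj_frac gproj_add)
  qed
  show "loc_proj R M \<rho> f k (c + e) (r \<odot>\<^bsub>L k\<^esub> X) = r \<odot>\<^bsub>L k\<^esub> loc_proj R M \<rho> f k c X"
    if r: "r \<in> part R e" and X: "X \<in> carrier (L k)" for c e r X
  proof -
    obtain m s where m: "m \<in> carrier M" "X = frac m s" using X by (rule L_cases)
    have e: "c + e + int s * k = (c + int s * k) + e" by simp
    show ?thesis using m part_carr[OF r] gproj_smult[OF r m(1), of "c + int s * k"]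
      by (simp add: L_smult loc_proj_frac e)
  qed
qed (rule part_sub)

end

section \<open>The Cech complex\<close>

text \<open>Induction on \<open>T\<close>: the row and the column of the new index cancel. The
  diagonal is left out because antisymmetry alone gives only \<open>2 g i i = 0\<close>.\<close>

lemma (in abelian_group) finsum_antisymmetric:
  assumes "finite T" "\<And>i j. i \<in> T \<Longrightarrow> j \<in> T \<Longrightarrow> i \<noteq> j \<Longrightarrow> g i j \<in> carrier G"
    and "\<And>i j. i \<in> T \<Longrightarrow> j \<in> T \<Longrightarrow> i \<noteq> j \<Longrightarrow> g j i = \<ominus> g i j"
  shows "(\<Oplus>i\<in>T. \<Oplus>j\<in>T - {i}. g i j) = \<zero>"
  using assms
proof (induction T rule: finite_induct)
  case empty
  show ?case by simp
next
  case (insert t T)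
  have g: "g i j \<in> carrier G" if "i \<in> insert t T" "j \<in> insert t T" "i \<noteq> j" for i j
    using insert.prems(1)[OF that] .
  have in1: "(\<Oplus>j\<in>T - {i}. g i j) \<in> carrier G" if "i \<in> T" for i
    by (rule finsum_closed) (use that g in auto)
  have gt: "g i t \<in> carrier G" if "i \<in> T" for i using g[of i t] that insert(2) by auto
  have row: "(\<Oplus>j\<in>insert t T - {i}. g i j) = g i t \<oplus> (\<Oplus>j\<in>T - {i}. g i j)" if i: "i \<in> T" for i
  proof -
    have "insert t T - {i} = insert t (T - {i})" using i insert(2) by auto
    moreover have "(\<Oplus>j\<in>insert t (T - {i}). g i j) = g i t \<oplus> (\<Oplus>j\<in>T - {i}. g i j)"
      by (rule finsum_insert) (use insert(1,2) gt[OF i] g i in auto)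
    ultimately show ?thesis by simp
  qed
  have "(\<Oplus>i\<in>T. \<Oplus>j\<in>insert t T - {i}. g i j) = (\<Oplus>i\<in>T. g i t \<oplus> (\<Oplus>j\<in>T - {i}. g i j))"
    by (rule finsum_cong'[OF refl]) (simp_all add: row in1 gt)
  also have "\<dots> = (\<Oplus>i\<in>T. g i t) \<oplus> (\<Oplus>i\<in>T. \<Oplus>j\<in>T - {i}. g i j)"
    using in1 gt by (intro finsum_addf) auto
  also have "(\<Oplus>i\<in>T. \<Oplus>j\<in>T - {i}. g i j) = \<zero>"
    by (rule insert.IH; rule insert.prems; simp)
  finally have 1: "(\<Oplus>i\<in>T. \<Oplus>j\<in>insert t T - {i}. g i j) = (\<Oplus>i\<in>T. g i t)" using gt by simp
  have gt': "g t j \<in> carrier G" if "j \<in> T" for j using g[of t j] that insert(2) by auto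
  have 2: "insert t T - {t} = T" using insert(2) by auto
  have "(\<Oplus>j\<in>T. g t j) \<oplus> (\<Oplus>i\<in>T. g i t) = (\<Oplus>j\<in>T. g t j \<oplus> g j t)"
    using gt gt' by (subst finsum_addf) auto
  also have "\<dots> = (\<Oplus>j\<in>T. \<zero>)"
  proof (rule finsum_cong')
    fix j assume j: "j \<in> T"
    then have "g j t = \<ominus> g t j" using insert.prems(2)[of t j] insert(2) by auto
    then show "g t j \<oplus> g j t = \<zero>" using gt'[OF j] by (simp add: r_neg)
  qed auto
  finally have 3: "(\<Oplus>j\<in>T. g t j) \<oplus> (\<Oplus>i\<in>T. g i t) = \<zero>" by simp
  have "(\<Oplus>i\<in>insert t T. \<Oplus>j\<in>insert t T - {i}. g i j)
      = (\<Oplus>j\<in>insert t T - {t}. g t j) \<oplus> (\<Oplus>i\<in>T. \<Oplus>j\<in>insert t T - {i}. g i j)"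
  proof (rule finsum_insert[OF insert(1,2)])
    show "(\<lambda>i. \<Oplus>j\<in>insert t T - {i}. g i j) \<in> T \<rightarrow> carrier G" using row in1 gt by auto
    show "(\<Oplus>j\<in>insert t T - {t}. g t j) \<in> carrier G" unfolding 2 using gt' by auto
  qed
  then show ?case unfolding 1 2 3 .
qed

locale cech = R?: gring R \<pi> + gmod R M \<rho>
  for R :: "'a graded_ring" (structure) and \<pi> and M :: "('a, 'b) graded_module" (structure) and \<rho> +
  fixes n :: nat and x :: "nat \<Rightarrow> 'a"
  assumes x_part: "i < n \<Longrightarrow> x i \<in> part R 1"
begin

definition xS :: "nat set \<Rightarrow> 'a" where "xS S = (\<Otimes>\<^bsub>R\<^esub>i\<in>S. x i)"

abbreviation CL where "CL \<equiv> cech_local R x M"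

abbreviation fr where "fr S \<equiv> fraction R M (xS S)"

definition pS :: "nat set \<Rightarrow> int \<Rightarrow> ('b \<times> nat) set \<Rightarrow> ('b \<times> nat) set" where
  "pS S = loc_proj R M \<rho> (xS S) (int (card S))"

lemma x_carr: "i < n \<Longrightarrow> x i \<in> carrier R"
  using x_part part_carr by blast

lemma xS_insert:
  assumes "finite S" "i \<notin> S" "insert i S \<subseteq> {..<n}"
  shows "xS (insert i S) = x i \<otimes>\<^bsub>R\<^esub> xS S"
  unfolding xS_def by (rule R.finprod_insert) (use assms x_carr in auto)

lemma xS_part: "S \<subseteq> {..<n} \<Longrightarrow> xS S \<in> part R (int (card S))"
proof -
  assume S: "S \<subseteq> {..<n}"
  then have "finite S" by (rule finite_subset) simp
  then show ?thesis using S
  proof (induction S rule: finite_induct)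
    case empty
    then show ?case using one_part by (simp add: xS_def)
  next
    case (insert i S)
    then have "x i \<otimes>\<^bsub>R\<^esub> xS S \<in> part R (int (card S) + 1)"
      by (intro part_mult x_part) auto
    then show ?case using insert by (simp add: xS_insert add.commute)
  qed
qed

lemma xS_remove: "T \<subseteq> {..<n} \<Longrightarrow> i \<in> T \<Longrightarrow> xS T = x i \<otimes>\<^bsub>R\<^esub> xS (T - {i})"
  using xS_insert[of "T - {i}" i] finite_subset[of T "{..<n}"] by (simp add: insert_absorb)

lemma gloc_S: "S \<subseteq> {..<n} \<Longrightarrow> gloc R \<pi> M \<rho> (xS S) (int (card S))"
  by (intro gloc.intro gring_axioms gmod_axioms loc_module.intro module_axioms loc_module_axioms.intro
      gloc_axioms.intro xS_part part_carr[OF xS_part])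

lemma loc_S: "S \<subseteq> {..<n} \<Longrightarrow> loc_module R M (xS S)"
  using gloc_S unfolding gloc_def by blast

lemma CL_eq: "CL S = localization R M (xS S) (int (card S))"
  by (simp add: cech_local_def xS_def)

lemma module_CL: "S \<subseteq> {..<n} \<Longrightarrow> Module.module R (CL S)"
  unfolding CL_eq by (rule loc_module.module_L[OF loc_S])

lemma gmod_CL: "S \<subseteq> {..<n} \<Longrightarrow> gmod R (CL S) (pS S)"
  unfolding CL_eq pS_def by (rule gloc.gmod_L[OF gloc_S])

lemma pow_insert: "T \<subseteq> {..<n} \<Longrightarrow> i \<in> T \<Longrightarrow> m \<in> carrier M \<Longrightarrow>
    (xS T [^]\<^bsub>R\<^esub> (u::nat)) \<odot>\<^bsub>M\<^esub> m = (x i [^]\<^bsub>R\<^esub> u) \<odot>\<^bsub>M\<^esub> ((xS (T - {i}) [^]\<^bsub>R\<^esub> u) \<odot>\<^bsub>M\<^esub> m)"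
proof -
  assume T: "T \<subseteq> {..<n}" "i \<in> T" and m: "m \<in> carrier M"
  have c: "x i \<in> carrier R" "xS (T - {i}) \<in> carrier R"
    using T x_carr part_carr[OF xS_part[of "T - {i}"]] by auto
  show ?thesis unfolding xS_remove[OF T] using c m
    by (simp add: R.nat_pow_distrib smult_assoc1[symmetric])
qed

text \<open>Independence of the representative: the product over \<open>T\<close> is
  \<open>x i\<close> times the product over \<open>T - {i}\<close>, so multiplying the relation for
  \<open>T - {i}\<close> by a power of \<open>x i\<close> gives the one for \<open>T\<close>, with
  the same witness \<open>u\<close>.\<close>

lemma restrict_frac:
  assumes T: "T \<subseteq> {..<n}" "i \<in> T" and m: "m \<in> carrier M"
  shows "cech_restrict R x M T i (fr (T - {i}) m s) = fr T ((x i [^]\<^bsub>R\<^esub> s) \<odot>\<^bsub>M\<^esub> m) s"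
proof -
  interpret lS: loc_module R M "xS (T - {i})" by (rule loc_S) (use T in auto)
  interpret lT: loc_module R M "xS T" by (rule loc_S) (use T in auto)
  have c: "x i \<in> carrier R" "xS (T - {i}) \<in> carrier R"
    using T x_carr part_carr[OF xS_part[of "T - {i}"]] by auto
  have "(\<Union>(m, s)\<in>fr (T - {i}) m s. fr T ((x i [^]\<^bsub>R\<^esub> s) \<odot>\<^bsub>M\<^esub> m) s) = fr T ((x i [^]\<^bsub>R\<^esub> s) \<odot>\<^bsub>M\<^esub> m) s"
  proof (rule lS.frac_cong_map[OF m])
    fix m' s' u assume m': "m' \<in> carrier M"
      and u: "(xS (T - {i}) [^]\<^bsub>R\<^esub> (u + s')) \<odot>\<^bsub>M\<^esub> m = (xS (T - {i}) [^]\<^bsub>R\<^esub> (u + s)) \<odot>\<^bsub>M\<^esub> m'"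
    have *: "(xS T [^]\<^bsub>R\<^esub> (u + t)) \<odot>\<^bsub>M\<^esub> ((x i [^]\<^bsub>R\<^esub> t') \<odot>\<^bsub>M\<^esub> v)
      = (x i [^]\<^bsub>R\<^esub> (u + t + t')) \<odot>\<^bsub>M\<^esub> ((xS (T - {i}) [^]\<^bsub>R\<^esub> (u + t)) \<odot>\<^bsub>M\<^esub> v)"
      if v: "v \<in> carrier M" for v and t t' :: nat
    proof -
      have "(xS (T - {i}) [^]\<^bsub>R\<^esub> (u + t)) \<odot>\<^bsub>M\<^esub> ((x i [^]\<^bsub>R\<^esub> t') \<odot>\<^bsub>M\<^esub> v)
        = (x i [^]\<^bsub>R\<^esub> t') \<odot>\<^bsub>M\<^esub> ((xS (T - {i}) [^]\<^bsub>R\<^esub> (u + t)) \<odot>\<^bsub>M\<^esub> v)"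
        using v c by (intro lS.pow_comm) auto
      then show ?thesis
        using v c by (simp add: pow_insert[OF T] smult_assoc1[symmetric] R.nat_pow_mult R.m_assoc[symmetric])
    qed
    show "fr T ((x i [^]\<^bsub>R\<^esub> s') \<odot>\<^bsub>M\<^esub> m') s' = fr T ((x i [^]\<^bsub>R\<^esub> s) \<odot>\<^bsub>M\<^esub> m) s"
    proof (rule lT.frac_eqI[of _ _ u])
      show "(xS T [^]\<^bsub>R\<^esub> (u + s)) \<odot>\<^bsub>M\<^esub> ((x i [^]\<^bsub>R\<^esub> s') \<odot>\<^bsub>M\<^esub> m')
         = (xS T [^]\<^bsub>R\<^esub> (u + s')) \<odot>\<^bsub>M\<^esub> ((x i [^]\<^bsub>R\<^esub> s) \<odot>\<^bsub>M\<^esub> m)"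
        unfolding *[OF m] *[OF m'] u by (simp add: add_ac)
    qed (use m m' c in auto)
  qed
  then show ?thesis by (simp add: cech_restrict_def xS_def)
qed

lemma CL_cases:
  assumes "S \<subseteq> {..<n}" "X \<in> carrier (CL S)"
  obtains m s where "m \<in> carrier M" "X = fr S m s"
  using loc_module.L_cases[OF loc_S[OF assms(1)], of X "int (card S)"] assms(2) unfolding CL_eq by blast

lemma restrict_lin:
  assumes T: "T \<subseteq> {..<n}" "i \<in> T"
  shows "lin_map R (CL (T - {i})) (CL T) (cech_restrict R x M T i)"
proof -
  have S: "T - {i} \<subseteq> {..<n}" using T by auto
  interpret lS: loc_module R M "xS (T - {i})" by (rule loc_S[OF S])
  interpret lT: loc_module R M "xS T" by (rule loc_S[OF T(1)])
  have c: "x i \<in> carrier R" using T x_carr by auto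
  show ?thesis
  proof (rule lin_mapI)
    fix X assume "X \<in> carrier (CL (T - {i}))"
    then obtain m s where m: "m \<in> carrier M" "X = fr (T - {i}) m s" by (rule CL_cases[OF S])
    show "cech_restrict R x M T i X \<in> carrier (CL T)"
      unfolding m(2) restrict_frac[OF T m(1)] CL_eq by (rule lT.frac_carrier) (use m c in auto)
  next
    fix X Y assume XY: "X \<in> carrier (CL (T - {i}))" "Y \<in> carrier (CL (T - {i}))"
    obtain m m' s where m: "m \<in> carrier M" "m' \<in> carrier M" "X = fr (T - {i}) m s" "Y = fr (T - {i}) m' s"
      using XY unfolding CL_eq by (rule lS.L_common2)
    show "cech_restrict R x M T i (X \<oplus>\<^bsub>CL (T - {i})\<^esub> Y)
        = cech_restrict R x M T i X \<oplus>\<^bsub>CL T\<^esub> cech_restrict R x M T i Y"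
      using m c by (simp add: CL_eq lS.L_add_common lT.L_add_common restrict_frac[OF T] smult_r_distr)
  next
    fix r X assume r: "r \<in> carrier R" and X: "X \<in> carrier (CL (T - {i}))"
    obtain m s where m: "m \<in> carrier M" "X = fr (T - {i}) m s" using X by (rule CL_cases[OF S])
    show "cech_restrict R x M T i (r \<odot>\<^bsub>CL (T - {i})\<^esub> X) = r \<odot>\<^bsub>CL T\<^esub> cech_restrict R x M T i X"
      using m c r by (simp add: CL_eq lS.L_smult lT.L_smult restrict_frac[OF T] smult_assoc1[symmetric] R.m_comm)
  qed
qed

text \<open>The numerator is multiplied by the \<open>s\<close>-th power of \<open>x i\<close>, of
  degree \<open>s\<close>; the degree of the denominator grows by the same amount, because
  \<open>T\<close> has one index more.\<close>

lemma restrict_proj: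
  assumes T: "T \<subseteq> {..<n}" "i \<in> T" and X: "X \<in> carrier (CL (T - {i}))"
  shows "pS T c (cech_restrict R x M T i X) = cech_restrict R x M T i (pS (T - {i}) c X)"
proof -
  have S: "T - {i} \<subseteq> {..<n}" using T by auto
  interpret lS: gloc R \<pi> M \<rho> "xS (T - {i})" "int (card (T - {i}))" by (rule gloc_S[OF S])
  interpret lT: gloc R \<pi> M \<rho> "xS T" "int (card T)" by (rule gloc_S[OF T(1)])
  \<comment> \<open>Used only for the degree of the powers of \<open>x i\<close>, the product over
    the singleton \<open>{i}\<close>.\<close>
  interpret lx: gloc R \<pi> M \<rho> "x i" 1
    using gloc_S[of "{i}"] T x_carr by (auto simp: xS_def)
  obtain m s where m: "m \<in> carrier M" "X = fr (T - {i}) m s" using X by (rule CL_cases[OF S])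
  have "card T = Suc (card (T - {i}))"
    by (rule card.remove[OF finite_subset[OF T(1)] T(2)]) simp
  then have e: "c + int s * int (card T) = c + int s * int (card (T - {i})) + int s * 1"
    by (simp add: algebra_simps)
  show ?thesis
    using m gproj_smult[OF lx.pow_part m(1), of "c + int s * int (card (T - {i}))" s]
    by (simp add: pS_def restrict_frac[OF T] lT.loc_proj_frac lS.loc_proj_frac e x_carr)
qed

lemma restrict_restrict:
  assumes T: "T \<subseteq> {..<n}" "i \<in> T" "j \<in> T" "i \<noteq> j" and X: "X \<in> carrier (CL (T - {i} - {j}))"
  shows "cech_restrict R x M T i (cech_restrict R x M (T - {i}) j X)
    = cech_restrict R x M T j (cech_restrict R x M (T - {j}) i X)"
proof -
  have S: "T - {i} - {j} \<subseteq> {..<n}" "T - {i} \<subseteq> {..<n}" "T - {j} \<subseteq> {..<n}" "j \<in> T - {i}" "i \<in> T - {j}"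
    using T by auto
  have c: "x i \<in> carrier R" "x j \<in> carrier R" using T x_carr by auto
  have comm: "T - {i} - {j} = T - {j} - {i}" by auto
  obtain m s where m: "m \<in> carrier M" "X = fr (T - {i} - {j}) m s" using X by (rule CL_cases[OF S(1)])
  show ?thesis
    unfolding m(2) restrict_frac[OF S(2,4) m(1)]
    unfolding comm restrict_frac[OF S(3,5) m(1)]
    using m c T by (simp add: restrict_frac smult_assoc1[symmetric] R.m_comm)
qed

abbreviation CM where "CM \<equiv> cech_module R n x M"
abbreviation CD where "CD \<equiv> cech_diff R n x M"

definition cproj :: "nat \<Rightarrow> int \<Rightarrow> (nat set \<Rightarrow> ('b \<times> nat) set) \<Rightarrow> (nat set \<Rightarrow> ('b \<times> nat) set)" where
  "cproj q c v = (\<lambda>S\<in>cech_index n q. pS S c (v S))"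

lemma index_subset: "S \<in> cech_index n q \<Longrightarrow> S \<subseteq> {..<n}"
  by (simp add: cech_index_def)

lemma index_finite: "S \<in> cech_index n q \<Longrightarrow> finite S"
  using index_subset finite_subset by blast

lemma index_remove: "T \<in> cech_index n (Suc q) \<Longrightarrow> i \<in> T \<Longrightarrow> T - {i} \<in> cech_index n q"
  using index_finite[of T "Suc q"] by (auto simp: cech_index_def)

lemma CM_simps:
  "carrier (CM q) = (\<Pi>\<^sub>E S\<in>cech_index n q. carrier (CL S))"
  "\<zero>\<^bsub>CM q\<^esub> = (\<lambda>S\<in>cech_index n q. \<zero>\<^bsub>CL S\<^esub>)"
  "c \<oplus>\<^bsub>CM q\<^esub> c' = (\<lambda>S\<in>cech_index n q. c S \<oplus>\<^bsub>CL S\<^esub> c' S)"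
  "r \<odot>\<^bsub>CM q\<^esub> c = (\<lambda>S\<in>cech_index n q. r \<odot>\<^bsub>CL S\<^esub> c S)"
  "component (CM q) k = (\<Pi>\<^sub>E S\<in>cech_index n q. component (CL S) k)"
  by (auto simp: cech_module_def)

lemma gmod_CM: "gmod R (CM q) (cproj q)"
proof -
  have "cproj q = (\<lambda>c v. \<lambda>S\<in>cech_index n q. pS S c (v S))" by (simp add: cproj_def fun_eq_iff)
  then show ?thesis
    using gmod_pointwise[where J = "cech_index n q" and N = CL and \<rho> = pS and P = "CM q", OF gring_axioms]
      gmod_CL index_subset CM_simps by auto
qed

text \<open>One signed summand of \<open>cech_diff\<close>, isolated so that linearity and degrees
  can be treated term by term.\<close>

definition face :: "nat set \<Rightarrow> nat \<Rightarrow> (nat set \<Rightarrow> ('b \<times> nat) set) \<Rightarrow> ('b \<times> nat) set" where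
  "face T i c = (let y = cech_restrict R x M T i (c (T - {i}))
           in if even (card {l \<in> T. l < i}) then y else \<ominus>\<^bsub>CL T\<^esub> y)"

lemma CD_eq: "CD q c = (\<lambda>T\<in>cech_index n (Suc q). \<Oplus>\<^bsub>CL T\<^esub>i\<in>T. face T i c)"
  by (simp add: cech_diff_def face_def)

lemma face_lin:
  assumes T: "T \<in> cech_index n (Suc q)" "i \<in> T"
  shows "lin_map R (CM q) (CL T) (face T i)"
proof -
  have ev: "lin_map R (CM q) (CL (T - {i})) (\<lambda>c. c (T - {i}))"
    using index_remove[OF T] by (auto intro!: lin_mapI simp: CM_simps)
  have "lin_map R (CM q) (CL T) (\<lambda>c. cech_restrict R x M T i (c (T - {i})))"
    by (rule lin_map_compose[OF ev restrict_lin[OF index_subset[OF T(1)] T(2)]])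
  then show ?thesis
    using lin_map_neg[OF module_CL[OF index_subset[OF T(1)]]]
    by (cases "even (card {l \<in> T. l < i})") (simp_all add: face_def[abs_def] Let_def)
qed

lemma CD_lin: "lin_map R (CM q) (CM (Suc q)) (CD q)"
proof -
  have *: "lin_map R (CM q) (CL T) (\<lambda>c. \<Oplus>\<^bsub>CL T\<^esub>i\<in>T. face T i c)" if T: "T \<in> cech_index n (Suc q)" for T
    by (rule lin_map_finsum_map[OF module_CL[OF index_subset[OF T]] index_finite[OF T] face_lin[OF T]])
  show ?thesis unfolding CD_eq[abs_def]
    by (rule lin_mapI) (auto simp: CM_simps(1,3,4)[of "Suc q"] lin_map_closed[OF *] lin_map_add[OF *]
        lin_map_smult[OF *] intro!: restrict_ext)
qed

lemma face_proj:
  assumes T: "T \<in> cech_index n (Suc q)" "i \<in> T" and v: "v \<in> carrier (CM q)"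
  shows "pS T c (face T i v) = face T i (cproj q c v)"
proof -
  note I = index_remove[OF T] and S = index_subset[OF T(1)]
  interpret gm: gmod R "CL T" "pS T" by (rule gmod_CL[OF S])
  have vc: "v (T - {i}) \<in> carrier (CL (T - {i}))" using v I by (auto simp: CM_simps)
  have "pS T c (cech_restrict R x M T i (v (T - {i}))) = cech_restrict R x M T i (cproj q c v (T - {i}))"
    using restrict_proj[OF S T(2) vc] I by (simp add: cproj_def)
  moreover have "cech_restrict R x M T i (v (T - {i})) \<in> carrier (CL T)"
    by (rule lin_map_closed[OF restrict_lin[OF S T(2)] vc])
  ultimately show ?thesis by (simp add: face_def Let_def gm.gproj_a_inv)
qed

lemma cproj_CD:
  assumes v: "v \<in> carrier (CM q)"
  shows "cproj (Suc q) c (CD q v) = CD q (cproj q c v)"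
  unfolding CD_eq cproj_def[of "Suc q"]
proof (rule restrict_ext)
  fix T assume T: "T \<in> cech_index n (Suc q)"
  interpret gm: gmod R "CL T" "pS T" by (rule gmod_CL[OF index_subset[OF T]])
  have cl: "face T i v \<in> carrier (CL T)" if "i \<in> T" for i
    by (rule lin_map_closed[OF face_lin[OF T that] v])
  have "pS T c (\<Oplus>\<^bsub>CL T\<^esub>i\<in>T. face T i v) = (\<Oplus>\<^bsub>CL T\<^esub>i\<in>T. pS T c (face T i v))"
    using cl index_finite[OF T] by (intro gm.gproj_finsum) auto
  also have "\<dots> = (\<Oplus>\<^bsub>CL T\<^esub>i\<in>T. face T i (cproj q c v))"
    by (rule gm.M.finsum_cong')
      (use face_proj[OF T _ v] cl gm.gproj_closed in \<open>auto simp flip: face_proj[OF T _ v]\<close>)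
  finally show "pS T c ((\<lambda>T\<in>cech_index n (Suc q). \<Oplus>\<^bsub>CL T\<^esub>i\<in>T. face T i v) T)
      = (\<Oplus>\<^bsub>CL T\<^esub>i\<in>T. face T i (cproj q c v))" using T by simp
qed

lemma card_less_remove:
  assumes "finite (T :: nat set)" "i \<in> T"
  shows "card {l \<in> T. l < j} = card {l \<in> T - {i}. l < j} + (if i < j then 1 else 0)"
proof (cases "i < j")
  case True
  then have "{l \<in> T. l < j} = insert i {l \<in> T - {i}. l < j}" using assms(2) by auto
  then show ?thesis using True assms(1) by simp
next
  case False
  then have "{l \<in> T. l < j} = {l \<in> T - {i}. l < j}" by auto
  then show ?thesis using False by simp
qed

text \<open>Applying the differential twice gives a double sum over ordered pairs of distinct
  indices. The two orders of removing a pair lead to the same fraction with opposite signs.\<close>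

lemma CD_CD:
  assumes v: "v \<in> carrier (CM q)"
  shows "CD (Suc q) (CD q v) = \<zero>\<^bsub>CM (Suc (Suc q))\<^esub>"
  unfolding CD_eq[of "Suc q"] CM_simps(2)
proof (rule restrict_ext)
  fix T assume T: "T \<in> cech_index n (Suc (Suc q))"
  note S = index_subset[OF T] and fin = index_finite[OF T]
  interpret CL: Module.module R "CL T" by (rule module_CL[OF S])
  \<comment> \<open>In what follows \<open>p\<close> decides the sign attached to an index,
    \<open>w i j\<close> is the unsigned term obtained by removing \<open>i\<close> and then
    \<open>j\<close>, and \<open>g i j\<close> is the same term with both signs.\<close>
  define sg where "sg b y = (if b then y else \<ominus>\<^bsub>CL T\<^esub> y)" for b :: bool and y
  define w where "w i j = cech_restrict R x M T i (cech_restrict R x M (T - {i}) j (v (T - {i} - {j})))" for i j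
  define p where "p T i = even (card {l \<in> T. l < (i::nat)})" for T i
  define g where "g i j = sg (p T i) (sg (p (T - {i}) j) (w i j))" for i j
  have sg_lin: "lin_map R (CL T) (CL T) (sg b)" for b
    using lin_map_neg[OF CL.module_axioms, of "CL T" "\<lambda>v. v"] lin_map_smult_map[OF CL.module_axioms]
    by (cases b) (auto simp: sg_def[abs_def] lin_map_def)
  have wc: "w i j \<in> carrier (CL T)" if "i \<in> T" "j \<in> T" "i \<noteq> j" for i j
    unfolding w_def
  proof (intro lin_map_closed[OF restrict_lin])
    show "v (T - {i} - {j}) \<in> carrier (CL (T - {i} - {j}))"
      using v index_remove[OF index_remove[OF T that(1)], of j] that by (auto simp: CM_simps)
  qed (use that S in auto)
  have gc: "g i j \<in> carrier (CL T)" if "i \<in> T" "j \<in> T" "i \<noteq> j" for i j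
    unfolding g_def by (intro lin_map_closed[OF sg_lin] wc that)
  have row: "face T i (CD q v) = (\<Oplus>\<^bsub>CL T\<^esub>j\<in>T - {i}. g i j)" if i: "i \<in> T" for i
  proof -
    note I = index_remove[OF T i]
    interpret CI: Module.module R "CL (T - {i})" by (rule module_CL[OF index_subset[OF I]])
    have fc: "(\<lambda>j. face (T - {i}) j v) \<in> T - {i} \<rightarrow> carrier (CL (T - {i}))"
      using lin_map_closed[OF face_lin[OF I] v] by auto
    have lin: "lin_map R (CL (T - {i})) (CL T) (\<lambda>y. sg (p T i) (cech_restrict R x M T i y))"
      by (rule lin_map_compose[OF restrict_lin[OF S i] sg_lin])
    have "face T i (CD q v) = sg (p T i) (cech_restrict R x M T i (\<Oplus>\<^bsub>CL (T - {i})\<^esub>j\<in>T - {i}. face (T - {i}) j v))"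
      using I by (simp add: face_def CD_eq Let_def sg_def p_def)
    also have "\<dots> = (\<Oplus>\<^bsub>CL T\<^esub>j\<in>T - {i}. sg (p T i) (cech_restrict R x M T i (face (T - {i}) j v)))"
      by (rule lin_map_finsum[OF CI.module_axioms CL.module_axioms lin _ fc]) (use fin in simp)
    also have "\<dots> = (\<Oplus>\<^bsub>CL T\<^esub>j\<in>T - {i}. g i j)"
    proof (rule CL.finsum_cong')
      show "(\<lambda>j. g i j) \<in> T - {i} \<rightarrow> carrier (CL T)" using gc i by auto
      fix j assume j: "j \<in> T - {i}"
      have "cech_restrict R x M (T - {i}) j (v (T - {i} - {j})) \<in> carrier (CL (T - {i}))"
        using v index_remove[OF I j] by (intro lin_map_closed[OF restrict_lin[OF index_subset[OF I] j]])
          (auto simp: CM_simps)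
      then show "sg (p T i) (cech_restrict R x M T i (face (T - {i}) j v)) = g i j"
        using lin_map_a_inv[OF CI.module_axioms CL.module_axioms restrict_lin[OF S i]]
        by (simp add: g_def face_def Let_def w_def sg_def p_def)
    qed simp
    finally show ?thesis .
  qed
  have anti: "g j i = \<ominus>\<^bsub>CL T\<^esub> g i j" if ij: "i \<in> T" "j \<in> T" "i \<noteq> j" for i j
  proof -
    have vc: "v (T - {i} - {j}) \<in> carrier (CL (T - {i} - {j}))"
      using v index_remove[OF index_remove[OF T ij(1)], of j] ij by (auto simp: CM_simps)
    have comm: "T - {j} - {i} = T - {i} - {j}" by auto
    have wsym: "w j i = w i j"
      unfolding w_def comm by (rule restrict_restrict[OF S ij vc, symmetric])
    \<comment> \<open>Removing \<open>i\<close> changes the number of elements below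
      \<open>j\<close> exactly if \<open>i < j\<close>. Of \<open>i < j\<close> and
      \<open>j < i\<close> exactly one holds, so exactly one of the two parities changes.\<close>
    have par: "(p T j = p (T - {j}) i) \<noteq> (p T i = p (T - {i}) j)"
      using card_less_remove[OF fin ij(1), of j] card_less_remove[OF fin ij(2), of i] ij(3)
      unfolding p_def by (cases "i < j") auto
    show ?thesis
      using par wc[OF ij] unfolding g_def wsym sg_def by auto
  qed
  have "(\<Oplus>\<^bsub>CL T\<^esub>i\<in>T. face T i (CD q v)) = (\<Oplus>\<^bsub>CL T\<^esub>i\<in>T. \<Oplus>\<^bsub>CL T\<^esub>j\<in>T - {i}. g i j)"
    by (rule CL.finsum_cong'[OF refl]) (use gc in \<open>simp_all add: row Pi_iff CL.finsum_closed\<close>)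
  also have "\<dots> = \<zero>\<^bsub>CL T\<^esub>"
    by (rule CL.finsum_antisymmetric[OF fin gc anti])
  finally show "(\<Oplus>\<^bsub>CL T\<^esub>i\<in>T. face T i (CD q v)) = \<zero>\<^bsub>CL T\<^esub>" .
qed

lemma CL_smult_bij:
  assumes "S \<subseteq> {..<n}" "i \<in> S"
  shows "bij_betw (\<lambda>X. x i \<odot>\<^bsub>CL S\<^esub> X) (carrier (CL S)) (carrier (CL S))"
  unfolding CL_eq
  by (rule loc_module.smult_bij_L[OF loc_S[OF assms(1)] _ _ xS_remove[OF assms]])
    (use assms x_carr part_carr[OF xS_part[of "S - {i}"]] in auto)

text \<open>The only index set of size 0 is empty; its product is treated as having degree 0, so a
  fraction of degree \<open>c\<close> has a numerator of degree \<open>c\<close>, whatever the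
  exponent of the denominator.\<close>

lemma CM_zero_component:
  assumes "component M c = {\<zero>\<^bsub>M\<^esub>}"
  shows "component (CM 0) c = {\<zero>\<^bsub>CM 0\<^esub>}"
proof -
  have I: "cech_index n 0 = {{}}" using finite_subset by (fastforce simp: cech_index_def)
  interpret l: loc_module R M "xS {}" by (rule loc_S) simp
  have "component (CL {}) c = {\<zero>\<^bsub>CL {}\<^esub>}"
    unfolding CL_eq l.L_simps(3) using assms l.frac_zero[of _ 0] by auto
  then show ?thesis unfolding CM_simps I by (auto simp: PiE_eq_singleton intro!: extensionalityI[of _ "{{}}"])
qed

end

text \<open>\<open>Suc q\<close> guarantees that each index set \<open>S\<close> has an element
  \<open>i\<close>, and then \<open>x i\<close> is the multiplication to which
  \<open>hom_acyclicI\<close> applies.\<close>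

lemma (in gres) hom_acyclic_CM:
  assumes "cech R \<pi> M \<rho> n x" and ann: "\<And>i k. i < n \<Longrightarrow> k \<in> carrier K \<Longrightarrow> x i \<odot>\<^bsub>K\<^esub> k = \<zero>\<^bsub>K\<^esub>"
  shows "hom_acyclic (cech_module R n x M (Suc q))"
proof -
  interpret C: cech R \<pi> M \<rho> n x by fact
  show ?thesis
  proof (rule hom_acyclic_pointwise[where J = "cech_index n (Suc q)" and N = "cech_local R x M"])
    fix S assume S: "S \<in> cech_index n (Suc q)"
    then obtain i where i: "i \<in> S" by (fastforce simp: cech_index_def)
    then have n: "i < n" using C.index_subset[OF S] by auto
    show "hom_acyclic (cech_local R x M S)"
      by (rule hom_acyclicI[OF C.x_carr[OF n] ann[OF n] C.module_CL[OF C.index_subset[OF S]]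
            C.CL_smult_bij[OF C.index_subset[OF S] i]])
  qed (auto simp: C.CM_simps)
qed

section \<open>Homogeneous ideals and quotients\<close>

text \<open>\<open>quotient_ring\<close> copies the fields of the plain quotient into a record of
  another type, so the ring axioms have to be carried across.\<close>

lemma cring_cong:
  assumes "cring Q" and eq: "carrier P = carrier Q" "mult P = mult Q" "one P = one Q"
    "zero P = zero Q" "add P = add Q"
  shows "cring P"
proof -
  interpret Q: cring Q by fact
  show ?thesis
  proof (rule cringI)
    show "abelian_group P"
      by (rule abelian_groupI) (auto simp: eq Q.a_ac intro: bexI[of _ "\<ominus>\<^bsub>Q\<^esub> _"] Q.l_neg)
    show "Group.comm_monoid P"
      by (rule comm_monoidI) (auto simp: eq Q.m_ac)
  qed (auto simp: eq Q.l_distr)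
qed

definition quot_proj :: "('a, 'b) graded_module \<Rightarrow> (int \<Rightarrow> 'b \<Rightarrow> 'b) \<Rightarrow> 'b set \<Rightarrow> int \<Rightarrow> 'b set \<Rightarrow> 'b set" where
  "quot_proj M \<rho> B c X = (\<Union>v\<in>X. B +>\<^bsub>M\<^esub> \<rho> c v)"

lemma (in gmod) quot_proj_coset:
  assumes B: "submodule B R M" and \<rho>B: "\<And>c v. v \<in> B \<Longrightarrow> \<rho> c v \<in> B" and v: "v \<in> carrier M"
  shows "quot_proj M \<rho> B c (B +>\<^bsub>M\<^esub> v) = B +>\<^bsub>M\<^esub> \<rho> c v"
proof -
  have Bc: "b \<in> carrier M" if "b \<in> B" for b using submoduleE(1)[OF B] that by blast
  have eq: "B +>\<^bsub>M\<^esub> \<rho> c w = B +>\<^bsub>M\<^esub> \<rho> c v" if w: "w \<in> B +>\<^bsub>M\<^esub> v" for w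
  proof -
    obtain b where b: "b \<in> B" "w = b \<oplus>\<^bsub>M\<^esub> v" using w by (auto simp: a_r_coset_def r_coset_def)
    have "\<rho> c w \<ominus>\<^bsub>M\<^esub> \<rho> c v = \<rho> c b"
      using b Bc v by (simp add: gproj_add a_minus_def M.a_assoc M.r_neg)
    then show ?thesis using b Bc v \<rho>B[OF b(1)] by (subst coset_eq_iff[OF module_M B]) auto
  qed
  have "v \<in> B +>\<^bsub>M\<^esub> v"
    by (intro abelian_subgroup.a_rcos_self abelian_subgroupI3 additive_subgroupI
        submodule.axioms(1)[OF B] M.abelian_group_axioms v)
  then have ne: "B +>\<^bsub>M\<^esub> v \<noteq> {}" by blast
  have "quot_proj M \<rho> B c (B +>\<^bsub>M\<^esub> v) = (\<Union>w\<in>B +>\<^bsub>M\<^esub> v. B +>\<^bsub>M\<^esub> \<rho> c v)"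
    unfolding quot_proj_def by (rule SUP_cong[OF refl eq])
  then show ?thesis using ne by simp
qed

lemma (in gmod) gmod_quotient:
  assumes B: "submodule B R M" and \<rho>B: "\<And>c v. v \<in> B \<Longrightarrow> \<rho> c v \<in> B"
  shows "gmod R (subquotient M (carrier M) B) (quot_proj M \<rho> B)"
proof -
  let ?Q = "subquotient M (carrier M) B"
  note mQ = subquotient_module(1)[OF module_M carrier_is_submodule B]
  have carQ: "carrier ?Q = (\<lambda>v. B +>\<^bsub>M\<^esub> v) ` carrier M"
    and compQ: "component ?Q c = (\<lambda>v. B +>\<^bsub>M\<^esub> v) ` (carrier M \<inter> component M c)" for c
    by (auto simp: subquotient_def)
  have addQ: "(B +>\<^bsub>M\<^esub> v) \<oplus>\<^bsub>?Q\<^esub> (B +>\<^bsub>M\<^esub> w) = B +>\<^bsub>M\<^esub> (v \<oplus>\<^bsub>M\<^esub> w)"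
    if "v \<in> carrier M" "w \<in> carrier M" for v w
    using coset_add[OF module_M B that] by (simp add: subquotient_def)
  have smultQ: "r \<odot>\<^bsub>?Q\<^esub> (B +>\<^bsub>M\<^esub> v) = B +>\<^bsub>M\<^esub> (r \<odot>\<^bsub>M\<^esub> v)"
    if "r \<in> carrier R" "v \<in> carrier M" for r v
    using coset_smult[OF module_M B that(2,1)] by (simp add: subquotient_def)
  note pr = quot_proj_coset[OF B \<rho>B]
  show ?thesis
  proof (intro gmod.intro mQ gmod_axioms.intro)
    show "component ?Q c \<subseteq> carrier ?Q" for c by (auto simp: carQ compQ)
    show "quot_proj M \<rho> B c X \<in> component ?Q c" if "X \<in> carrier ?Q" for c X
      using that gproj_in unfolding carQ compQ by (auto simp: pr)
    show "quot_proj M \<rho> B c X = X" if "X \<in> component ?Q c" for c X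
      using that gproj_id unfolding compQ by (auto simp: pr)
    show "quot_proj M \<rho> B c (X \<oplus>\<^bsub>?Q\<^esub> Y) = quot_proj M \<rho> B c X \<oplus>\<^bsub>?Q\<^esub> quot_proj M \<rho> B c Y"
      if "X \<in> carrier ?Q" "Y \<in> carrier ?Q" for c X Y
      using that unfolding carQ by (auto simp: pr addQ gproj_add)
    show "quot_proj M \<rho> B (c + e) (r \<odot>\<^bsub>?Q\<^esub> X) = r \<odot>\<^bsub>?Q\<^esub> quot_proj M \<rho> B c X"
      if r: "r \<in> part R e" and "X \<in> carrier ?Q" for c e r X
      using that(2) part_carrier[of e] r unfolding carQ by (auto simp: pr smultQ gproj_smult)
  qed (rule part_carrier)
qed

context gring
begin

text \<open>Closure under the projections is the form of homogeneity that passes to products and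
  powers and lets the projections descend to quotients.\<close>

definition stable :: "'a set \<Rightarrow> bool" where
  "stable J \<longleftrightarrow> ideal J R \<and> (\<forall>c. \<forall>x\<in>J. \<pi> c x \<in> J)"

text \<open>\<open>regular_module R\<close> and \<open>R\<close> are different records with the same
  addition, so inverses, sums and cosets formed in one have to be identified with those of the
  other.\<close>

lemma regular_a_inv: "a_inv (regular_module R) x = \<ominus> x"
  by (simp add: a_inv_def m_inv_def regular_module_def)

lemma regular_finsum: "finsum (regular_module R) f A = finsum R f A"
  by (simp add: finsum_def finprod_def regular_module_def)

lemma ideal_submodule: "ideal J R \<Longrightarrow> submodule J R (regular_module R)"
proof -
  assume "ideal J R"
  then interpret J: ideal J R .
  show ?thesis
    by (rule Module.module.submoduleI[OF module_regular])
      (auto simp: J.I_l_closed regular_a_inv J.Icarr)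
qed

lemma regular_coset: "a_r_coset (regular_module R) = a_r_coset R" "set_add (regular_module R) = set_add R"
  by (simp_all add: a_r_coset_def r_coset_def set_add_def set_mult_def fun_eq_iff regular_module_def)

lemma proj_finsum:
  assumes "finite A" "g \<in> A \<rightarrow> carrier R"
  shows "\<pi> c (\<Oplus>e\<in>A. g e) = (\<Oplus>e\<in>A. \<pi> c (g e))"
  using gmod.gproj_finsum[OF gmod_regular assms(1), of g c] assms(2)
  by (simp add: regular_finsum)

lemma ideal_finsum:
  assumes "ideal J R" "finite A" "g \<in> A \<rightarrow> J"
  shows "(\<Oplus>e\<in>A. g e) \<in> J"
  using submodule_finsum[OF module_regular ideal_submodule[OF assms(1)] assms(2,3)]
  by (simp add: regular_finsum)

text \<open>The component of degree \<open>c\<close> of the product is the sum of the products of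
  \<open>\<pi> e r\<close> and \<open>\<pi> (c - e) x\<close>, over the degrees \<open>e\<close> of
  a finite decomposition of \<open>r\<close>.\<close>

lemma proj_prod_in:
  assumes J: "ideal J R" and r: "r \<in> carrier R" and x: "x \<in> carrier R"
    and mem: "\<And>e. \<pi> e r \<otimes> \<pi> (c - e) x \<in> J"
  shows "\<pi> c (r \<otimes> x) \<in> J"
proof -
  obtain E where E: "finite E" "r = (\<Oplus>e\<in>E. \<pi> e r)" using decomp[OF r] by blast
  have cl: "(\<lambda>e. \<pi> e r) \<in> E \<rightarrow> carrier R" using r by auto
  have "r \<otimes> x = (\<Oplus>e\<in>E. \<pi> e r \<otimes> x)"
    using finsum_ldistr[OF E(1) x cl] E(2) by simp
  then have "\<pi> c (r \<otimes> x) = (\<Oplus>e\<in>E. \<pi> c (\<pi> e r \<otimes> x))"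
    using proj_finsum[OF E(1), of "\<lambda>e. \<pi> e r \<otimes> x" c] r x by simp
  also have "\<dots> = (\<Oplus>e\<in>E. \<pi> e r \<otimes> \<pi> (c - e) x)"
  proof (rule finsum_cong')
    fix e
    show "\<pi> c (\<pi> e r \<otimes> x) = \<pi> e r \<otimes> \<pi> (c - e) x"
      using proj_mult[OF proj_in[OF r] x, of "c - e" e] by simp
  qed (use r x in auto)
  also have "\<dots> \<in> J" by (rule ideal_finsum[OF J E(1)]) (use mem in auto)
  finally show ?thesis .
qed

text \<open>The elements whose components all lie in \<open>J\<close> form an ideal. It contains the
  homogeneous generators, and therefore \<open>J\<close>.\<close>

lemma stable_homogeneous:
  assumes "homogeneous_ideal R J"
  shows "stable J"
proof -
  obtain S where J: "ideal J R" and S: "S \<subseteq> (\<Union>i. part R i)" "J = Idl S"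
    using assms unfolding homogeneous_ideal_def by blast
  interpret J: ideal J R by fact
  have Sc: "S \<subseteq> carrier R" using S(1) part_sub by blast
  have SJ: "S \<subseteq> J" unfolding S(2) by (rule genideal_self[OF Sc])
  let ?T = "{x \<in> carrier R. \<forall>c. \<pi> c x \<in> J}"
  have neg: "\<pi> c (\<ominus> x) = \<ominus> \<pi> c x" if "x \<in> carrier R" for c x
    using gmod.gproj_a_inv[OF gmod_regular, of x c] that
    by (simp add: regular_a_inv)
  have "ideal ?T R"
  proof (rule idealI)
    show "ring R" by (rule ring_axioms)
    show "subgroup ?T (add_monoid R)"
      by (rule subgroup.intro) (auto simp: proj_add proj_zero neg a_inv_def[symmetric])
    fix a x assume a: "a \<in> ?T" and x: "x \<in> carrier R"
    have "\<pi> c (x \<otimes> a) \<in> J" for c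
      by (rule proj_prod_in[OF J x]) (use a x in \<open>auto simp: J.I_l_closed\<close>)
    then show "x \<otimes> a \<in> ?T" using a x by simp
    then show "a \<otimes> x \<in> ?T" using a x m_comm by simp
  qed
  moreover have "S \<subseteq> ?T"
  proof
    fix s assume s: "s \<in> S"
    then obtain i where i: "s \<in> part R i" using S(1) by blast
    have "\<pi> c s \<in> J" for c
      using proj_id[OF i] proj_other[OF i, of c] s SJ by (cases "c = i") auto
    then show "s \<in> ?T" using s Sc by auto
  qed
  ultimately have "J \<subseteq> ?T" unfolding S(2) by (rule genideal_minimal)
  then show ?thesis using J by (auto simp: stable_def)
qed

lemma stable_prod:
  assumes "stable I" "stable J"
  shows "stable (ideal_prod R I J)"
proof -
  have I: "ideal I R" and J: "ideal J R" using assms by (auto simp: stable_def)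
  have IJ: "ideal (ideal_prod R I J) R" by (rule ideal_prod_is_ideal[OF I J])
  have "\<pi> c s \<in> ideal_prod R I J" if "s \<in> ideal_prod R I J" for c s
    using that
  proof (induction s rule: ideal_prod.induct)
    case (prod i j)
    show ?case
      by (rule proj_prod_in[OF IJ])
        (use prod assms ideal.Icarr[OF I] ideal.Icarr[OF J] in \<open>auto simp: stable_def intro: ideal_prod.prod\<close>)
  next
    case (sum s1 s2)
    then show ?case
      using ideal_prod_in_carrier[OF I J] by (auto simp: proj_add subset_iff intro: ideal_prod.sum)
  qed
  then show ?thesis using IJ by (simp add: stable_def)
qed

lemma stable_power:
  assumes "stable I"
  shows "stable (ideal_power R I t)"
  by (induction t) (auto simp: stable_prod assms, simp add: stable_def oneideal)

lemma gmod_quotient_module: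
  assumes "stable J"
  shows "gmod R (quotient_module R J) (quot_proj (regular_module R) \<pi> J)"
  using gmod.gmod_quotient[OF gmod_regular ideal_submodule, of J] assms
  by (auto simp: stable_def)

lemma quotient_module_annihilates:
  assumes J: "ideal J R" and x: "x \<in> J" and k: "k \<in> carrier (quotient_module R J)"
  shows "x \<odot>\<^bsub>quotient_module R J\<^esub> k = \<zero>\<^bsub>quotient_module R J\<^esub>"
proof -
  interpret J: ideal J R by fact
  obtain r where r: "r \<in> carrier R" "k = J +>\<^bsub>regular_module R\<^esub> r" using k by (auto simp: subquotient_def)
  have "x \<odot>\<^bsub>quotient_module R J\<^esub> k = J +>\<^bsub>regular_module R\<^esub> (x \<otimes> r)"
    using coset_smult[OF module_regular ideal_submodule[OF J], of r x] r x J.Icarr by (simp add: subquotient_def)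
  also have "\<dots> = J"
    using coset_eq_self_iff[OF module_regular ideal_submodule[OF J], of "x \<otimes> r"] r x J.Icarr J.I_r_closed by simp
  finally show ?thesis by (simp add: subquotient_def)
qed

text \<open>As a graded group the quotient ring is the graded module \<open>R/J\<close>, from which
  the projections and their additivity are taken over. Multiplication and finite decomposition are
  checked on representatives.\<close>

lemma gring_quotient:
  assumes "stable J"
  shows "gring (quotient_ring R J) (quot_proj (regular_module R) \<pi> J)"
proof -
  have J: "ideal J R" using assms by (simp add: stable_def)
  interpret J: ideal J R by fact
  let ?Q = "quotient_ring R J" and ?p = "quot_proj (regular_module R) \<pi> J"
  let ?M = "quotient_module R J"
  interpret M: gmod R ?M ?p by (rule gmod_quotient_module[OF assms])
  have pr: "?p c (J +> x) = J +> \<pi> c x" if "x \<in> carrier R" for c x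
    using gmod.quot_proj_coset[OF gmod_regular ideal_submodule[OF J], of x c] assms that
    by (simp add: stable_def regular_coset)
  have carQ: "carrier ?Q = (\<lambda>x. J +> x) ` carrier R"
    by (auto simp: quotient_ring_def FactRing_def A_RCOSETS_def' )
  have partQ: "part ?Q c = (\<lambda>x. J +> x) ` part R c" for c by (simp add: quotient_ring_def)
  have oneQ: "\<one>\<^bsub>?Q\<^esub> = J +> \<one>" by (simp add: quotient_ring_def FactRing_def)
  have multQ: "(J +> x) \<otimes>\<^bsub>?Q\<^esub> (J +> y) = J +> (x \<otimes> y)" if "x \<in> carrier R" "y \<in> carrier R" for x y
    using J.rcoset_mult_add[OF that] by (simp add: quotient_ring_def FactRing_def)
  have "cring (R Quot J)" by (rule J.quotient_is_cring[OF is_cring])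
  then have cringQ: "cring ?Q"
    by (rule cring_cong) (simp_all add: quotient_ring_def)
  interpret Q: cring ?Q by (rule cringQ)
  have add_eq: "add ?Q = add ?M" "zero ?Q = zero ?M" "carrier ?Q = carrier ?M"
    by (simp_all add: carQ) (simp_all add: quotient_ring_def FactRing_def subquotient_def regular_coset)
  have compM: "component ?M c = part ?Q c" for c
    using part_sub[of c] by (auto simp: subquotient_def partQ regular_coset)
  show ?thesis
  proof (intro gring.intro cringQ gring_axioms.intro)
    show "part ?Q c \<subseteq> carrier ?Q" for c unfolding carQ partQ using part_sub by blast
    show "\<one>\<^bsub>?Q\<^esub> \<in> part ?Q 0" unfolding oneQ partQ using one_part by blast
    show "?p c x \<in> part ?Q c" if "x \<in> carrier ?Q" for c x
      using M.gproj_in that by (simp add: add_eq compM)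
    show "?p c x = x" if "x \<in> part ?Q c" for c x
      using M.gproj_id that by (simp add: compM)
    show "?p c x = \<zero>\<^bsub>?Q\<^esub>" if x: "x \<in> part ?Q j" "c \<noteq> j" for c j x
    proof -
      obtain y where y: "y \<in> part R j" "x = J +> y" using x unfolding partQ by blast
      have "?p c x = J +> \<zero>" using y pr[OF part_carr[OF y(1)]] proj_other[OF y(1) x(2)] by simp
      also have "\<dots> = J" using J.a_subset by simp
      finally show ?thesis by (simp add: quotient_ring_def FactRing_def)
    qed
    show "?p c (x \<oplus>\<^bsub>?Q\<^esub> y) = ?p c x \<oplus>\<^bsub>?Q\<^esub> ?p c y" if "x \<in> carrier ?Q" "y \<in> carrier ?Q" for c x y
      using M.gproj_add that by (simp add: add_eq)
    show "?p (c + e) (r \<otimes>\<^bsub>?Q\<^esub> x) = r \<otimes>\<^bsub>?Q\<^esub> ?p c x" if r: "r \<in> part ?Q e" and x: "x \<in> carrier ?Q" for c e r x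
    proof -
      obtain s where s: "s \<in> part R e" "r = J +> s" using r unfolding partQ by blast
      obtain y where y: "y \<in> carrier R" "x = J +> y" using x unfolding carQ by blast
      show ?thesis using s y part_carr[OF s(1)] by (simp add: multQ pr proj_mult)
    qed
    show "\<exists>E. finite E \<and> x = (\<Oplus>\<^bsub>?Q\<^esub>e\<in>E. ?p e x)" if x: "x \<in> carrier ?Q" for x
    proof -
      obtain y where y: "y \<in> carrier R" "x = J +> y" using x unfolding carQ by blast
      obtain E where E: "finite E" "y = (\<Oplus>e\<in>E. \<pi> e y)" using decomp[OF y(1)] by blast
      interpret h: ring_hom_cring R "R Quot J" "\<lambda>x. J +> x" by (rule J.rcos_ring_hom_cring[OF is_cring])
      have "J +> (\<Oplus>e\<in>E. \<pi> e y) = (\<Oplus>\<^bsub>R Quot J\<^esub>e\<in>E. J +> \<pi> e y)"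
        using h.hom_finsum[of "\<lambda>e. \<pi> e y" E] y(1) by (simp add: Pi_iff comp_def)
      then have "x = (\<Oplus>\<^bsub>R Quot J\<^esub>e\<in>E. J +> \<pi> e y)" by (simp only: y(2) E(2)[symmetric])
      also have "(\<lambda>e. J +> \<pi> e y) = (\<lambda>e. ?p e x)" using y pr by simp
      also have "(\<Oplus>\<^bsub>R Quot J\<^esub>e\<in>E. ?p e x) = (\<Oplus>\<^bsub>?Q\<^esub>e\<in>E. ?p e x)"
        by (simp add: finsum_def finprod_def quotient_ring_def)
      finally show ?thesis using E(1) by blast
    qed
  qed
qed

end

section \<open>The polynomial ring as a graded ring\<close>

definition mon_degree :: "(nat \<Rightarrow>\<^sub>0 nat) \<Rightarrow> int" where
  "mon_degree \<mu> = int (\<Sum>l\<in>Poly_Mapping.keys \<mu>. Poly_Mapping.lookup \<mu> l)"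

lemma mon_degree_superset:
  "finite A \<Longrightarrow> Poly_Mapping.keys \<mu> \<subseteq> A \<Longrightarrow> mon_degree \<mu> = int (\<Sum>l\<in>A. Poly_Mapping.lookup \<mu> l)"
  unfolding mon_degree_def
  by (intro arg_cong[where f = int] sum.mono_neutral_left) (auto simp: in_keys_iff)

lemma mon_degree_add: "mon_degree (\<mu> + \<nu>) = mon_degree \<mu> + mon_degree \<nu>"
  using mon_degree_superset[of "Poly_Mapping.keys \<mu> \<union> Poly_Mapping.keys \<nu>" "\<mu> + \<nu>"]
    mon_degree_superset[of "Poly_Mapping.keys \<mu> \<union> Poly_Mapping.keys \<nu>" \<mu>]
    mon_degree_superset[of "Poly_Mapping.keys \<mu> \<union> Poly_Mapping.keys \<nu>" \<nu>]
    Poly_Mapping.keys_add[of \<mu> \<nu>]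
  by (simp add: lookup_add sum.distrib)

definition hom_part :: "int \<Rightarrow> ((nat \<Rightarrow>\<^sub>0 nat) \<Rightarrow>\<^sub>0 'k::zero) \<Rightarrow> ((nat \<Rightarrow>\<^sub>0 nat) \<Rightarrow>\<^sub>0 'k)" where
  "hom_part c p = Poly_Mapping.mapp (\<lambda>\<mu> a. if mon_degree \<mu> = c then a else 0) p"

lemma lookup_hom_part:
  "Poly_Mapping.lookup (hom_part c p) \<mu> = (if mon_degree \<mu> = c then Poly_Mapping.lookup p \<mu> else 0)"
  by (auto simp: hom_part_def lookup_mapp when_def in_keys_iff)

lemma keys_hom_part: "Poly_Mapping.keys (hom_part c p) = {\<mu> \<in> Poly_Mapping.keys p. mon_degree \<mu> = c}"
  by (auto simp: in_keys_iff lookup_hom_part split: if_splits)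

lemma hom_part_add: "hom_part c (p + q) = hom_part c p + hom_part c (q :: _ \<Rightarrow>\<^sub>0 'k::comm_monoid_add)"
  by (rule poly_mapping_eqI) (simp add: lookup_hom_part lookup_add)

lemma hom_part_id: "(\<And>\<mu>. \<mu> \<in> Poly_Mapping.keys p \<Longrightarrow> mon_degree \<mu> = c) \<Longrightarrow> hom_part c p = p"
  by (rule poly_mapping_eqI) (metis in_keys_iff lookup_hom_part)

lemma hom_part_other: "(\<And>\<mu>. \<mu> \<in> Poly_Mapping.keys p \<Longrightarrow> mon_degree \<mu> \<noteq> c) \<Longrightarrow> hom_part c p = 0"
  by (rule poly_mapping_eqI) (metis in_keys_iff lookup_hom_part lookup_zero)

text \<open>Split \<open>p\<close> into its part of degree \<open>c\<close> and the rest: the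
  monomials of \<open>r\<close> times the first all have degree \<open>c + e\<close>, those of
  \<open>r\<close> times the rest never do.\<close>

lemma hom_part_mult:
  fixes r p :: "(nat \<Rightarrow>\<^sub>0 nat) \<Rightarrow>\<^sub>0 'k::field"
  assumes "\<And>\<mu>. \<mu> \<in> Poly_Mapping.keys r \<Longrightarrow> mon_degree \<mu> = e"
  shows "hom_part (c + e) (r * p) = r * hom_part c p"
proof -
  let ?q = "p - hom_part c p"
  have "r * p = r * hom_part c p + r * ?q" by (simp add: algebra_simps)
  moreover have "hom_part (c + e) (r * hom_part c p) = r * hom_part c p"
    by (rule hom_part_id)
      (use Poly_Mapping.keys_mult[of r "hom_part c p"] assms in \<open>auto simp: mon_degree_add keys_hom_part\<close>)
  moreover have "hom_part (c + e) (r * ?q) = 0"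
  proof (rule hom_part_other)
    fix \<mu> assume "\<mu> \<in> Poly_Mapping.keys (r * ?q)"
    then obtain \<alpha> \<beta> where *: "\<mu> = \<alpha> + \<beta>" "\<alpha> \<in> Poly_Mapping.keys r" "\<beta> \<in> Poly_Mapping.keys ?q"
      using Poly_Mapping.keys_mult[of r ?q] by blast
    have "mon_degree \<beta> \<noteq> c" using *(3) by (auto simp: in_keys_iff lookup_minus lookup_hom_part)
    then show "mon_degree \<mu> \<noteq> c + e" using * assms by (simp add: mon_degree_add)
  qed
  ultimately show ?thesis by (simp add: hom_part_add)
qed

abbreviation poly_car :: "nat \<Rightarrow> ((nat \<Rightarrow>\<^sub>0 nat) \<Rightarrow>\<^sub>0 'k::field) set" where
  "poly_car n \<equiv> {p. \<forall>\<mu>\<in>Poly_Mapping.keys p. Poly_Mapping.keys \<mu> \<subseteq> {..<n}}"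

lemma std_poly_ring_simps:
  "carrier (std_poly_ring n) = poly_car n" "mult (std_poly_ring n) = (*)" "one (std_poly_ring n) = 1"
  "zero (std_poly_ring n) = 0" "add (std_poly_ring n) = (+)"
  "part (std_poly_ring n) c = {p \<in> poly_car n. \<forall>\<mu>\<in>Poly_Mapping.keys p. mon_degree \<mu> = c}"
  by (simp_all add: std_poly_ring_def Let_def mon_degree_def)

lemma poly_car_closed:
  "p \<in> poly_car n \<Longrightarrow> q \<in> poly_car n \<Longrightarrow> p + q \<in> poly_car n"
  "p \<in> poly_car n \<Longrightarrow> - p \<in> poly_car n"
  "p \<in> poly_car n \<Longrightarrow> q \<in> poly_car n \<Longrightarrow> p * q \<in> poly_car n"
proof -
  show "p + q \<in> poly_car n" if "p \<in> poly_car n" "q \<in> poly_car n"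
    using that Poly_Mapping.keys_add[of p q] by blast
  show "- p \<in> poly_car n" if "p \<in> poly_car n"
    using that by (simp add: in_keys_iff)
  show "p * q \<in> poly_car n" if "p \<in> poly_car n" "q \<in> poly_car n"
  proof (clarsimp)
    fix \<mu> i assume "\<mu> \<in> Poly_Mapping.keys (p * q)" and i: "i \<in> Poly_Mapping.keys \<mu>"
    then obtain \<alpha> \<beta> where *: "\<mu> = \<alpha> + \<beta>" "\<alpha> \<in> Poly_Mapping.keys p" "\<beta> \<in> Poly_Mapping.keys q"
      using Poly_Mapping.keys_mult[of p q] by blast
    have "i \<in> Poly_Mapping.keys \<alpha> \<union> Poly_Mapping.keys \<beta>" using i Poly_Mapping.keys_add[of \<alpha> \<beta>] * by blast
    then show "i < n" using * that by auto
  qed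
qed

lemma cring_std_poly_ring: "cring (std_poly_ring n :: ((nat \<Rightarrow>\<^sub>0 nat) \<Rightarrow>\<^sub>0 'k::field) graded_ring)"
proof (rule cringI)
  let ?S = "std_poly_ring n :: ((nat \<Rightarrow>\<^sub>0 nat) \<Rightarrow>\<^sub>0 'k) graded_ring"
  show "abelian_group ?S"
  proof (rule abelian_groupI)
    show "\<exists>y\<in>carrier ?S. y \<oplus>\<^bsub>?S\<^esub> x = \<zero>\<^bsub>?S\<^esub>" if "x \<in> carrier ?S" for x
      using that poly_car_closed(2)[of x n] by (intro bexI[of _ "- x"]) (simp_all add: std_poly_ring_simps)
    show "x \<oplus>\<^bsub>?S\<^esub> y \<in> carrier ?S" if "x \<in> carrier ?S" "y \<in> carrier ?S" for x y
      using poly_car_closed(1)[of x n y] that unfolding std_poly_ring_simps .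
  qed (auto simp: std_poly_ring_simps add_ac)
  show "Group.comm_monoid ?S"
  proof (rule comm_monoidI)
    show "x \<otimes>\<^bsub>?S\<^esub> y \<in> carrier ?S" if "x \<in> carrier ?S" "y \<in> carrier ?S" for x y
      using poly_car_closed(3)[of x n y] that unfolding std_poly_ring_simps .
  qed (auto simp: std_poly_ring_simps mult_ac)
qed (auto simp: std_poly_ring_simps algebra_simps)

lemma std_finsum:
  assumes "finite E" "f \<in> E \<rightarrow> poly_car n"
  shows "(\<Oplus>\<^bsub>std_poly_ring n\<^esub>e\<in>E. f e) = (\<Sum>e\<in>E. f e)"
proof -
  interpret S: cring "std_poly_ring n" by (rule cring_std_poly_ring)
  show ?thesis using assms
    by (induction E rule: finite_induct) (simp_all add: std_poly_ring_simps Pi_iff)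
qed

lemma gring_std_poly_ring:
  "gring (std_poly_ring n :: ((nat \<Rightarrow>\<^sub>0 nat) \<Rightarrow>\<^sub>0 'k::field) graded_ring) hom_part"
proof (intro gring.intro cring_std_poly_ring gring_axioms.intro)
  let ?S = "std_poly_ring n :: ((nat \<Rightarrow>\<^sub>0 nat) \<Rightarrow>\<^sub>0 'k) graded_ring"
  have pc: "hom_part c x \<in> poly_car n" if "x \<in> poly_car n" for c and x :: "(nat \<Rightarrow>\<^sub>0 nat) \<Rightarrow>\<^sub>0 'k"
    using that by (auto simp: keys_hom_part)
  show "hom_part (c + e) (r \<otimes>\<^bsub>?S\<^esub> x) = r \<otimes>\<^bsub>?S\<^esub> hom_part c x" if "r \<in> part ?S e" for c e r x
    using that by (simp add: std_poly_ring_simps hom_part_mult)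
  show "\<exists>E. finite E \<and> x = (\<Oplus>\<^bsub>?S\<^esub>e\<in>E. hom_part e x)" if x: "x \<in> carrier ?S" for x
  proof (intro exI conjI)
    let ?E = "mon_degree ` Poly_Mapping.keys x"
    show "finite ?E" by simp
    have "(\<Sum>e\<in>?E. hom_part e x) = x"
      by (rule poly_mapping_eqI) (auto simp: lookup_sum lookup_hom_part sum.delta' in_keys_iff)
    then show "x = (\<Oplus>\<^bsub>?S\<^esub>e\<in>?E. hom_part e x)"
      using std_finsum[of ?E "\<lambda>e. hom_part e x" n] x pc by (simp add: std_poly_ring_simps)
  qed
  show "hom_part c x = x" if "x \<in> part ?S c" for c x
    using that by (auto simp: std_poly_ring_simps intro!: hom_part_id)
  show "hom_part c x = \<zero>\<^bsub>?S\<^esub>" if "x \<in> part ?S j" "c \<noteq> j" for c j x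
    using that by (auto simp: std_poly_ring_simps intro!: hom_part_other)
qed (auto simp: std_poly_ring_simps keys_hom_part hom_part_add mon_degree_def)

section \<open>Groebner bases\<close>

text \<open>There is a monotone subsequence; if it is decreasing, it reaches its minimum and is
  constant from there on.\<close>

lemma nat_seq_increasing_subseq:
  fixes g :: "nat \<Rightarrow> nat"
  obtains r :: "nat \<Rightarrow> nat" where "strict_mono r" "incseq (\<lambda>k. g (r k))"
proof -
  obtain r where r: "strict_mono r" "monoseq (\<lambda>k. g (r k))" using seq_monosub by blast
  show ?thesis
  proof (cases "incseq (\<lambda>k. g (r k))")
    case True
    then show ?thesis using that r by blast
  next
    case False
    then have dec: "decseq (\<lambda>k. g (r k))" using r(2) by (simp add: monoseq_iff)
    define m where "m = (LEAST y. \<exists>k. y = g (r k))"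
    have "\<exists>k. m = g (r k)" unfolding m_def by (rule LeastI_ex) blast
    then obtain N where N: "m = g (r N)" by blast
    have "g (r (k + N)) = m" for k
    proof (rule antisym)
      show "g (r (k + N)) \<le> m" using dec N by (simp add: decseq_def)
      show "m \<le> g (r (k + N))" unfolding m_def by (rule Least_le) blast
    qed
    then have "incseq (\<lambda>k. g (r (k + N)))" by (simp add: incseq_def)
    moreover have "strict_mono (\<lambda>k. r (k + N))" using r(1) by (simp add: strict_mono_def)
    ultimately show ?thesis using that[of "\<lambda>k. r (k + N)"] by simp
  qed
qed

text \<open>One coordinate after the other: a further subsequence keeps the coordinates already
  treated nondecreasing.\<close>

lemma dickson_sequence:
  fixes f :: "nat \<Rightarrow> 'i \<Rightarrow> nat"
  assumes "finite I"
  obtains r :: "nat \<Rightarrow> nat" where "strict_mono r" "\<And>i. i \<in> I \<Longrightarrow> incseq (\<lambda>k. f (r k) i)"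
proof -
  have "\<exists>r. strict_mono r \<and> (\<forall>i\<in>I. incseq (\<lambda>k. f (r k) i))" using assms
  proof (induction I)
    case empty
    show ?case by (intro exI[of _ id]) (simp add: strict_mono_def)
  next
    case (insert i I)
    then obtain r where r: "strict_mono r" "\<And>i. i \<in> I \<Longrightarrow> incseq (\<lambda>k. f (r k) i)" by blast
    obtain q where q: "strict_mono q" "incseq (\<lambda>k. f (r (q k)) i)"
      by (rule nat_seq_increasing_subseq[of "\<lambda>k. f (r k) i"])
    have "incseq (\<lambda>k. f (r (q k)) j)" if "j \<in> I" for j
      using r(2)[OF that] strict_mono_less_eq[OF q(1)] by (simp add: incseq_def)
    then show ?case using q strict_mono_o[OF r(1) q(1)]
      by (intro exI[of _ "\<lambda>k. r (q k)"]) (auto simp: comp_def)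
  qed
  then show ?thesis using that by blast
qed

text \<open>A pair \<open>(l, \<mu>)\<close> stands for the monomial with exponents
  \<open>\<mu>\<close> times the \<open>l\<close>-th basis vector of a free module; this is
  divisibility of such monomials.\<close>

definition pos_dvd :: "nat \<times> (nat \<Rightarrow>\<^sub>0 nat) \<Rightarrow> nat \<times> (nat \<Rightarrow>\<^sub>0 nat) \<Rightarrow> bool" where
  "pos_dvd w w' \<longleftrightarrow> fst w = fst w' \<and> (\<forall>i. Poly_Mapping.lookup (snd w) i \<le> Poly_Mapping.lookup (snd w') i)"

definition positions :: "nat \<Rightarrow> nat \<Rightarrow> (nat \<times> (nat \<Rightarrow>\<^sub>0 nat)) set" where
  "positions n b = {(l, \<mu>). l < b \<and> Poly_Mapping.keys \<mu> \<subseteq> {..<n}}"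

text \<open>The two extra coordinates \<open>l\<close> and \<open>b - l\<close> force the index \<open>l\<close> of the basis vector to be
  constant along an increasing sequence.\<close>

lemma positions_sequence:
  fixes w :: "nat \<Rightarrow> nat \<times> (nat \<Rightarrow>\<^sub>0 nat)"
  assumes "\<And>k. w k \<in> positions n b"
  shows "\<exists>r :: nat \<Rightarrow> nat. strict_mono r \<and> (\<forall>p q. p \<le> q \<longrightarrow> pos_dvd (w (r p)) (w (r q)))"
proof -
  define f where "f k i = (if i < n then Poly_Mapping.lookup (snd (w k)) i
      else if i = n then fst (w k) else b - fst (w k))" for k i
  obtain r where r: "strict_mono r" "\<And>i. i \<in> {..Suc n} \<Longrightarrow> incseq (\<lambda>k. f (r k) i)"
    using dickson_sequence[of "{..Suc n}" f] by auto
  have "pos_dvd (w (r p)) (w (r q))" if "p \<le> q" for p q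
  proof -
    have le: "f (r p) i \<le> f (r q) i" if "i \<le> Suc n" for i
      using r(2)[of i] that \<open>p \<le> q\<close> by (simp add: incseq_def)
    have b: "fst (w k) < b" and z: "i \<ge> n \<Longrightarrow> Poly_Mapping.lookup (snd (w k)) i = 0" for k i
      using assms[of k] by (auto simp: positions_def in_keys_iff subset_iff not_less)
    have "fst (w (r p)) = fst (w (r q))"
      using le[of n] le[of "Suc n"] b[of "r p"] b[of "r q"] by (simp add: f_def)
    moreover have "Poly_Mapping.lookup (snd (w (r p))) i \<le> Poly_Mapping.lookup (snd (w (r q))) i" for i
      using le[of i] z[of i "r p"] by (cases "i < n") (simp_all add: f_def)
    ultimately show ?thesis by (simp add: pos_dvd_def)
  qed
  then show ?thesis using r(1) by blast
qed

text \<open>The order on exponents is lexicographic: the smallest index at which they differ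
  decides. With its invariance under addition this yields that divisors are not larger, see
  \<open>pos_dvd_le\<close>.\<close>

lemma poly_mapping_nonneg: "(0 :: nat \<Rightarrow>\<^sub>0 nat) \<le> \<nu>"
proof (cases "\<nu> = 0")
  case False
  then have ne: "Poly_Mapping.keys \<nu> \<noteq> {}" by (simp add: keys_eq_empty)
  let ?k = "Min (Poly_Mapping.keys \<nu>)"
  have "?k \<in> Poly_Mapping.keys \<nu>" using ne by simp
  moreover have "k' \<notin> Poly_Mapping.keys \<nu>" if "k' < ?k" for k' using that ne Min_le[of "Poly_Mapping.keys \<nu>" k'] by auto
  ultimately have "less_fun (Poly_Mapping.lookup 0) (Poly_Mapping.lookup \<nu>)"
    unfolding less_fun_def by (intro exI[of _ ?k]) (auto simp: in_keys_iff)
  then show ?thesis by (simp add: less_eq_poly_mapping.rep_eq)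
qed simp

lemma pos_dvdE:
  assumes "pos_dvd w w'"
  obtains \<nu> where "snd w' = \<nu> + snd w" "Poly_Mapping.keys \<nu> \<subseteq> Poly_Mapping.keys (snd w')"
proof
  let ?\<nu> = "snd w' - snd w"
  show "snd w' = ?\<nu> + snd w"
    by (rule poly_mapping_eqI) (use assms in \<open>simp add: pos_dvd_def lookup_add lookup_minus\<close>)
  show "Poly_Mapping.keys ?\<nu> \<subseteq> Poly_Mapping.keys (snd w')"
    by (auto simp: in_keys_iff lookup_minus)
qed

lemma pos_dvd_le: "pos_dvd w w' \<Longrightarrow> w \<le> w'"
proof -
  assume d: "pos_dvd w w'"
  then obtain \<nu> where \<nu>: "snd w' = \<nu> + snd w" by (rule pos_dvdE)
  have "0 + snd w \<le> \<nu> + snd w" by (intro add_right_mono poly_mapping_nonneg)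
  then have "snd w \<le> snd w'" using \<nu> by simp
  then show ?thesis using d by (cases w, cases w') (simp add: pos_dvd_def)
qed

text \<open>With infinitely many variables the lexicographic order is not well-founded, as the
  variables themselves form a descending chain. With \<open>n\<close> variables a descending
  sequence would contain an earlier term that divides a later one, and divisors are not
  larger.\<close>

lemma wf_positions: "wf {(w', w). w' \<in> positions n b \<and> w \<in> positions n b \<and> w' < w}"
  unfolding wf_iff_no_infinite_down_chain
proof
  assume "\<exists>w. \<forall>i. (w (Suc i), w i) \<in> {(w', w). w' \<in> positions n b \<and> w \<in> positions n b \<and> w' < w}"
  then obtain w where w: "\<And>i. w i \<in> positions n b" "\<And>i. w (Suc i) < w i" by blast
  obtain r :: "nat \<Rightarrow> nat" where r': "strict_mono r \<and> (\<forall>p q. p \<le> q \<longrightarrow> pos_dvd (w (r p)) (w (r q)))"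
    by (rule exE[OF positions_sequence[of w n b, OF w(1)]])
  then have r: "strict_mono r" "\<And>p q. p \<le> q \<Longrightarrow> pos_dvd (w (r p)) (w (r q))" by simp_all
  have "w j < w i" if "i < j" for i j
    using that
  proof (induction j)
    case (Suc j)
    then show ?case using w(2)[of j] by (cases "i = j") (auto intro: less_trans)
  qed simp
  moreover have "r 0 < r 1" using r(1) by (simp add: strict_mono_def)
  ultimately have "w (r 1) < w (r 0)" by blast
  then show False using pos_dvd_le[OF r(2)[of 0 1]] by simp
qed

text \<open>The witness \<open>?L0\<close> consists of the elements minimal for divisibility.
  Infinitely many of them would include two distinct ones with one dividing the other; that every
  element has a minimal divisor follows by descent along the well-founded order.\<close>

lemma dickson:
  assumes L: "L \<subseteq> positions n b"
  shows "\<exists>L0. finite L0 \<and> L0 \<subseteq> L \<and> (\<forall>w\<in>L. \<exists>w0\<in>L0. pos_dvd w0 w)"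
proof (intro exI conjI)
  let ?L0 = "{w \<in> L. \<forall>w'\<in>L. pos_dvd w' w \<longrightarrow> w' = w}"
  show "?L0 \<subseteq> L" by blast
  show "finite ?L0"
  proof (rule ccontr)
    assume "infinite ?L0"
    then obtain w :: "nat \<Rightarrow> _" where w: "inj w" "range w \<subseteq> ?L0" using infinite_countable_subset by blast
    have wp: "w k \<in> positions n b" for k using w(2) L by blast
    obtain r :: "nat \<Rightarrow> nat" where r': "strict_mono r \<and> (\<forall>p q. p \<le> q \<longrightarrow> pos_dvd (w (r p)) (w (r q)))"
    by (rule exE[OF positions_sequence[of w n b, OF wp]])
  then have r: "strict_mono r" "\<And>p q. p \<le> q \<Longrightarrow> pos_dvd (w (r p)) (w (r q))" by simp_all
    have "pos_dvd (w (r 0)) (w (r 1))" by (rule r(2)) simp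
    then have "w (r 0) = w (r 1)" using w(2) by blast
    then have "r 0 = r 1" using w(1) by (simp add: inj_def)
    then show False using r(1) strict_monoD[of r 0 1] by simp
  qed
  have "w \<in> L \<longrightarrow> (\<exists>w0\<in>?L0. pos_dvd w0 w)" for w
  proof (induction w rule: wf_induct_rule[OF wf_positions[of n b]])
    case (1 w)
    show ?case
    proof
      assume w: "w \<in> L"
      show "\<exists>w0\<in>?L0. pos_dvd w0 w"
      proof (cases "w \<in> ?L0")
        case True
        then show ?thesis by (intro bexI[of _ w]) (auto simp: pos_dvd_def)
      next
        case False
        then obtain w' where w': "w' \<in> L" "pos_dvd w' w" "w' \<noteq> w" using w by blast
        then have "w' < w" using pos_dvd_le[OF w'(2)] by simp
        then obtain w0 where "w0 \<in> ?L0" "pos_dvd w0 w'" using 1 w w' L by blast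
        then show ?thesis using w'(2) by (intro bexI[of _ w0]) (auto simp: pos_dvd_def intro: order_trans)
      qed
    qed
  qed
  then show "\<forall>w\<in>L. \<exists>w0\<in>?L0. pos_dvd w0 w" by blast
qed

lemma lookup_single_mult:
  fixes p :: "(nat \<Rightarrow>\<^sub>0 nat) \<Rightarrow>\<^sub>0 'k::field"
  shows "Poly_Mapping.lookup (Poly_Mapping.single \<nu> c * p) (\<nu> + \<mu>) = c * Poly_Mapping.lookup p \<mu>"
  by (simp add: lookup_mult lookup_single when_mult)

definition supp :: "nat \<Rightarrow> (nat \<Rightarrow> ((nat \<Rightarrow>\<^sub>0 nat) \<Rightarrow>\<^sub>0 'k::zero)) \<Rightarrow> (nat \<times> (nat \<Rightarrow>\<^sub>0 nat)) set" where
  "supp b v = (SIGMA l:{..<b}. Poly_Mapping.keys (v l))"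

lemma finite_supp [simp]: "finite (supp b v)"
  unfolding supp_def by (intro finite_SigmaI) auto

lemma supp_iff: "(l, \<mu>) \<in> supp b v \<longleftrightarrow> l < b \<and> Poly_Mapping.lookup (v l) \<mu> \<noteq> 0"
  by (simp add: supp_def in_keys_iff)

text \<open>The elements of the finite generating set are homogeneous and have the minimal leading
  positions of \<open>V\<close>; the division algorithm shows that they generate.\<close>

lemma homogeneous_groebner_basis:
  fixes V :: "(nat \<Rightarrow> ((nat \<Rightarrow>\<^sub>0 nat) \<Rightarrow>\<^sub>0 'k::field)) set" and s :: "nat \<Rightarrow> int"
  assumes car: "\<And>v l. v \<in> V \<Longrightarrow> l < b \<Longrightarrow> v l \<in> poly_car n"
    and zero: "\<And>v l. v \<in> V \<Longrightarrow> b \<le> l \<Longrightarrow> v l = 0"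
    and add: "\<And>v w. v \<in> V \<Longrightarrow> w \<in> V \<Longrightarrow> (\<lambda>l. v l + w l) \<in> V"
    and mult: "\<And>v \<nu> c. v \<in> V \<Longrightarrow> Poly_Mapping.keys \<nu> \<subseteq> {..<n} \<Longrightarrow> (\<lambda>l. Poly_Mapping.single \<nu> c * v l) \<in> V"
    and hom: "\<And>v c. v \<in> V \<Longrightarrow> (\<lambda>l. hom_part (c - s l) (v l)) \<in> V"
  obtains G where "finite G" "G \<subseteq> V" "\<And>g. g \<in> G \<Longrightarrow> \<exists>c. \<forall>l. hom_part (c - s l) (g l) = g l"
    "\<And>W. (\<lambda>l. 0) \<in> W \<Longrightarrow>
      (\<And>v g \<nu> c. v \<in> W \<Longrightarrow> g \<in> G \<Longrightarrow> Poly_Mapping.keys \<nu> \<subseteq> {..<n} \<Longrightarrow>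
         (\<lambda>l. v l + Poly_Mapping.single \<nu> c * g l) \<in> W) \<Longrightarrow> V \<subseteq> W"
proof -
  define L where "L = {Max (supp b v) | v. v \<in> V \<and> supp b v \<noteq> {}}"
  have supp_pos: "supp b v \<subseteq> positions n b" if "v \<in> V" for v
    using car[OF that] by (auto simp: supp_def positions_def)
  have "L \<subseteq> positions n b"
  proof
    fix w assume "w \<in> L"
    then obtain v where v: "v \<in> V" "supp b v \<noteq> {}" "w = Max (supp b v)" by (auto simp: L_def)
    show "w \<in> positions n b"
      using Max_in[OF finite_supp v(2)] supp_pos[OF v(1)] v(3) by blast
  qed
  from dickson[OF this] obtain L0
    where L0: "finite L0" "L0 \<subseteq> L" "\<And>w. w \<in> L \<Longrightarrow> \<exists>w0\<in>L0. pos_dvd w0 w"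
    by blast
  have "\<exists>g. g \<in> V \<and> (\<exists>c. \<forall>l. hom_part (c - s l) (g l) = g l) \<and> supp b g \<noteq> {} \<and> Max (supp b g) = w"
    if w: "w \<in> L" for w
  proof -
    obtain v where v: "v \<in> V" "supp b v \<noteq> {}" "w = Max (supp b v)" using w by (auto simp: L_def)
    \<comment> \<open>The degree of the leading monomial. Passing to this homogeneous component
      keeps the leading position: the support only shrinks, and \<open>w\<close> survives.\<close>
    let ?c = "mon_degree (snd w) + s (fst w)"
    let ?g = "\<lambda>l. hom_part (?c - s l) (v l)"
    obtain l \<mu> where wl: "w = (l, \<mu>)" by fastforce
    have "w \<in> supp b v" using Max_in[OF finite_supp v(2)] v(3) by simp
    then have w': "w \<in> supp b ?g" by (simp add: wl supp_iff lookup_hom_part)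
    have "supp b ?g \<subseteq> supp b v" by (auto simp: supp_iff lookup_hom_part split: if_splits)
    then have "Max (supp b ?g) = w"
      using v(3) w' by (intro Max_eqI) (auto intro: Max_ge)
    moreover have "\<forall>l. hom_part (?c - s l) (?g l) = ?g l"
      by (auto intro!: hom_part_id simp: keys_hom_part)
    ultimately show ?thesis using hom[OF v(1), of ?c] w' by blast
  qed
  then obtain g where g: "\<And>w. w \<in> L \<Longrightarrow> g w \<in> V \<and> (\<exists>c. \<forall>l. hom_part (c - s l) (g w l) = g w l) \<and>
      supp b (g w) \<noteq> {} \<and> Max (supp b (g w)) = w" by metis
  show ?thesis
  proof
    show "finite (g ` L0)" using L0(1) by simp
    show "g ` L0 \<subseteq> V" using g L0(2) by blast
    show "\<exists>c. \<forall>l. hom_part (c - s l) (h l) = h l" if "h \<in> g ` L0" for h using that g L0(2) by blast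
    \<comment> \<open>Quantifying over all sets with these closure properties expresses generation
      without a notion of span.\<close>
    fix W
    assume W0: "(\<lambda>l. 0) \<in> W" and W: "\<And>v h \<nu> c. v \<in> W \<Longrightarrow> h \<in> g ` L0 \<Longrightarrow> Poly_Mapping.keys \<nu> \<subseteq> {..<n} \<Longrightarrow>
         (\<lambda>l. v l + Poly_Mapping.single \<nu> c * h l) \<in> W"
    have zeroW: "v \<in> W" if "v \<in> V" "supp b v = {}" for v
    proof -
      have "v l = 0" for l
        using zero[OF that(1), of l] that(2) supp_iff[of l _ b v]
        by (cases "l < b") (auto intro: poly_mapping_eqI)
      then have "v = (\<lambda>l. 0)" by blast
      then show ?thesis using W0 by simp
    qed
    have "\<forall>v\<in>V. supp b v \<noteq> {} \<longrightarrow> Max (supp b v) = w \<longrightarrow> v \<in> W" for w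
    proof (induction w rule: wf_induct_rule[OF wf_positions[of n b]])
      case (1 w)
      show ?case
      proof (intro ballI impI)
        fix v assume v: "v \<in> V" "supp b v \<noteq> {}" "Max (supp b v) = w"
        have wL: "w \<in> L" using v by (auto simp: L_def)
        have ws: "w \<in> supp b v" using Max_in[OF finite_supp v(2)] v(3) by simp
        obtain w0 where w0: "w0 \<in> L0" "pos_dvd w0 w" using L0(3)[OF wL] by blast
        obtain l \<mu> where wl: "w = (l, \<mu>)" by fastforce
        obtain \<mu>0 where w0l: "w0 = (l, \<mu>0)" using w0(2) wl by (cases w0) (auto simp: pos_dvd_def)
        obtain \<nu> where \<nu>: "\<mu> = \<nu> + \<mu>0" "Poly_Mapping.keys \<nu> \<subseteq> Poly_Mapping.keys \<mu>"
          using pos_dvdE[OF w0(2)] wl w0l by auto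
        have "w \<in> positions n b" using supp_pos[OF v(1)] ws by blast
        then have \<nu>n: "Poly_Mapping.keys \<nu> \<subseteq> {..<n}" using \<nu>(2) wl by (auto simp: positions_def)
        let ?g = "g w0"
        have gw: "?g \<in> V" "supp b ?g \<noteq> {}" "Max (supp b ?g) = w0" using g w0(1) L0(2) by blast+
        have w0s: "w0 \<in> supp b ?g" using Max_in[OF finite_supp gw(2)] gw(3) by simp
        \<comment> \<open>The quotient of the leading coefficients. Subtracting this multiple of
          \<open>?g\<close> cancels the leading term of \<open>v\<close> and brings in no larger
          position, since adding \<open>\<nu>\<close> preserves the order.\<close>
        define c where "c = Poly_Mapping.lookup (v l) \<mu> / Poly_Mapping.lookup (?g l) \<mu>0"
        define v' where "v' = (\<lambda>l. v l + Poly_Mapping.single \<nu> (- c) * ?g l)"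
        have v'V: "v' \<in> V" unfolding v'_def by (intro add mult v(1) gw(1) \<nu>n)
        have lt: "p < w" if p: "p \<in> supp b v'" for p
        proof -
          obtain m \<alpha> where pm: "p = (m, \<alpha>)" by fastforce
          have m: "m < b" and nz: "Poly_Mapping.lookup (v' m) \<alpha> \<noteq> 0" using p pm by (auto simp: supp_iff)
          have le: "p \<le> w"
          proof (cases "Poly_Mapping.lookup (v m) \<alpha> = 0")
            case False
            then have "p \<in> supp b v" using pm m by (simp add: supp_iff)
            then show ?thesis using Max_ge[OF finite_supp] v(3) by blast
          next
            case True
            then have "\<alpha> \<in> Poly_Mapping.keys (Poly_Mapping.single \<nu> (- c) * ?g m)"
              using nz by (simp add: v'_def lookup_add in_keys_iff)
            then obtain \<beta> where \<beta>: "\<alpha> = \<nu> + \<beta>" "\<beta> \<in> Poly_Mapping.keys (?g m)"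
              using Poly_Mapping.keys_mult[of "Poly_Mapping.single \<nu> (- c)" "?g m"] by (auto split: if_splits)
            have "(m, \<beta>) \<in> supp b ?g" using m \<beta>(2) by (simp add: supp_def)
            then have "(m, \<beta>) \<le> (l, \<mu>0)" using Max_ge[OF finite_supp] gw(3) w0l by metis
            then show ?thesis unfolding pm wl \<beta>(1) \<nu>(1) by (auto intro: add_left_mono)
          qed
          have "Poly_Mapping.lookup (v' l) \<mu> = 0"
            using w0s w0l unfolding v'_def \<nu>(1)
            by (simp add: lookup_add lookup_single_mult c_def supp_iff \<nu>(1))
          then have "p \<noteq> w" using nz pm wl by auto
          then show ?thesis using le by simp
        qed
        have v'W: "v' \<in> W"
        proof (cases "supp b v' = {}")
          case True
          then show ?thesis by (rule zeroW[OF v'V])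
        next
          case False
          have M: "Max (supp b v') \<in> supp b v'" by (rule Max_in[OF finite_supp False])
          then have "(Max (supp b v'), w) \<in> {(w', w). w' \<in> positions n b \<and> w \<in> positions n b \<and> w' < w}"
            using lt supp_pos[OF v'V] supp_pos[OF v(1)] ws by blast
          then show ?thesis using 1 v'V False by blast
        qed
        have "v = (\<lambda>l. v' l + Poly_Mapping.single \<nu> c * ?g l)"
          by (simp add: v'_def fun_eq_iff single_uminus)
        then show "v \<in> W" using W[OF v'W imageI[OF w0(1)] \<nu>n, of c] by simp
      qed
    qed
    then show "V \<subseteq> W" using zeroW by blast
  qed
qed

section \<open>Finite generation of graded submodules of free modules\<close>

context gring
begin

definition stable_submodule :: "nat \<Rightarrow> (nat \<Rightarrow> int) \<Rightarrow> (nat \<Rightarrow> 'a) set \<Rightarrow> bool" where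
  "stable_submodule b s N \<longleftrightarrow> submodule N R (free_module R b s) \<and> (\<forall>c. \<forall>v\<in>N. free_proj \<pi> b s c v \<in> N)"

text \<open>Restricted to graded submodules of free modules of finite rank, since the syzygies are
  of this kind. The degrees \<open>s'\<close> of the generators become the shifts of the next free
  module of a resolution.\<close>

definition graded_noetherian :: bool where
  "graded_noetherian \<longleftrightarrow> (\<forall>b s N. stable_submodule b s N \<longrightarrow>
     (\<exists>b' s' \<gamma>. (\<forall>m<b'. \<gamma> m \<in> N \<and> \<gamma> m \<in> component (free_module R b s) (s' m)) \<and>
        N \<subseteq> lin_comb (free_module R b s) b' \<gamma> ` carrier (free_module R b' s')))"

end

text \<open>The submodule is pulled back to a free module over the polynomial ring, where a
  homogeneous Groebner basis exists; the classes of its elements generate.\<close>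

lemma graded_noetherian_quotient:
  fixes \<aa> :: "((nat \<Rightarrow>\<^sub>0 nat) \<Rightarrow>\<^sub>0 'k::field) set"
  assumes \<aa>: "gring.stable (std_poly_ring n) hom_part \<aa>"
  shows "gring.graded_noetherian (quotient_ring (std_poly_ring n) \<aa>)
           (quot_proj (regular_module (std_poly_ring n)) hom_part \<aa>)"
proof -
  let ?S = "std_poly_ring n :: ((nat \<Rightarrow>\<^sub>0 nat) \<Rightarrow>\<^sub>0 'k) graded_ring"
  let ?R = "quotient_ring ?S \<aa>" and ?p = "quot_proj (regular_module ?S) hom_part \<aa>"
  interpret S: gring ?S hom_part by (rule gring_std_poly_ring)
  interpret R: gring ?R ?p by (rule S.gring_quotient[OF \<aa>])
  have ida: "ideal \<aa> ?S" using \<aa> by (simp add: S.stable_def)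
  interpret a: ideal \<aa> ?S by (rule ida)
  define q where "q x = \<aa> +>\<^bsub>?S\<^esub> x" for x
  have q_add: "q x \<oplus>\<^bsub>?R\<^esub> q y = q (x + y)" if "x \<in> poly_car n" "y \<in> poly_car n" for x y
    using a.a_rcos_sum[of x y] that by (simp add: q_def quotient_ring_def FactRing_def std_poly_ring_simps)
  have q_mult: "q x \<otimes>\<^bsub>?R\<^esub> q y = q (x * y)" if "x \<in> poly_car n" "y \<in> poly_car n" for x y
    using a.rcoset_mult_add[of x y] that by (simp add: q_def quotient_ring_def FactRing_def std_poly_ring_simps)
  have q_zero: "q 0 = \<zero>\<^bsub>?R\<^esub>"
    using S.a_coset_add_zero[OF a.a_subset] by (simp add: q_def quotient_ring_def FactRing_def std_poly_ring_simps)
  have q_car: "carrier ?R = q ` poly_car n"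
    by (auto simp: q_def quotient_ring_def FactRing_def A_RCOSETS_def' std_poly_ring_simps)
  have q_proj: "?p c (q x) = q (hom_part c x)" if "x \<in> poly_car n" for c x
    using gmod.quot_proj_coset[OF S.gmod_regular S.ideal_submodule[OF ida], of x c] \<aa> that
    by (simp add: S.stable_def S.regular_coset q_def std_poly_ring_simps)
  have hp: "hom_part c x \<in> poly_car n" if "x \<in> poly_car n" for c and x :: "(nat \<Rightarrow>\<^sub>0 nat) \<Rightarrow>\<^sub>0 'k"
    using that by (auto simp: keys_hom_part)
  have sg: "Poly_Mapping.single \<nu> c \<in> poly_car n" if "Poly_Mapping.keys \<nu> \<subseteq> {..<n}" for \<nu> and c :: 'k
    using that by auto
  show ?thesis unfolding R.graded_noetherian_def
  proof (intro allI impI)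
    fix b s N assume "R.stable_submodule b s N"
    let ?F = "free_module ?R b s"
    have N: "submodule N ?R ?F" and Np: "\<And>c v. v \<in> N \<Longrightarrow> free_proj ?p b s c v \<in> N"
      using \<open>R.stable_submodule b s N\<close> by (auto simp: R.stable_submodule_def)
    interpret F: Module.module ?R ?F by (rule R.module_free)
    note Ns = F.submoduleE[OF N]
    \<comment> \<open>Vectors over the polynomial ring are padded with 0 from \<open>b\<close> on,
      as \<open>homogeneous_groebner_basis\<close> expects; \<open>cl\<close> reduces them
      coordinatewise and makes them extensional.\<close>
    define P where "P = {v :: nat \<Rightarrow> (nat \<Rightarrow>\<^sub>0 nat) \<Rightarrow>\<^sub>0 'k. (\<forall>l<b. v l \<in> poly_car n) \<and> (\<forall>l\<ge>b. v l = 0)}"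
    define cl where "cl v = (\<lambda>l\<in>{..<b}. q (v l))" for v
    have cl_F: "cl v \<in> carrier ?F" if "v \<in> P" for v
      using that q_car by (auto simp: cl_def P_def)
    have P_add: "(\<lambda>l. v l + w l) \<in> P" if vw: "v \<in> P" "w \<in> P" for v w
    proof -
      have "v l + w l \<in> poly_car n" if "l < b" for l
        by (rule poly_car_closed(1)) (use vw that in \<open>simp_all add: P_def\<close>)
      then show ?thesis using vw by (simp add: P_def)
    qed
    have P_mult: "(\<lambda>l. x * v l) \<in> P" if v: "v \<in> P" and x: "x \<in> poly_car n" for v x
    proof -
      have "x * v l \<in> poly_car n" if "l < b" for l
        by (rule poly_car_closed(3)[OF x]) (use v that in \<open>simp_all add: P_def\<close>)
      then show ?thesis using v by (simp add: P_def)
    qed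
    have cl_add: "cl (\<lambda>l. v l + w l) = cl v \<oplus>\<^bsub>?F\<^esub> cl w" if "v \<in> P" "w \<in> P" for v w
      using that q_add by (auto simp: cl_def P_def intro!: restrict_ext)
    have cl_mult: "cl (\<lambda>l. x * v l) = q x \<odot>\<^bsub>?F\<^esub> cl v" if "v \<in> P" "x \<in> poly_car n" for v x
      using that q_mult by (auto simp: cl_def P_def intro!: restrict_ext)
    have cl_proj: "cl (\<lambda>l. hom_part (c - s l) (v l)) = free_proj ?p b s c (cl v)" if "v \<in> P" for c v
      using that q_proj by (auto simp: cl_def P_def free_proj_def intro!: restrict_ext)
    have q_R: "q x \<in> carrier ?R" if "x \<in> poly_car n" for x using that q_car by blast
    define V where "V = {v \<in> P. cl v \<in> N}"
    obtain G where G: "finite G" "G \<subseteq> V" "\<And>g. g \<in> G \<Longrightarrow> \<exists>c. \<forall>l. hom_part (c - s l) (g l) = g l"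
      and gen: "\<And>W. (\<lambda>l. 0) \<in> W \<Longrightarrow>
        (\<And>v g \<nu> c. v \<in> W \<Longrightarrow> g \<in> G \<Longrightarrow> Poly_Mapping.keys \<nu> \<subseteq> {..<n} \<Longrightarrow>
         (\<lambda>l. v l + Poly_Mapping.single \<nu> c * g l) \<in> W) \<Longrightarrow> V \<subseteq> W"
    proof (rule homogeneous_groebner_basis[of V b n s])
      show "v l \<in> poly_car n" if "v \<in> V" "l < b" for v l using that by (simp add: V_def P_def)
      show "v l = 0" if "v \<in> V" "b \<le> l" for v l using that by (simp add: V_def P_def)
      show "(\<lambda>l. v l + w l) \<in> V" if "v \<in> V" "w \<in> V" for v w
        using that P_add cl_add Ns(5) by (simp add: V_def)
      show "(\<lambda>l. Poly_Mapping.single \<nu> c * v l) \<in> V" if "v \<in> V" "Poly_Mapping.keys \<nu> \<subseteq> {..<n}" for v \<nu> c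
        using that(1) P_mult[OF _ sg[OF that(2)]] cl_mult[OF _ sg[OF that(2)]] Ns(4)[OF q_R[OF sg[OF that(2)]]]
        by (simp add: V_def)
      show "(\<lambda>l. hom_part (c - s l) (v l)) \<in> V" if "v \<in> V" for v c
      proof -
        have "hom_part (c - s l) 0 = (0 :: (nat \<Rightarrow>\<^sub>0 nat) \<Rightarrow>\<^sub>0 'k)" for l by (rule hom_part_other) simp
        moreover have "hom_part (c - s l) (v l) \<in> poly_car n" if "l < b" for l
          by (rule hp) (use \<open>v \<in> V\<close> that in \<open>simp add: V_def P_def\<close>)
        ultimately have "(\<lambda>l. hom_part (c - s l) (v l)) \<in> P" using that by (simp add: V_def P_def)
        then show ?thesis using that cl_proj Np by (simp add: V_def)
      qed
    qed blast
    obtain h where h: "bij_betw h {0..<card G} G" using ex_bij_betw_nat_finite[OF G(1)] by blast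
    define b' where "b' = card G"
    define \<gamma> where "\<gamma> m = cl (h m)" for m
    have hG: "h m \<in> G" if "m < b'" for m using h that by (auto simp: bij_betw_def b'_def)
    have "\<forall>m. \<exists>c. m < b' \<longrightarrow> (\<forall>l. hom_part (c - s l) (h m l) = h m l)" using G(3) hG by blast
    then obtain s' where s': "\<And>m l. m < b' \<Longrightarrow> hom_part (s' m - s l) (h m l) = h m l" by metis
    have \<gamma>N: "\<gamma> m \<in> N" and \<gamma>P: "h m \<in> P" if "m < b'" for m
      using hG[OF that] G(2) by (auto simp: \<gamma>_def V_def)
    have \<gamma>F: "\<gamma> m \<in> carrier ?F" if "m < b'" for m using \<gamma>N[OF that] Ns(1) by blast
    have \<gamma>c: "\<gamma> m \<in> component ?F (s' m)" if "m < b'" for m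
    proof -
      have "free_proj ?p b s (s' m) (\<gamma> m) = \<gamma> m"
        unfolding \<gamma>_def cl_proj[OF \<gamma>P[OF that], symmetric] using s'[OF that] by simp
      then show ?thesis using gmod.gproj_in[OF R.gmod_free \<gamma>F[OF that], of "s' m"] by simp
    qed
    let ?F' = "free_module ?R b' s'" and ?f = "lin_comb ?F b' \<gamma>"
    have f: "lin_map ?R ?F' ?F ?f" by (rule R.lin_comb_lin_map[OF R.module_free \<gamma>F])
    define I where "I = ?f ` carrier ?F'"
    have Is: "submodule I ?R ?F" unfolding I_def
      by (rule submodule_image[OF R.module_free R.module_free f Module.module.carrier_is_submodule[OF R.module_free]])
    note IsE = F.submoduleE[OF Is]
    have \<gamma>I: "\<gamma> m \<in> I" if "m < b'" for m
    proof -
      have u: "?f (unit_vec ?R b' m) = \<gamma> m"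
        by (rule R.lin_comb_unit_vec[OF R.module_free _ that]) (rule \<gamma>F)
      have "?f (unit_vec ?R b' m) \<in> I" unfolding I_def by (rule imageI[OF R.unit_vec_carrier])
      then show ?thesis by (simp only: u)
    qed
    \<comment> \<open>The set on the right is taken for \<open>W\<close>: it consists of the vectors
      whose classes lie in the submodule generated by the \<open>\<gamma> m\<close>.\<close>
    have "V \<subseteq> {v \<in> P. cl v \<in> I}"
    proof (rule gen)
      have "cl (\<lambda>l. 0) = \<zero>\<^bsub>?F\<^esub>" by (simp add: cl_def q_zero)
      then show "(\<lambda>l. 0) \<in> {v \<in> P. cl v \<in> I}"
        using submodule_zero[OF R.module_free Is] by (simp add: P_def)
      fix v g and \<nu> :: "nat \<Rightarrow>\<^sub>0 nat" and c :: 'k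
      assume v: "v \<in> {v \<in> P. cl v \<in> I}" and g: "g \<in> G" and \<nu>: "Poly_Mapping.keys \<nu> \<subseteq> {..<n}"
      have "g \<in> h ` {0..<b'}" using g h by (simp add: bij_betw_def b'_def)
      then obtain m where m: "m < b'" "g = h m" by auto
      have gP: "g \<in> P" using \<gamma>P m by simp
      note gm = P_mult[OF gP sg[OF \<nu>, of c]]
      have "cl (\<lambda>l. Poly_Mapping.single \<nu> c * g l) \<in> I"
        unfolding cl_mult[OF gP sg[OF \<nu>]] using IsE(4)[OF q_R[OF sg[OF \<nu>]] \<gamma>I[OF m(1)]]
        by (simp only: m(2) \<gamma>_def)
      then show "(\<lambda>l. v l + Poly_Mapping.single \<nu> c * g l) \<in> {v \<in> P. cl v \<in> I}"
        using v P_add[OF _ gm] cl_add[OF _ gm] IsE(5) by simp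
    qed
    moreover have "\<exists>v\<in>P. cl v = y" if y: "y \<in> carrier ?F" for y
    proof -
      have ql: "y l \<in> q ` poly_car n" if "l < b" for l using y that by (simp add: q_car PiE_iff)
      define x where "x l = inv_into (poly_car n) q (y l)" for l
      have x: "x l \<in> poly_car n \<and> y l = q (x l)" if "l < b" for l
        using inv_into_into[OF ql[OF that]] f_inv_into_f[OF ql[OF that]] unfolding x_def by (intro conjI) simp_all
      have "cl (\<lambda>l. if l < b then x l else 0) = y"
        using x y by (intro extensionalityI[of _ "{..<b}"]) (auto simp: cl_def PiE_iff)
      moreover have "(\<lambda>l. if l < b then x l else 0) \<in> P" using x by (simp add: P_def)
      ultimately show ?thesis by blast
    qed
    ultimately have "N \<subseteq> I" using Ns(1) unfolding V_def by blast
    then show "\<exists>b' s' \<gamma>. (\<forall>m<b'. \<gamma> m \<in> N \<and> \<gamma> m \<in> component ?F (s' m)) \<and>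
        N \<subseteq> lin_comb ?F b' \<gamma> ` carrier (free_module ?R b' s')"
      using \<gamma>N \<gamma>c unfolding I_def by blast
  qed
qed

section \<open>Existence of resolutions\<close>

lemma hom_module_componentI:
  assumes "lin_map R M N \<phi>" "\<phi> \<in> extensional (carrier M)"
    and "\<And>c v. v \<in> component M c \<Longrightarrow> \<phi> v \<in> component N (c + a)"
  shows "\<phi> \<in> component (hom_module R M N) a"
  unfolding hom_module_component hom_module_carrier image_subset_iff using assms by blast

context gring
begin

text \<open>Complements \<open>gproj_smult\<close>: here the scalar is arbitrary and the vector
  homogeneous. It holds because the coordinates of \<open>y\<close> are homogeneous ring elements
  and multiplication is commutative.\<close>

lemma free_proj_compat:
  assumes r: "r \<in> carrier R" and y: "y \<in> component (free_module R b s) e"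
  shows "free_proj \<pi> b s c (r \<odot>\<^bsub>free_module R b s\<^esub> y) = \<pi> (c - e) r \<odot>\<^bsub>free_module R b s\<^esub> y"
proof -
  have "\<pi> (c - s l) (r \<otimes> y l) = \<pi> (c - e) r \<otimes> y l" if "l < b" for l
  proof -
    have yl: "y l \<in> part R (e - s l)" using y that by auto
    show ?thesis
      using proj_mult[OF yl r, of "c - e"] r part_carr[OF yl] m_comm by (simp add: algebra_simps)
  qed
  then show ?thesis by (auto simp: free_proj_def intro!: restrict_ext)
qed

lemma quot_proj_compat:
  assumes J: "stable J" and r: "r \<in> carrier R" and y: "y \<in> component (quotient_module R J) e"
  shows "quot_proj (regular_module R) \<pi> J c (r \<odot>\<^bsub>quotient_module R J\<^esub> y)
    = \<pi> (c - e) r \<odot>\<^bsub>quotient_module R J\<^esub> y"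
proof -
  have id: "ideal J R" using J by (simp add: stable_def)
  obtain t where t: "t \<in> part R e" "y = J +>\<^bsub>regular_module R\<^esub> t" using y by (auto simp: subquotient_def)
  have tc: "t \<in> carrier R" by (rule part_carr[OF t(1)])
  have sm: "x \<odot>\<^bsub>quotient_module R J\<^esub> y = J +>\<^bsub>regular_module R\<^esub> (x \<otimes> t)" if "x \<in> carrier R" for x
    using coset_smult[OF module_regular ideal_submodule[OF id], of t x] that tc t(2) by (simp add: subquotient_def)
  have "\<pi> c (r \<otimes> t) = \<pi> (c - e) r \<otimes> t"
    using proj_mult[OF t(1) r, of "c - e"] r tc m_comm by (simp add: algebra_simps)
  then show ?thesis
    using gmod.quot_proj_coset[OF gmod_regular ideal_submodule[OF id], of "r \<otimes> t" c] J r tc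
    by (simp add: sm stable_def)
qed

text \<open>The map \<open>f\<close> commutes with the projections. This is seen by expanding
  \<open>v\<close> in basis vectors with inhomogeneous coefficients, which is what
  \<open>compat\<close> is for.\<close>

lemma kernel_stable:
  assumes "gmod R N \<rho>" and f: "lin_map R (free_module R b s) N f"
    and fu: "\<And>l. l < b \<Longrightarrow> f (unit_vec R b l) \<in> component N (s l)"
    and compat: "\<And>r y c e. r \<in> carrier R \<Longrightarrow> y \<in> component N e \<Longrightarrow> \<rho> c (r \<odot>\<^bsub>N\<^esub> y) = \<pi> (c - e) r \<odot>\<^bsub>N\<^esub> y"
  shows "stable_submodule b s {v \<in> carrier (free_module R b s). f v = \<zero>\<^bsub>N\<^esub>}"
proof -
  interpret N: gmod R N \<rho> by fact
  have "f (free_proj \<pi> b s c v) = \<rho> c (f v)" if v: "v \<in> carrier (free_module R b s)" for c v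
  proof -
    have vl: "v l \<in> carrier R" if "l < b" for l using v that by auto
    have fc: "f (unit_vec R b l) \<in> carrier N" if "l < b" for l by (rule lin_map_closed[OF f unit_vec_carrier])
    have pv: "free_proj \<pi> b s c v \<in> carrier (free_module R b s)"
      by (rule gmod.gproj_closed[OF gmod_free v])
    have "\<rho> c (f v) = (\<Oplus>\<^bsub>N\<^esub>l\<in>{..<b}. \<rho> c (v l \<odot>\<^bsub>N\<^esub> f (unit_vec R b l)))"
      unfolding lin_map_free_expand[OF N.module_M f v] lin_comb_def
      by (rule N.gproj_finsum) (use vl fc in auto)
    also have "\<dots> = (\<Oplus>\<^bsub>N\<^esub>l\<in>{..<b}. free_proj \<pi> b s c v l \<odot>\<^bsub>N\<^esub> f (unit_vec R b l))"
      by (rule N.M.finsum_cong'[OF refl])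
        (use vl fc compat[OF _ fu] in \<open>simp_all add: free_proj_def\<close>)
    also have "\<dots> = f (free_proj \<pi> b s c v)"
      unfolding lin_map_free_expand[OF N.module_M f pv] lin_comb_def ..
    finally show ?thesis by simp
  qed
  then show ?thesis
    unfolding stable_submodule_def
    using submodule_kernel[OF module_free N.module_M f] gmod.gproj_closed[OF gmod_free] N.gproj_zero
    by (auto simp del: free_module_simps)
qed

text \<open>Besides a cover of \<open>N\<close> the step returns stability of its kernel, so that it
  can be repeated.\<close>

lemma resolution_step:
  assumes noeth: graded_noetherian and N: "stable_submodule b s N"
  shows "\<exists>b' s' g. g \<in> component (hom_module R (free_module R b' s') (free_module R b s)) 0 \<and>
     g ` carrier (free_module R b' s') = N \<and>
     stable_submodule b' s' {v \<in> carrier (free_module R b' s'). g v = \<zero>\<^bsub>free_module R b s\<^esub>}"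
proof -
  let ?F = "free_module R b s"
  obtain b' s' \<gamma> where \<gamma>: "\<And>m. m < b' \<Longrightarrow> \<gamma> m \<in> N" "\<And>m. m < b' \<Longrightarrow> \<gamma> m \<in> component ?F (s' m)"
    and gen: "N \<subseteq> lin_comb ?F b' \<gamma> ` carrier (free_module R b' s')"
    using noeth N unfolding graded_noetherian_def by blast
  let ?F' = "free_module R b' s'" and ?f = "lin_comb ?F b' \<gamma>"
  let ?g = "restrict ?f (carrier ?F')"
  have Ns: "submodule N R ?F" using N by (simp add: stable_submodule_def)
  have \<gamma>F: "\<gamma> m \<in> carrier ?F" if "m < b'" for m
    using Module.module.submoduleE(1)[OF module_free Ns] \<gamma>(1)[OF that] by blast
  have f: "lin_map R ?F' ?F ?f" by (rule lin_comb_lin_map[OF module_free \<gamma>F])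
  have g: "lin_map R ?F' ?F ?g" using f by (simp add: lin_map_restrict[OF module_free] del: free_module_simps)
  have fu: "?f (unit_vec R b' m) = \<gamma> m" if "m < b'" for m
    by (rule lin_comb_unit_vec[OF module_free _ that]) (rule \<gamma>F)
  have gu: "?g (unit_vec R b' m) \<in> component ?F (s' m)" if "m < b'" for m
    using fu[OF that] \<gamma>(2)[OF that] unit_vec_carrier[of b' m s'] by (simp del: free_module_simps)
  have "?g v \<in> component ?F (c + 0)" if "v \<in> component ?F' c" for v c
    by (rule lin_map_degree[OF gmod_free g _ that]) (use gu in \<open>simp del: free_module_simps restrict_apply\<close>)
  then have "?g \<in> component (hom_module R ?F' ?F) 0"
    by (rule hom_module_componentI[OF g restrict_extensional])
  moreover have "?g ` carrier ?F' = N"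
  proof -
    have "?f v \<in> N" if "v \<in> carrier ?F'" for v
      by (rule lin_map_free_submodule[OF module_free Ns f _ that]) (simp add: fu \<gamma>(1))
    then show ?thesis using gen by (auto simp del: free_module_simps)
  qed
  moreover have "stable_submodule b' s' {v \<in> carrier ?F'. ?g v = \<zero>\<^bsub>?F\<^esub>}"
    by (rule kernel_stable[OF gmod_free g gu free_proj_compat])
  ultimately show ?thesis by blast
qed

lemma graded_free_resolution_exists:
  assumes noeth: graded_noetherian and J: "stable J"
  shows "\<exists>X. graded_free_resolution R (quotient_module R J) X"
proof -
  let ?K = "quotient_module R J" and ?R = "regular_module R"
  let ?F0 = "free_module R 1 (\<lambda>_. 0)"
  let ?\<epsilon> = "restrict (\<lambda>v. J +>\<^bsub>?R\<^esub> v 0) (carrier ?F0)"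
  have sJ: "submodule J R ?R" using J ideal_submodule by (simp add: stable_def)
  have gK: "gmod R ?K (quot_proj ?R \<pi> J)" by (rule gmod_quotient_module[OF J])
  have ev: "lin_map R ?F0 ?R (\<lambda>v. v 0)" by (auto intro!: lin_mapI)
  have q: "lin_map R ?R ?K (\<lambda>r. J +>\<^bsub>?R\<^esub> r)"
    using subquotient_module(2)[OF module_regular Module.module.carrier_is_submodule[OF module_regular] sJ]
    by (simp add: regular_module_def)
  have \<epsilon>: "lin_map R ?F0 ?K ?\<epsilon>"
    using lin_map_compose[OF ev q] by (simp add: lin_map_restrict[OF module_free] del: free_module_simps)
  have \<epsilon>deg: "?\<epsilon> v \<in> component ?K c" if v: "v \<in> component ?F0 c" for v c
  proof -
    have "v \<in> carrier ?F0" using v gmod.comp_sub[OF gmod_free] by blast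
    moreover have "v 0 \<in> part R c" using v by auto
    ultimately show ?thesis using part_carr by (simp add: subquotient_def del: free_module_simps)
  qed
  have \<epsilon>surj: "?\<epsilon> ` carrier ?F0 = carrier ?K"
  proof -
    have "J +>\<^bsub>?R\<^esub> r \<in> ?\<epsilon> ` carrier ?F0" if "r \<in> carrier R" for r
      by (rule image_eqI[of _ _ "\<lambda>l\<in>{..<1}. r"]) (use that in auto)
    then show ?thesis using lin_map_closed[OF \<epsilon>] by (auto simp: subquotient_def simp del: free_module_simps)
  qed
  define N0 where "N0 = {v \<in> carrier ?F0. ?\<epsilon> v = \<zero>\<^bsub>?K\<^esub>}"
  have N0: "stable_submodule 1 (\<lambda>_. 0) N0" unfolding N0_def
    by (rule kernel_stable[OF gK \<epsilon> \<epsilon>deg[OF unit_vec_component] quot_proj_compat[OF J]])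
  \<comment> \<open>The state of the recursion is a rank, the shifts, and the submodule still to be
    covered. \<open>P\<close> fixes the start with one generator of degree 0; by \<open>Q\<close>
    the next submodule is the kernel of the cover just built.\<close>
  define P where "P p T \<longleftrightarrow> stable_submodule (fst T) (fst (snd T)) (snd (snd T)) \<and>
     (p = 0 \<longrightarrow> T = (1, \<lambda>_. 0, N0))" for p :: nat and T
  define Q where "Q T T' g \<longleftrightarrow>
     g \<in> component (hom_module R (free_module R (fst T') (fst (snd T'))) (free_module R (fst T) (fst (snd T)))) 0 \<and>
     g ` carrier (free_module R (fst T') (fst (snd T'))) = snd (snd T) \<and>
     snd (snd T') = {v \<in> carrier (free_module R (fst T') (fst (snd T'))). g v = \<zero>\<^bsub>free_module R (fst T) (fst (snd T))\<^esub>}"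
    for T T' g
  have "\<exists>T. \<forall>p. P p (T p) \<and> (\<exists>g. Q (T p) (T (Suc p)) g)"
  proof (rule dependent_nat_choice)
    show "\<exists>T. P 0 T" using N0 by (intro exI[of _ "(1, \<lambda>_. 0, N0)"]) (simp add: P_def)
    fix T p assume "P p T"
    then have st: "stable_submodule (fst T) (fst (snd T)) (snd (snd T))" by (simp add: P_def)
    obtain b' s' g where g: "g \<in> component (hom_module R (free_module R b' s') (free_module R (fst T) (fst (snd T)))) 0"
      "g ` carrier (free_module R b' s') = snd (snd T)"
      "stable_submodule b' s' {v \<in> carrier (free_module R b' s'). g v = \<zero>\<^bsub>free_module R (fst T) (fst (snd T))\<^esub>}"
      using resolution_step[OF noeth st] by blast
    let ?T = "(b', s', {v \<in> carrier (free_module R b' s'). g v = \<zero>\<^bsub>free_module R (fst T) (fst (snd T))\<^esub>})"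
    have "P (Suc p) ?T" using g(3) unfolding P_def fst_conv snd_conv by blast
    moreover have "Q T ?T g" using g(1,2) unfolding Q_def fst_conv snd_conv by blast
    ultimately show "\<exists>T'. P (Suc p) T' \<and> (\<exists>g. Q T T' g)" by blast
  qed
  then obtain T where T: "\<And>p. P p (T p)" "\<And>p. \<exists>g. Q (T p) (T (Suc p)) g" by blast
  obtain g where g: "\<And>p. Q (T p) (T (Suc p)) (g p)" using T(2) by metis
  have T0: "T 0 = (1, \<lambda>_. 0, N0)" using T(1)[of 0] by (simp add: P_def)
  let ?X = "\<lparr>frank = \<lambda>p. fst (T p), fshift = \<lambda>p. fst (snd (T p)), fdiff = g, faug = ?\<epsilon>\<rparr>"
  have F: "fmod R ?X p = free_module R (fst (T p)) (fst (snd (T p)))" for p by (simp add: fmod_def)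
  have F0: "fmod R ?X 0 = ?F0" by (simp only: F T0 fst_conv snd_conv)
  have "graded_free_resolution R ?K ?X"
    unfolding graded_free_resolution_def F0
  proof (intro conjI allI)
    show "faug ?X \<in> component (hom_module R ?F0 ?K) 0"
      unfolding free_data.simps
      by (rule hom_module_componentI[OF \<epsilon> restrict_extensional]) (simp only: add_0_right \<epsilon>deg)
    show "faug ?X ` carrier ?F0 = carrier ?K" using \<epsilon>surj by simp
    show "fdiff ?X p \<in> component (hom_module R (fmod R ?X (Suc p)) (fmod R ?X p)) 0" for p
      using g[of p] unfolding Q_def F by simp
    show "{v \<in> carrier ?F0. faug ?X v = \<zero>\<^bsub>?K\<^esub>} = fdiff ?X 0 ` carrier (fmod R ?X 1)"
      using g[of 0] unfolding Q_def F T0 N0_def[symmetric] by (simp add: N0_def)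
    show "{v \<in> carrier (fmod R ?X (Suc p)). fdiff ?X p v = \<zero>\<^bsub>fmod R ?X p\<^esub>}
            = fdiff ?X (Suc p) ` carrier (fmod R ?X (Suc (Suc p)))" for p
      using g[of p] g[of "Suc p"] unfolding Q_def F by simp
  qed
  then show ?thesis by blast
qed

end

section \<open>From vanishing components to the linear bound\<close>

lemma beg_ge_component:
  assumes "beg M \<ge> ereal b" "real_of_int i < b"
  shows "component M i = {\<zero>\<^bsub>M\<^esub>}"
proof (rule ccontr)
  assume "component M i \<noteq> {\<zero>\<^bsub>M\<^esub>}"
  then have "beg M \<le> ereal (real_of_int i)" unfolding beg_def by (intro Inf_lower) blast
  then have "ereal b \<le> ereal (real_of_int i)" using assms(1) by (rule order_trans[rotated])
  then show False using assms(2) by simp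
qed

lemma beg_geI:
  assumes "\<And>i. real_of_int i < b \<Longrightarrow> component M i = {\<zero>\<^bsub>M\<^esub>}"
  shows "beg M \<ge> ereal b"
  unfolding beg_def by (rule Inf_greatest) (use assms in \<open>force simp: not_less[symmetric]\<close>)

text \<open>A socle element of degree \<open>a\<close> is the class of a cocycle \<open>z\<close> of
  degree \<open>a\<close>, and that \<open>J\<close> kills the class means that \<open>J z\<close>
  lies in \<open>bd d\<close>; so \<open>socle_cocycle_bd\<close> applies.\<close>

lemma (in socle_chase) socle_component:
  "component (Soc J (cohomology C \<delta> d)) a = {\<zero>\<^bsub>Soc J (cohomology C \<delta> d)\<^esub>}"
proof -
  let ?H = "subquotient (C d) (cyc d) (bd d)"
  interpret C: gmod R "C d" "\<rho> d" by (rule gmod_C)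
  have Jc: "r \<in> carrier R" if "r \<in> J" for r
    using Module.module.submoduleE(1)[OF module_regular J] that by auto
  have cc: "z \<in> carrier (C d)" if "z \<in> cyc d" for z using that by (simp add: cyc_def)
  have zH: "\<zero>\<^bsub>?H\<^esub> = bd d" and cH: "carrier ?H = (\<lambda>z. bd d +>\<^bsub>C d\<^esub> z) ` cyc d"
    and coH: "component ?H a = (\<lambda>z. bd d +>\<^bsub>C d\<^esub> z) ` (cyc d \<inter> component (C d) a)"
    by (auto simp: subquotient_def)
  have sm: "r \<odot>\<^bsub>?H\<^esub> (bd d +>\<^bsub>C d\<^esub> z) = bd d +>\<^bsub>C d\<^esub> (r \<odot>\<^bsub>C d\<^esub> z)" if "r \<in> J" "z \<in> cyc d" for r z
    using coset_smult[OF module_C submodule_bd cc[OF that(2)] Jc[OF that(1)]] by (simp add: subquotient_def)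
  have self: "bd d +>\<^bsub>C d\<^esub> z = bd d \<longleftrightarrow> z \<in> bd d" if "z \<in> carrier (C d)" for z
    by (rule coset_eq_self_iff[OF module_C submodule_bd that])
  have z0: "\<zero>\<^bsub>C d\<^esub> \<in> cyc d" "\<zero>\<^bsub>C d\<^esub> \<in> bd d"
    using submodule_zero[OF module_C] submodule_cyc submodule_bd by blast+
  have bd0: "bd d = bd d +>\<^bsub>C d\<^esub> \<zero>\<^bsub>C d\<^esub>" using self[of "\<zero>\<^bsub>C d\<^esub>"] z0 by simp
  have "X = bd d" if X: "X \<in> carrier ?H" "\<forall>r\<in>J. r \<odot>\<^bsub>?H\<^esub> X = bd d" "X \<in> component ?H a" for X
  proof -
    obtain z where z: "z \<in> cyc d" "z \<in> component (C d) a" "X = bd d +>\<^bsub>C d\<^esub> z" using X(3) coH by blast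
    have "r \<odot>\<^bsub>C d\<^esub> z \<in> bd d" if "r \<in> J" for r
      using X(2) that sm[OF that z(1)] self[of "r \<odot>\<^bsub>C d\<^esub> z"] z(3) cc[OF z(1)] Jc[OF that] by simp
    then have "z \<in> bd d" by (rule socle_cocycle_bd[OF z(1,2)])
    then show ?thesis using self[OF cc[OF z(1)]] z(3) by simp
  qed
  moreover have "bd d \<in> carrier ?H" "bd d \<in> component ?H a"
    unfolding cH coH using bd0 z0(1) C.comp_zero by blast+
  moreover have "r \<odot>\<^bsub>?H\<^esub> bd d = bd d" if "r \<in> J" for r
    using sm[OF that z0(1)] bd0 Jc[OF that] by simp
  ultimately have "{z \<in> carrier ?H. \<forall>r\<in>J. r \<odot>\<^bsub>?H\<^esub> z = bd d} \<inter> component ?H a = {bd d}"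
    by blast
  then show ?thesis unfolding cohomology_eq Soc_def Let_def using zH by simp
qed

theorem theorem1p2:
  fixes n d :: nat
    and \<aa> :: "((nat \<Rightarrow>\<^sub>0 nat) \<Rightarrow>\<^sub>0 'k::field) set"
    and R :: "((nat \<Rightarrow>\<^sub>0 nat) \<Rightarrow>\<^sub>0 'k) set graded_ring"
    and \<mm> I :: "((nat \<Rightarrow>\<^sub>0 nat) \<Rightarrow>\<^sub>0 'k) set set"
  assumes "homogeneous_ideal (std_poly_ring n) \<aa>" and "\<aa> \<noteq> carrier (std_poly_ring n)"
    and "R = std_graded_algebra n \<aa>" and "\<mm> = max_ideal n \<aa>"
    and "homogeneous_ideal R I"
    and "krull_dim (R Quot I) = enat d"
    and "\<exists>c'::real. \<forall>j<d. \<forall>i<d + 2. \<forall>t\<ge>1.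
           beg (Ext R i (quotient_module R \<mm>)
                 (local_cohomology R n (alg_gen n \<aa>) j (quotient_module R (ideal_power R I t))))
             \<ge> ereal (- c' * real t)"
  shows "\<exists>c::real. \<forall>t\<ge>1.
           beg (Soc \<mm> (local_cohomology R n (alg_gen n \<aa>) d (quotient_module R (ideal_power R I t))))
             \<ge> ereal (- c * real t)"
proof -
  let ?S = "std_poly_ring n :: ((nat \<Rightarrow>\<^sub>0 nat) \<Rightarrow>\<^sub>0 'k) graded_ring"
  let ?x = "alg_gen n \<aa>"
  let ?p = "quot_proj (regular_module ?S) hom_part \<aa>"
  interpret S: gring ?S hom_part by (rule gring_std_poly_ring)
  have \<aa>: "S.stable \<aa>" by (rule S.stable_homogeneous[OF assms(1)])
  have R: "R = quotient_ring ?S \<aa>" using assms(3) by (simp add: std_graded_algebra_def)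
  interpret R: gring R ?p unfolding R by (rule S.gring_quotient[OF \<aa>])
  have x1: "?x i \<in> part R 1" if "i < n" for i
  proof -
    have "poly_var i \<in> part ?S 1" using that by (simp add: std_poly_ring_simps poly_var_def mon_degree_def)
    then show ?thesis by (simp add: R alg_gen_def quotient_ring_def)
  qed
  have xR: "?x ` {..<n} \<subseteq> carrier R" using x1 R.part_carr by blast
  have \<mm>: "\<mm> = Idl\<^bsub>R\<^esub> (?x ` {..<n})" using assms(3,4) by (simp add: max_ideal_def)
  have "homogeneous_ideal R \<mm>"
    unfolding homogeneous_ideal_def \<mm> using R.genideal_ideal[OF xR] x1 by (intro conjI exI[of _ "?x ` {..<n}"]) auto
  then have st\<mm>: "R.stable \<mm>" by (rule R.stable_homogeneous)
  then have id\<mm>: "ideal \<mm> R" by (simp add: R.stable_def)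
  have x\<mm>: "?x i \<in> \<mm>" if "i < n" for i
    unfolding \<mm> using R.genideal_self[OF xR] that by blast
  have stI: "R.stable (ideal_power R I t)" for t
    by (rule R.stable_power[OF R.stable_homogeneous[OF assms(5)]])
  define K where "K = quotient_module R \<mm>"
  define X where "X = (SOME X. graded_free_resolution R K X)"
  have "\<exists>X. graded_free_resolution R K X"
    unfolding K_def
    by (rule R.graded_free_resolution_exists[OF graded_noetherian_quotient[OF \<aa>, folded R] st\<mm>])
  then have resX: "graded_free_resolution R K X" unfolding X_def by (rule someI_ex)
  have gK: "gmod R K (quot_proj (regular_module R) ?p \<mm>)"
    unfolding K_def by (rule R.gmod_quotient_module[OF st\<mm>])
  interpret G: gres R ?p K X
    by (intro gres.intro gres_axioms.intro R.gring_axioms gmod.module_M[OF gK] resX)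
  \<comment> \<open>The choice in \<open>Ext\<close> depends on neither the index nor the second
    module, so the one \<open>X\<close> fixed above serves every \<open>Ext\<close> module of the
    hypothesis.\<close>
  have Ext: "Ext R i K N = G.ext_complex i N" for i and N :: "(_, 'z) graded_module"
    unfolding Ext_def Let_def X_def[symmetric] G.ext_complex_def ..
  obtain c' where c': "\<And>j i t. j < d \<Longrightarrow> i < d + 2 \<Longrightarrow> 1 \<le> t \<Longrightarrow>
      beg (Ext R i K (local_cohomology R n ?x j (quotient_module R (ideal_power R I t)))) \<ge> ereal (- c' * real t)"
    using assms(7) unfolding K_def by blast
  \<comment> \<open>The inserted 0 keeps the maximum defined when \<open>F d\<close> has rank 0 and
    makes \<open>\<sigma>\<close> nonnegative. As \<open>X\<close> was fixed before
    \<open>t\<close>, the bound is the same for all powers of \<open>I\<close>.\<close>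
  define \<sigma> where "\<sigma> = Max (insert 0 (fshift X d ` {..<frank X d}))"
  have \<sigma>: "0 \<le> \<sigma>" "\<And>l. l < frank X d \<Longrightarrow> fshift X d l \<le> \<sigma>" unfolding \<sigma>_def by auto
  define c where "c = max c' (real_of_int \<sigma>)"
  have "beg (Soc \<mm> (local_cohomology R n ?x d (quotient_module R (ideal_power R I t)))) \<ge> ereal (- c * real t)"
    if t: "1 \<le> t" for t
  proof (rule beg_geI)
    fix a :: int assume a: "real_of_int a < - c * real t"
    let ?M = "quotient_module R (ideal_power R I t)"
    let ?\<rho> = "quot_proj (regular_module R) ?p (ideal_power R I t)"
    have "c' * real t \<le> c * real t" by (rule mult_right_mono) (simp_all add: c_def)
    then have a1: "real_of_int a < - c' * real t" using a by simp
    \<comment> \<open>Since \<open>t \<ge> 1\<close> and \<open>\<sigma> \<ge> 0\<close>, it follows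
      that \<open>\<sigma> \<le> c * t < - a\<close>; so all degrees \<open>fshift X d l + a\<close>
      are negative.\<close>
    have "real_of_int \<sigma> * 1 \<le> c * real t"
      by (rule mult_mono) (use \<sigma>(1) t in \<open>auto simp: c_def\<close>)
    then have "real_of_int (a + \<sigma>) < 0" using a by simp
    then have a2: "a + \<sigma> < 0" by linarith
    interpret M: gmod R ?M ?\<rho> by (rule R.gmod_quotient_module[OF stI])
    interpret C: cech R ?p ?M ?\<rho> n ?x
      by (intro cech.intro cech_axioms.intro R.gring_axioms M.gmod_axioms x1)
    \<comment> \<open>Monomials have nonnegative degree; the vanishing in negative degrees then
      passes from the polynomial ring to \<open>R\<close> and to its quotient.\<close>
    have low: "component ?M k = {\<zero>\<^bsub>?M\<^esub>}" if k: "k < 0" for k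
    proof -
      have "p = 0" if p: "p \<in> part ?S k" for p
      proof -
        have "\<mu> \<notin> Poly_Mapping.keys p" for \<mu>
        proof
          assume "\<mu> \<in> Poly_Mapping.keys p"
          then have "mon_degree \<mu> = k" using p by (simp add: std_poly_ring_simps)
          moreover have "0 \<le> mon_degree \<mu>" unfolding mon_degree_def by (rule of_nat_0_le_iff)
          ultimately show False using k by simp
        qed
        then have "Poly_Mapping.keys p = {}" by blast
        then show ?thesis by simp
      qed
      moreover have "\<aa> +>\<^bsub>?S\<^esub> 0 = \<zero>\<^bsub>R\<^esub>"
        using S.a_coset_add_zero[OF additive_subgroup.a_subset[OF ideal.axioms(1)], of \<aa>] \<aa>
        by (simp add: R quotient_ring_def FactRing_def S.stable_def std_poly_ring_simps)
      ultimately have "part R k \<subseteq> {\<zero>\<^bsub>R\<^esub>}" unfolding R quotient_ring_def by auto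
      moreover have "ideal_power R I t +>\<^bsub>regular_module R\<^esub> \<zero>\<^bsub>R\<^esub> = \<zero>\<^bsub>?M\<^esub>"
        using coset_eq_self_iff[OF R.module_regular R.ideal_submodule, of "ideal_power R I t" "\<zero>\<^bsub>R\<^esub>"]
          submodule_zero[OF R.module_regular R.ideal_submodule, of "ideal_power R I t"] stI[of t]
        by (simp add: R.stable_def subquotient_def)
      ultimately have "component ?M k \<subseteq> {\<zero>\<^bsub>?M\<^esub>}" by (auto simp: subquotient_def)
      then show ?thesis using M.comp_zero by blast
    qed
    have "socle_chase R ?p \<mm> X C.CM C.CD C.cproj a d"
    proof (intro socle_chase.intro chase.intro chase_axioms.intro socle_chase_axioms.intro)
      show "gres R ?p (quotient_module R \<mm>) X" using G.gres_axioms by (simp only: K_def)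
      show "gmod R (C.CM q) (C.cproj q)" for q by (rule C.gmod_CM)
      show "lin_map R (C.CM q) (C.CM (Suc q)) (C.CD q)" for q by (rule C.CD_lin)
      show "C.CD (Suc q) (C.CD q v) = \<zero>\<^bsub>C.CM (Suc (Suc q))\<^esub>" if "v \<in> carrier (C.CM q)" for q v
        by (rule C.CD_CD[OF that])
      show "C.cproj (Suc q) k (C.CD q v) = C.CD q (C.cproj q k v)" if "v \<in> carrier (C.CM q)" for q v k
        by (rule C.cproj_CD[OF that])
      show "gres.hom_acyclic R X (C.CM (Suc q))" for q
        by (rule G.hom_acyclic_CM[OF C.cech_axioms])
          (use R.quotient_module_annihilates[OF id\<mm> x\<mm>] in \<open>simp add: K_def\<close>)
      show "component (gres.ext_complex R X i (cohomology C.CM C.CD j)) a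
          = {\<zero>\<^bsub>gres.ext_complex R X i (cohomology C.CM C.CD j)\<^esub>}" if "j < d" "i < d + 2" for i j
        using beg_ge_component[OF c'[OF that t] a1] unfolding Ext local_cohomology_def .
      show "component (C.CM 0) (fshift X d l + a) = {\<zero>\<^bsub>C.CM 0\<^esub>}" if "l < frank X d" for l
        by (rule C.CM_zero_component[OF low]) (use \<sigma>(2)[OF that] a2 in simp)
      show "submodule \<mm> R (regular_module R)" by (rule R.ideal_submodule[OF id\<mm>])
    qed
    then show "component (Soc \<mm> (local_cohomology R n ?x d ?M)) a
        = {\<zero>\<^bsub>Soc \<mm> (local_cohomology R n ?x d ?M)\<^esub>}"
      unfolding local_cohomology_def by (rule socle_chase.socle_component)
  qed
  then show ?thesis by blast
qed

end
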